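(* Let $G$ be the fundamental group of a special cube complex. Then $\operatorname{scl}(g)\ge 1/24$ for every nontrivial $g\in G$.
   Context: Special cube complexes are in the sense of Haglund and Wise. Let $Y$ be a connected non-positively curved cube complex (links of vertices are flag complexes). Two oriented edges are parallel if they are related by the equivalence relation generated by: opposite sides of a square, oriented in the same direction, are equivalent. Hyperplanes of $Y$ correspond to parallelism classes of unoriented edges; the edges in the class are said to be dual to the hyperplane. $Y$ is special if: (1) hyperplanes are embedded: no square has two adjacent sides dual to the same hyperplane; (2) hyperplanes are two-sided: no oriented edge is parallel to its reverse; (3) hyperplanes do not (directly) self-osculate: there are no two distinct parallel oriented edges with the same initial vertex that do not form a corner of a square at that vertex; (4) hyperplanes do not inter-osculate: there are no two distinct hyperplanes that cross (have dual edges that are adjacent sides of some square) and also have dual edges which, suitably oriented, share an initial vertex but do not form a corner of a square at that vertex. For $g\in[G,G]$, $\operatorname{cl}(g)$ is the least number of commutators whose product is $g$, and $\operatorname{scl}(g)=\lim_{n\to\infty}\operatorname{cl}(g^n)/n$. If $g^n\in[G,G]$ for some $n\geq 1$, set $\operatorname{scl}(g)=\operatorname{scl}(g^n)/n$; if no positive power of $g$ lies in $[G,G]$, $\operatorname{scl}(g)=\infty$. *)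

theory Defs
  imports "HOL-Analysis.Analysis" "HOL-Algebra.Algebra"
begin

definition loops :: "'a::topological_space set \<Rightarrow> 'a \<Rightarrow> (real \<Rightarrow> 'a) set" where
  "loops S p = {\<gamma>. path \<gamma> \<and> path_image \<gamma> \<subseteq> S \<and> pathstart \<gamma> = p \<and> pathfinish \<gamma> = p}"

definition loop_class :: "'a::topological_space set \<Rightarrow> (real \<Rightarrow> 'a) \<Rightarrow> (real \<Rightarrow> 'a) set" where
  "loop_class S \<gamma> = {\<delta>. homotopic_paths S \<gamma> \<delta>}"

definition fundamental_group :: "'a::topological_space set \<Rightarrow> 'a \<Rightarrow> (real \<Rightarrow> 'a) set monoid" where
  "fundamental_group S p =
     \<lparr>carrier = loop_class S ` loops S p,
      mult = (\<lambda>a b. \<Union>\<gamma>\<in>a. \<Union>\<delta>\<in>b. loop_class S (\<gamma> +++ \<delta>)),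
      one = loop_class S (\<lambda>_. p)\<rparr>"

text \<open>The inverse of a commutator is a commutator, so every element of the derived subgroup is
  a product of commutators, and the minimum below is attained.\<close>

definition cl :: "('a, 'b) monoid_scheme \<Rightarrow> 'a \<Rightarrow> nat" where
  "cl G g = (LEAST k. \<exists>cs. length cs = k \<and> set cs \<subseteq> derived_set G (carrier G) \<and>
                            foldr (\<lambda>x y. x \<otimes>\<^bsub>G\<^esub> y) cs \<one>\<^bsub>G\<^esub> = g)"

definition scl_derived :: "('a, 'b) monoid_scheme \<Rightarrow> 'a \<Rightarrow> real" where
  "scl_derived G g = lim (\<lambda>n. real (cl G (g [^]\<^bsub>G\<^esub> n)) / real n)"

definition scl :: "('a, 'b) monoid_scheme \<Rightarrow> 'a \<Rightarrow> ereal" where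
  "scl G g =
     (if \<exists>n\<ge>1. g [^]\<^bsub>G\<^esub> (n::nat) \<in> derived G (carrier G)
      then let n = (LEAST n::nat. n \<ge> 1 \<and> g [^]\<^bsub>G\<^esub> n \<in> derived G (carrier G))
           in ereal (scl_derived G (g [^]\<^bsub>G\<^esub> n) / real n)
      else \<infinity>)"

text \<open>The standard \<open>n\<close>-cube sits in the space of real sequences, with all coordinates of index
  at least \<open>n\<close> equal to 0.\<close>

definition cube :: "nat \<Rightarrow> (nat \<Rightarrow> real) set" where
  "cube n = {x. (\<forall>i<n. 0 \<le> x i \<and> x i \<le> 1) \<and> (\<forall>i\<ge>n. x i = 0)}"

definition open_cube :: "nat \<Rightarrow> (nat \<Rightarrow> real) set" where
  "open_cube n = {x. (\<forall>i<n. 0 < x i \<and> x i < 1) \<and> (\<forall>i\<ge>n. x i = 0)}"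

definition face_map :: "nat \<Rightarrow> real \<Rightarrow> (nat \<Rightarrow> real) \<Rightarrow> (nat \<Rightarrow> real)" where
  "face_map i b x = (\<lambda>j. if j < i then x j else if j = i then b else x (j - 1))"

definition cube_sym :: "nat \<Rightarrow> (nat \<Rightarrow> nat) \<Rightarrow> nat set \<Rightarrow> (nat \<Rightarrow> real) \<Rightarrow> (nat \<Rightarrow> real)" where
  "cube_sym n \<pi> A x = (\<lambda>i. if i < n then (if i \<in> A then 1 - x (\<pi> i) else x (\<pi> i)) else 0)"

text \<open>A parametrized \<open>n\<close>-cube is a map on \<open>cube n\<close>, made \<open>undefined\<close> elsewhere so
  that equality of functions is equality of parametrized cubes.\<close>

definition face :: "nat \<Rightarrow> nat \<Rightarrow> real \<Rightarrow> ((nat \<Rightarrow> real) \<Rightarrow> 'a) \<Rightarrow> ((nat \<Rightarrow> real) \<Rightarrow> 'a)" where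
  "face n i b \<phi> = restrict (\<phi> \<circ> face_map i b) (cube (n - 1))"

definition reparam ::
    "nat \<Rightarrow> (nat \<Rightarrow> nat) \<Rightarrow> nat set \<Rightarrow> ((nat \<Rightarrow> real) \<Rightarrow> 'a) \<Rightarrow> ((nat \<Rightarrow> real) \<Rightarrow> 'a)" where
  "reparam n \<pi> A \<phi> = restrict (\<phi> \<circ> cube_sym n \<pi> A) (cube n)"

text \<open>\<open>K n\<close> is the set of all characteristic maps of \<open>n\<close>-cells: each cell occurs with each of
  its \<open>n! * 2^n\<close> isometric parametrizations. Cells are glued by isometries of faces, a cube may
  be glued to itself along its boundary, and the space \<open>S\<close> carries the weak topology. Neither
  the number of cubes nor their dimension is bounded.\<close>

definition cube_complex ::
    "'a::topological_space set \<Rightarrow> (nat \<Rightarrow> ((nat \<Rightarrow> real) \<Rightarrow> 'a) set) \<Rightarrow> bool" where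
  "cube_complex S K \<longleftrightarrow>
     (\<forall>n. \<forall>\<phi>\<in>K n. \<phi> \<in> extensional (cube n) \<and> continuous_on (cube n) \<phi> \<and>
                    inj_on \<phi> (open_cube n)) \<and>
     (\<forall>n. \<forall>\<phi>\<in>K n. \<forall>i<n. \<forall>b\<in>{0, 1}. face n i b \<phi> \<in> K (n - 1)) \<and>
     (\<forall>n. \<forall>\<phi>\<in>K n. \<forall>\<pi> A. \<pi> permutes {..<n} \<longrightarrow> A \<subseteq> {..<n} \<longrightarrow> reparam n \<pi> A \<phi> \<in> K n) \<and>
     S = (\<Union>n. \<Union>\<phi>\<in>K n. \<phi> ` open_cube n) \<and>
     (\<forall>m n. \<forall>\<phi>\<in>K m. \<forall>\<psi>\<in>K n. \<phi> ` open_cube m \<inter> \<psi> ` open_cube n \<noteq> {} \<longrightarrow>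
        m = n \<and> (\<exists>\<pi> A. \<pi> permutes {..<n} \<and> A \<subseteq> {..<n} \<and> \<psi> = reparam n \<pi> A \<phi>)) \<and>
     (\<forall>C. C \<subseteq> S \<longrightarrow>
        (\<forall>n. \<forall>\<phi>\<in>K n. closedin (top_of_set (cube n)) {x \<in> cube n. \<phi> x \<in> C}) \<longrightarrow>
        closedin (top_of_set S) C)"

text \<open>Elements of \<open>K 1\<close> are oriented edges.\<close>

definition initial :: "((nat \<Rightarrow> real) \<Rightarrow> 'a) \<Rightarrow> 'a" where
  "initial \<phi> = \<phi> (\<lambda>_. 0)"

definition rev_edge :: "((nat \<Rightarrow> real) \<Rightarrow> 'a) \<Rightarrow> ((nat \<Rightarrow> real) \<Rightarrow> 'a)" where
  "rev_edge e = reparam 1 id {0} e"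

definition axis_edge :: "nat \<Rightarrow> ((nat \<Rightarrow> real) \<Rightarrow> 'a) \<Rightarrow> ((nat \<Rightarrow> real) \<Rightarrow> 'a)" where
  "axis_edge i \<phi> = restrict (\<lambda>t. \<phi> (\<lambda>j. if j = i then t 0 else 0)) (cube 1)"

text \<open>As \<open>K\<close> is closed under the symmetries of cubes, every corner of a cube is the corner at the
  origin of some element of \<open>K\<close>.\<close>

definition forms_corner ::
    "(nat \<Rightarrow> ((nat \<Rightarrow> real) \<Rightarrow> 'a) set) \<Rightarrow> ((nat \<Rightarrow> real) \<Rightarrow> 'a) \<Rightarrow> ((nat \<Rightarrow> real) \<Rightarrow> 'a) \<Rightarrow> bool" where
  "forms_corner K e f \<longleftrightarrow> (\<exists>\<sigma>\<in>K 2. e = axis_edge 0 \<sigma> \<and> f = axis_edge 1 \<sigma>)"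

text \<open>The vertices of the link of \<open>v\<close> are the oriented edges with initial vertex \<open>v\<close>; each corner
  of an \<open>n\<close>-cube at \<open>v\<close> (an \<open>n\<close>-cube with origin \<open>v\<close>, up to permuting coordinates) contributes
  an \<open>(n-1)\<close>-simplex spanned by its \<open>n\<close> edges at \<open>v\<close>. The link is a simplicial complex if the
  vertices of each simplex are distinct and a simplex is determined by its set of vertices.\<close>

definition corner_edges :: "nat \<Rightarrow> ((nat \<Rightarrow> real) \<Rightarrow> 'a) \<Rightarrow> ((nat \<Rightarrow> real) \<Rightarrow> 'a) set" where
  "corner_edges n \<phi> = (\<lambda>i. axis_edge i \<phi>) ` {..<n}"

definition simplicial_link :: "(nat \<Rightarrow> ((nat \<Rightarrow> real) \<Rightarrow> 'a) set) \<Rightarrow> 'a \<Rightarrow> bool" where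
  "simplicial_link K v \<longleftrightarrow>
     (\<forall>n. \<forall>\<phi>\<in>K n. initial \<phi> = v \<longrightarrow> inj_on (\<lambda>i. axis_edge i \<phi>) {..<n}) \<and>
     (\<forall>n. \<forall>\<phi>\<in>K n. \<forall>\<psi>\<in>K n. initial \<phi> = v \<longrightarrow> initial \<psi> = v \<longrightarrow>
        corner_edges n \<phi> = corner_edges n \<psi> \<longrightarrow>
        (\<exists>\<pi>. \<pi> permutes {..<n} \<and> \<psi> = reparam n \<pi> {} \<phi>))"

definition flag_link :: "(nat \<Rightarrow> ((nat \<Rightarrow> real) \<Rightarrow> 'a) set) \<Rightarrow> 'a \<Rightarrow> bool" where
  "flag_link K v \<longleftrightarrow> simplicial_link K v \<and>
     (\<forall>E. finite E \<longrightarrow> E \<noteq> {} \<longrightarrow> E \<subseteq> {e \<in> K 1. initial e = v} \<longrightarrow> pairwise (forms_corner K) E \<longrightarrow>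
        (\<exists>n. \<exists>\<phi>\<in>K n. initial \<phi> = v \<and> corner_edges n \<phi> = E))"

definition nonpositively_curved :: "(nat \<Rightarrow> ((nat \<Rightarrow> real) \<Rightarrow> 'a) set) \<Rightarrow> bool" where
  "nonpositively_curved K \<longleftrightarrow> (\<forall>\<phi>\<in>K 0. flag_link K (initial \<phi>))"

definition opposite_sides ::
    "(nat \<Rightarrow> ((nat \<Rightarrow> real) \<Rightarrow> 'a) set) \<Rightarrow> ((nat \<Rightarrow> real) \<Rightarrow> 'a) \<Rightarrow> ((nat \<Rightarrow> real) \<Rightarrow> 'a) \<Rightarrow> bool" where
  "opposite_sides K e f \<longleftrightarrow> (\<exists>\<sigma>\<in>K 2. e = face 2 1 0 \<sigma> \<and> f = face 2 1 1 \<sigma>)"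

definition parallel ::
    "(nat \<Rightarrow> ((nat \<Rightarrow> real) \<Rightarrow> 'a) set) \<Rightarrow> ((nat \<Rightarrow> real) \<Rightarrow> 'a) \<Rightarrow> ((nat \<Rightarrow> real) \<Rightarrow> 'a) \<Rightarrow> bool" where
  "parallel K = equivclp (opposite_sides K)"

text \<open>A hyperplane is represented by the set of its dual edges, with both orientations.\<close>

definition dual_hyperplane ::
    "(nat \<Rightarrow> ((nat \<Rightarrow> real) \<Rightarrow> 'a) set) \<Rightarrow> ((nat \<Rightarrow> real) \<Rightarrow> 'a) \<Rightarrow> ((nat \<Rightarrow> real) \<Rightarrow> 'a) set" where
  "dual_hyperplane K e = {f \<in> K 1. parallel K e f \<or> parallel K (rev_edge e) f}"

definition hyperplanes ::
    "(nat \<Rightarrow> ((nat \<Rightarrow> real) \<Rightarrow> 'a) set) \<Rightarrow> ((nat \<Rightarrow> real) \<Rightarrow> 'a) set set" where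
  "hyperplanes K = dual_hyperplane K ` K 1"

definition hyperplanes_embedded :: "(nat \<Rightarrow> ((nat \<Rightarrow> real) \<Rightarrow> 'a) set) \<Rightarrow> bool" where
  "hyperplanes_embedded K \<longleftrightarrow>
     \<not> (\<exists>H\<in>hyperplanes K. \<exists>e\<in>H. \<exists>f\<in>H. forms_corner K e f)"

definition hyperplanes_two_sided :: "(nat \<Rightarrow> ((nat \<Rightarrow> real) \<Rightarrow> 'a) set) \<Rightarrow> bool" where
  "hyperplanes_two_sided K \<longleftrightarrow> \<not> (\<exists>e\<in>K 1. parallel K e (rev_edge e))"

definition hyperplanes_self_osculate :: "(nat \<Rightarrow> ((nat \<Rightarrow> real) \<Rightarrow> 'a) set) \<Rightarrow> bool" where
  "hyperplanes_self_osculate K \<longleftrightarrow>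
     (\<exists>e\<in>K 1. \<exists>f\<in>K 1. e \<noteq> f \<and> parallel K e f \<and> initial e = initial f \<and> \<not> forms_corner K e f)"

definition hyperplanes_cross ::
    "(nat \<Rightarrow> ((nat \<Rightarrow> real) \<Rightarrow> 'a) set) \<Rightarrow> ((nat \<Rightarrow> real) \<Rightarrow> 'a) set \<Rightarrow> ((nat \<Rightarrow> real) \<Rightarrow> 'a) set \<Rightarrow> bool" where
  "hyperplanes_cross K H H' \<longleftrightarrow> (\<exists>e\<in>H. \<exists>f\<in>H'. forms_corner K e f)"

definition hyperplanes_osculate ::
    "(nat \<Rightarrow> ((nat \<Rightarrow> real) \<Rightarrow> 'a) set) \<Rightarrow> ((nat \<Rightarrow> real) \<Rightarrow> 'a) set \<Rightarrow> ((nat \<Rightarrow> real) \<Rightarrow> 'a) set \<Rightarrow> bool" where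
  "hyperplanes_osculate K H H' \<longleftrightarrow>
     (\<exists>e\<in>H. \<exists>f\<in>H'. initial e = initial f \<and> \<not> forms_corner K e f)"

definition special_cube_complex ::
    "'a::topological_space set \<Rightarrow> (nat \<Rightarrow> ((nat \<Rightarrow> real) \<Rightarrow> 'a) set) \<Rightarrow> bool" where
  "special_cube_complex S K \<longleftrightarrow>
     cube_complex S K \<and> connected S \<and> nonpositively_curved K \<and>
     hyperplanes_embedded K \<and> hyperplanes_two_sided K \<and> \<not> hyperplanes_self_osculate K \<and>
     \<not> (\<exists>H\<in>hyperplanes K. \<exists>H'\<in>hyperplanes K.
          H \<noteq> H' \<and> hyperplanes_cross K H H' \<and> hyperplanes_osculate K H H')"

end

theory Submission
  imports Defs
begin

text \<open>Label each oriented edge by its oriented hyperplane. Since each hyperplane gives a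
  circle-valued coordinate that is continuous for the weak topology, a path in the complex has a
  well-defined, homotopy invariant word in the right-angled Artin group on the hyperplanes, with
  crossing hyperplanes commuting. Every loop is homotopic to an edge loop, and specialness allows
  an edge loop to follow any cancellation of its word, so the fundamental group embeds in the
  right-angled Artin group.

  There, halfspaces with the same label never cross. Given a nontrivial element \<open>f\<close>, some
  halfspace \<open>h\<close> satisfies \<open>f h \<subset> h\<close>; count disjoint nested copies of the chain of
  all halfspaces between \<open>f h\<close> and \<open>h\<close>, and subtract the number of reversed copies. Because
  equally labelled halfspaces are nested, cutting a pair of points at a third one changes a count by
  at most 1, so this is a quasimorphism of defect at most 6. No reversed copy occurs along the axis of
  \<open>f\<close>, as it would produce an element exchanging two halfspaces. Hence the value at
  \<open>f ^ n\<close> is at least \<open>n - 1\<close>, while a product of \<open>k\<close> commutators has value at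
  most \<open>24 k\<close>.\<close>

text \<open>Each condition on hyperplanes has its own task. Embeddedness makes crossing irreflexive,
  so that it can serve as commutation. Two-sidedness makes reversing an edge invert its label.
  Absence of self-osculation makes consecutive edges with inverse labels literally reverse to each
  other, and absence of inter-osculation supplies the square in which consecutive edges with
  commuting labels are exchanged. The danger in the group is that copies and reversed copies of the
  chain balance along the axis. This is why the chain contains every halfspace of one label from
  \<open>h\<close> down to \<open>f h\<close>: a reversed copy must then match a run of consecutive
  halfspaces of the axis, and its middle yields an element whose square fixes a halfspace that the
  element itself moves. Right-angled Artin groups contain no such element. The constants: three
  points give six counts, each split with an error of at most 1, so the defect is 6. A commutator
  takes three products and attaching it to the others one more, so \<open>k\<close> commutators have
  value at most \<open>4 * 6 * k\<close>.\<close>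

type_synonym 'v word = "('v \<times> bool) list"

definition linv :: "'v \<times> bool \<Rightarrow> 'v \<times> bool" where
  "linv s = (fst s, \<not> snd s)"

definition winv :: "'v word \<Rightarrow> 'v word" where
  "winv w = rev (map linv w)"

lemma linv_simps [simp]: "linv (linv s) = s" "fst (linv s) = fst s" "linv s \<noteq> s" "s \<noteq> linv s"
  "linv s = linv t \<longleftrightarrow> s = t" "snd (linv s) \<longleftrightarrow> \<not> snd s"
  by (auto simp: linv_def prod_eq_iff)

lemma winv_simps [simp]: "winv [] = []" "winv (s # w) = winv w @ [linv s]"
  "winv (u @ w) = winv w @ winv u" "winv (winv w) = w" "length (winv w) = length w"
  by (auto simp: winv_def rev_map o_def)

section \<open>Right-angled Artin groups as words modulo commutation\<close>

locale raag =
  fixes comm :: "'v \<Rightarrow> 'v \<Rightarrow> bool"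
  assumes comm_sym: "comm u v \<Longrightarrow> comm v u"
    and comm_irrefl [simp]: "\<not> comm v v"
begin

text \<open>The group is never formed as a quotient: its elements are words, \<doteq> is equality in
  it, \<open>@\<close> is multiplication and \<open>winv\<close> inversion.\<close>

inductive eqw :: "'v word \<Rightarrow> 'v word \<Rightarrow> bool" (infix "\<doteq>" 50) where
  eqw_refl [simp, intro]: "w \<doteq> w"
| eqw_sym: "u \<doteq> w \<Longrightarrow> w \<doteq> u"
| eqw_trans [trans]: "u \<doteq> v \<Longrightarrow> v \<doteq> w \<Longrightarrow> u \<doteq> w"
| eqw_cong: "u \<doteq> w \<Longrightarrow> a @ u @ b \<doteq> a @ w @ b"
| eqw_cancel: "[s, linv s] \<doteq> []"
| eqw_swap: "comm (fst s) (fst t) \<Longrightarrow> [s, t] \<doteq> [t, s]"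

declare eqw_trans [trans]

lemma eqw_append: "u \<doteq> u' \<Longrightarrow> w \<doteq> w' \<Longrightarrow> u @ w \<doteq> u' @ w'"
  using eqw_cong[of u u' "[]" w] eqw_cong[of w w' u' "[]"] by (auto intro: eqw_trans)

lemma eqw_Cons: "w \<doteq> w' \<Longrightarrow> s # w \<doteq> s # w'"
  using eqw_append[of "[s]" "[s]" w w'] by auto

lemma eqw_Cons_append: "w \<doteq> w' \<Longrightarrow> s # w @ b \<doteq> s # w' @ b"
  using eqw_cong[of w w' "[s]" b] by auto

lemma eqw_cancel': "[linv s, s] \<doteq> []"
  using eqw_cancel[of "linv s"] by simp

lemma eqw_cancel_Cons: "s # linv s # w \<doteq> w" "linv s # s # w \<doteq> w"
  using eqw_append[OF eqw_cancel[of s] eqw_refl[of w]] eqw_append[OF eqw_cancel'[of s] eqw_refl[of w]]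
  by auto

lemma eqw_rinv: "w @ winv w \<doteq> []"
proof (induction w)
  case (Cons s w)
  have "(s # w) @ winv (s # w) = [s] @ (w @ winv w) @ [linv s]" by simp
  also have "\<dots> \<doteq> [s] @ [] @ [linv s]" using Cons by (rule eqw_cong)
  also have "\<dots> \<doteq> []" using eqw_cancel by simp
  finally show ?case .
qed auto

lemma eqw_linv: "winv w @ w \<doteq> []"
  using eqw_rinv[of "winv w"] by simp

lemma eqw_inv_cancel: "winv w @ w @ u \<doteq> u" "w @ winv w @ u \<doteq> u"
  using eqw_append[OF eqw_linv[of w] eqw_refl[of u]] eqw_append[OF eqw_rinv[of w] eqw_refl[of u]]
  by auto

lemma eqw_inv_cancel_r: "u @ winv w @ w \<doteq> u" "u @ w @ winv w \<doteq> u"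
  using eqw_append[OF eqw_refl[of u] eqw_linv[of w]] eqw_append[OF eqw_refl[of u] eqw_rinv[of w]]
  by auto

lemma eqw_winv: assumes "u \<doteq> w" shows "winv u \<doteq> winv w"
proof -
  have "winv u \<doteq> winv u @ w @ winv w" by (rule eqw_sym, rule eqw_inv_cancel_r)
  also have "\<dots> \<doteq> winv u @ u @ winv w" by (rule eqw_cong, rule eqw_sym, rule assms)
  also have "\<dots> \<doteq> winv w" by (rule eqw_inv_cancel)
  finally show ?thesis .
qed

lemma eqw_cancel_left: assumes "a @ u \<doteq> a @ w" shows "u \<doteq> w"
proof -
  have "u \<doteq> winv a @ a @ u" by (rule eqw_sym, rule eqw_inv_cancel)
  also have "\<dots> \<doteq> winv a @ a @ w" using eqw_append[OF eqw_refl assms] by simp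
  also have "\<dots> \<doteq> w" by (rule eqw_inv_cancel)
  finally show ?thesis .
qed

lemma eqw_cancel_right: assumes "u @ a \<doteq> w @ a" shows "u \<doteq> w"
proof -
  have "u \<doteq> u @ a @ winv a" by (rule eqw_sym, rule eqw_inv_cancel_r)
  also have "\<dots> \<doteq> w @ a @ winv a" using eqw_append[OF assms eqw_refl[of "winv a"]] by simp
  also have "\<dots> \<doteq> w" by (rule eqw_inv_cancel_r)
  finally show ?thesis .
qed

lemma eqw_move: assumes "\<And>t. t \<in> set w \<Longrightarrow> comm (fst t) (fst s) \<or> t = s \<or> t = linv s"
  shows "s # w \<doteq> w @ [s]"
  using assms
proof (induction w)
  case (Cons t w)
  have "[s, t] \<doteq> [t, s]"
    using Cons.prems[of t] eqw_cancel[of s] eqw_cancel'[of s] eqw_swap[of s t]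
    by (auto intro: eqw_sym eqw_trans comm_sym)
  then have "[s, t] @ w \<doteq> [t, s] @ w" by (intro eqw_append) auto
  also have "[t, s] @ w \<doteq> t # w @ [s]" using eqw_Cons[OF Cons.IH] Cons.prems by simp
  finally show ?case by simp
qed auto

definition esum :: "'v word \<Rightarrow> 'v \<Rightarrow> int" where
  "esum w v = sum_list (map (\<lambda>s. if fst s = v then if snd s then 1 else - 1 else 0) w)"

lemma esum_simps [simp]: "esum [] v = 0"
  "esum (s # w) v = (if fst s = v then if snd s then 1 else - 1 else 0) + esum w v"
  "esum (u @ w) v = esum u v + esum w v"
  by (auto simp: esum_def)

lemma esum_winv [simp]: "esum (winv w) v = - esum w v"
  by (induction w) (auto simp: linv_def)

text \<open>Such a word lives in a free abelian group, where exponent sums determine the element.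
  The inverse of the first letter must occur later, since otherwise all letters with that label have
  the same sign; the first letter is moved next to it and cancels.\<close>

lemma commuting_word_Nil:
  assumes "\<And>s t. s \<in> set w \<Longrightarrow> t \<in> set w \<Longrightarrow> fst s = fst t \<or> comm (fst s) (fst t)" "\<And>v. esum w v = 0"
  shows "w \<doteq> []"
  using assms
proof (induction "length w" arbitrary: w rule: less_induct)
  case less
  show ?case
  proof (cases w)
    case (Cons s w')
    have "linv s \<in> set w'"
    proof (rule ccontr)
      assume no: "linv s \<notin> set w'"
      have *: "linv s \<notin> set l \<Longrightarrow> (if snd s then esum l (fst s) \<ge> 0 else esum l (fst s) \<le> 0)" for l
        by (induction l) (auto simp: linv_def prod_eq_iff)
      show False using *[OF no] less.prems(2)[of "fst s"] Cons by (auto split: if_splits)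
    qed
    then obtain u u' where u: "w' = u @ linv s # u'" by (meson split_list)
    have "s # u \<doteq> u @ [s]"
    proof (rule eqw_move)
      fix t assume "t \<in> set u"
      then have "fst s = fst t \<or> comm (fst s) (fst t)" using less.prems(1)[of s t] Cons u by auto
      then show "comm (fst t) (fst s) \<or> t = s \<or> t = linv s"
        by (auto simp: linv_def prod_eq_iff dest: comm_sym)
    qed
    then have "(s # u) @ linv s # u' \<doteq> (u @ [s]) @ linv s # u'" by (rule eqw_append) simp
    also have "(u @ [s]) @ linv s # u' \<doteq> u @ u'"
      using eqw_append[OF eqw_refl[of u] eqw_cancel_Cons(1)[of s u']] by simp
    finally have 1: "w \<doteq> u @ u'" using Cons u by simp
    have "esum (u @ u') v = 0" for v
      using less.prems(2)[of v] Cons u by (auto simp: linv_def split: if_splits)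
    then have "u @ u' \<doteq> []" using less.prems(1) Cons u by (intro less.hyps) auto
    then show ?thesis using 1 eqw_trans by blast
  qed simp
qed

lemma commuting_words_eqw:
  assumes "\<And>s t. s \<in> set u \<union> set w \<Longrightarrow> t \<in> set u \<union> set w \<Longrightarrow> fst s = fst t \<or> comm (fst s) (fst t)"
    and "\<And>v. esum u v = esum w v"
  shows "u \<doteq> w"
proof -
  have "\<exists>s'\<in>set u \<union> set w. fst s' = fst s" if "s \<in> set (u @ winv w)" for s
    using that by (force simp: winv_def)
  then have "fst s = fst t \<or> comm (fst s) (fst t)" if "s \<in> set (u @ winv w)" "t \<in> set (u @ winv w)" for s t
    using assms(1) that by metis
  then have "u @ winv w \<doteq> []" using assms(2) by (intro commuting_word_Nil) simp_all
  then have "(u @ winv w) @ w \<doteq> [] @ w" by (rule eqw_append) simp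
  then show ?thesis using eqw_inv_cancel_r(1)[of u w] eqw_sym eqw_trans by (metis append_Nil append_assoc)
qed

section \<open>Piles and halfspaces\<close>

text \<open>A pile has one stack per vertex \<open>v\<close>: an entry \<open>Some b\<close> is an occurrence of \<open>v\<close> with
  sign \<open>b\<close>, and \<open>None\<close> marks a letter that does not commute with \<open>v\<close>. Letters are added
  at the front of the word, and a letter meeting its inverse on top of its stack cancels it.\<close>

definition push :: "'v \<times> bool \<Rightarrow> ('v \<Rightarrow> bool option list) \<Rightarrow> 'v \<Rightarrow> bool option list" where
  "push s P u = (if u = fst s then Some (snd s) # P u
                 else if comm u (fst s) then P u else None # P u)"

definition pop :: "'v \<Rightarrow> ('v \<Rightarrow> bool option list) \<Rightarrow> 'v \<Rightarrow> bool option list" where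
  "pop v P u = (if comm u v then P u else tl (P u))"

definition top_is :: "'v \<times> bool \<Rightarrow> ('v \<Rightarrow> bool option list) \<Rightarrow> bool" where
  "top_is s P \<longleftrightarrow> (\<exists>l. P (fst s) = Some (snd s) # l)"

definition lop :: "'v \<times> bool \<Rightarrow> ('v \<Rightarrow> bool option list) \<Rightarrow> 'v \<Rightarrow> bool option list" where
  "lop s P = (if top_is (linv s) P then pop (fst s) P else push s P)"

definition pile :: "'v word \<Rightarrow> 'v \<Rightarrow> bool option list" where
  "pile w = foldr lop w (\<lambda>_. [])"

text \<open>Popping removes the tops of other stacks without looking at them, so on arbitrary stacks
  \<open>lop s\<close> and \<open>lop (linv s)\<close> need not be inverse to each other. On piles
  built by pushes without cancellation they are.\<close>

inductive reach :: "('v \<Rightarrow> bool option list) \<Rightarrow> bool" where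
  reach_empty: "reach (\<lambda>_. [])"
| reach_push: "reach P \<Longrightarrow> \<not> top_is (linv s) P \<Longrightarrow> reach (push s P)"

lemma top_is_push: "top_is s (push s P)"
  by (simp add: top_is_def push_def)

lemma pop_push: "pop (fst s) (push s P) = P"
  by (auto simp: pop_def push_def fun_eq_iff)

lemma top_is_push_comm: "comm (fst s) (fst t) \<Longrightarrow> top_is t (push s P) = top_is t P"
  by (auto simp: top_is_def push_def dest: comm_sym)

lemma top_is_push_not: "\<not> comm (fst s) (fst t) \<Longrightarrow> t \<noteq> s \<Longrightarrow> \<not> top_is t (push s P)"
  by (auto simp: top_is_def push_def prod_eq_iff dest: comm_sym)

lemma push_push: "comm (fst s) (fst t) \<Longrightarrow> push s (push t P) = push t (push s P)"
  by (auto simp: push_def fun_eq_iff dest: comm_sym)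

text \<open>If the last letter pushed is not \<open>s\<close>, it commutes with \<open>s\<close>, as
  it would otherwise have covered the stack of \<open>s\<close>. So \<open>s\<close> was on top
  before it, and by induction the two pushes can be exchanged.\<close>

lemma reach_top: "reach P \<Longrightarrow> top_is s P \<Longrightarrow> \<exists>Q. reach Q \<and> \<not> top_is (linv s) Q \<and> P = push s Q"
proof (induction rule: reach.induct)
  case reach_empty
  then show ?case by (simp add: top_is_def)
next
  case (reach_push P t)
  show ?case
  proof (cases "t = s")
    case True
    then show ?thesis using reach_push by blast
  next
    case False
    then have c: "comm (fst t) (fst s)"
      using top_is_push_not[of t s P] reach_push.prems by metis
    then have "top_is s P" using reach_push.prems top_is_push_comm by blast
    then obtain Q where Q: "reach Q" "\<not> top_is (linv s) Q" "P = push s Q"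
      using reach_push.IH by blast
    have "\<not> top_is (linv t) Q"
      using reach_push.hyps(2) c Q(3) top_is_push_comm[of s "linv t" Q] by (auto dest: comm_sym)
    then have "reach (push t Q)" using Q(1) reach.reach_push by blast
    moreover have "\<not> top_is (linv s) (push t Q)"
      using top_is_push_comm[of t "linv s" Q] c Q(2) by simp
    moreover have "push t P = push s (push t Q)" using Q(3) push_push c by simp
    ultimately show ?thesis by blast
  qed
qed

lemma reach_lop: "reach P \<Longrightarrow> reach (lop s P)"
  using reach_top[of P "linv s"] reach_push[of P s] pop_push[of "linv s"]
  by (auto simp: lop_def)

lemma lop_push: "\<not> top_is (linv s) P \<Longrightarrow> lop s P = push s P"
  by (simp add: lop_def)

lemma lop_linv_push: "lop (linv s) (push s P) = P"
  using pop_push[of s P] top_is_push[of s P] by (simp add: lop_def)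

lemma lop_lop_linv: assumes "reach P" shows "lop s (lop (linv s) P) = P"
proof (cases "top_is s P")
  case True
  then obtain Q where "\<not> top_is (linv s) Q" "P = push s Q" using reach_top assms by blast
  then show ?thesis by (simp add: lop_linv_push lop_push)
next
  case False
  then have "lop (linv s) P = push (linv s) P" by (simp add: lop_def)
  then show ?thesis using lop_linv_push[of "linv s" P] by simp
qed

lemma top_is_lop_comm: assumes "comm (fst s) (fst t)" shows "top_is t (lop s P) = top_is t P"
  using top_is_push_comm[OF assms, of P] comm_sym[OF assms] by (auto simp: lop_def top_is_def pop_def)

lemma lop_lop_comm: assumes "reach P" "comm (fst s) (fst t)" shows "lop s (lop t P) = lop t (lop s P)"
proof -
  \<comment> \<open>The case in which a letter cancels, by symmetry \<open>s\<close>: writing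
    \<open>P\<close> as a push of \<open>linv s\<close> reduces the claim to commuting
    pushes.\<close>
  have *: "lop s (lop t P) = lop t (lop s P)" if tt: "top_is (linv s) P" and rr: "reach P" and cc: "comm (fst s) (fst t)" for s t P
  proof -
    obtain Q where Q: "reach Q" "\<not> top_is s Q" "P = push (linv s) Q"
      using reach_top[OF rr tt] by auto
    have 1: "lop t P = push (linv s) (lop t Q)"
    proof (cases "top_is (linv t) Q")
      case True
      obtain R where R: "Q = push (linv t) R" using reach_top[OF Q(1) True] by auto
      have "P = push (linv t) (push (linv s) R)" using Q(3) R push_push[of "linv s" "linv t" R] cc by simp
      then show ?thesis using R lop_linv_push[of "linv t"] by simp
    next
      case False
      then show ?thesis
        using top_is_push_comm[of "linv s" "linv t" Q] Q(3) push_push[of "linv s" t Q] cc by (simp add: lop_push)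
    qed
    have "lop s (push (linv s) (lop t Q)) = lop t Q"
      using lop_linv_push[of "linv s"] by simp
    moreover have "lop s P = Q" using Q lop_linv_push[of "linv s"] by simp
    ultimately show ?thesis using 1 by simp
  qed
  show ?thesis
  proof (cases "top_is (linv s) P \<or> top_is (linv t) P")
    case True
    then show ?thesis using *[of s P t] *[of t P s] assms comm_sym by metis
  next
    case False
    then show ?thesis using assms top_is_lop_comm[of s "linv t" P] top_is_lop_comm[of t "linv s" P]
        comm_sym[OF assms(2)] push_push by (simp add: lop_push)
  qed
qed

lemma reach_foldr: "reach P \<Longrightarrow> reach (foldr lop w P)"
  by (induction w) (auto intro: reach_lop)

lemma reach_pile [simp]: "reach (pile w)"
  by (simp add: pile_def reach_foldr reach_empty)

text \<open>The defining relations hold for the operators \<open>lop\<close> on reachable piles, so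
  the group acts on these. The pile of a word is therefore an invariant of its group element, and so
  is everything read off from it.\<close>

lemma foldr_lop_eqw: "u \<doteq> w \<Longrightarrow> reach P \<Longrightarrow> foldr lop u P = foldr lop w P"
proof (induction arbitrary: P rule: eqw.induct)
  case (eqw_cong u w a b)
  then show ?case by (simp add: reach_foldr)
next
  case (eqw_swap s t)
  then show ?case using lop_lop_comm[of P s t] by simp
qed (auto simp: lop_lop_linv)

lemma pile_eqw: "u \<doteq> w \<Longrightarrow> pile u = pile w"
  unfolding pile_def by (rule foldr_lop_eqw) (auto intro: reach_empty)

lemma pile_simps: "pile [] = (\<lambda>_. [])" "pile (s # w) = lop s (pile w)"
  by (auto simp: pile_def)

text \<open>\<open>half s\<close> consists of the words whose reduced form can begin with \<open>s\<close>.\<close>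

definition half :: "'v \<times> bool \<Rightarrow> 'v word set" where
  "half s = {w. top_is s (pile w)}"

lemma half_eqw: "u \<doteq> w \<Longrightarrow> u \<in> half s \<longleftrightarrow> w \<in> half s"
  by (simp add: half_def pile_eqw)

lemma Nil_half [simp]: "[] \<notin> half s"
  by (simp add: half_def top_is_def pile_simps)

text \<open>A letter on top was pushed last up to commutation, and that push covers the stacks of
  all letters that do not commute with it.\<close>

lemma half_disjoint: "w \<in> half s \<Longrightarrow> w \<in> half t \<Longrightarrow> \<not> comm (fst s) (fst t) \<Longrightarrow> s = t"
  using reach_top[OF reach_pile[of w], of s] top_is_push_not[of s t] unfolding half_def
  by fastforce

text \<open>The ping-pong relation. It makes the complement of a halfspace a translate of the
  opposite one, see \<open>hsp_compl\<close>.\<close>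

lemma half_Cons: "s # w \<in> half s \<longleftrightarrow> w \<notin> half (linv s)"
proof (cases "w \<in> half (linv s)")
  case True
  then obtain Q where "\<not> top_is s Q" "pile w = push (linv s) Q"
    using reach_top[OF reach_pile[of w], of "linv s"] by (auto simp: half_def)
  then show ?thesis using True lop_linv_push[of "linv s" Q] by (simp add: half_def pile_simps)
next
  case False
  then show ?thesis by (simp add: half_def pile_simps lop_push top_is_push)
qed

lemma half_linv_Cons: "linv s # w \<in> half (linv s) \<longleftrightarrow> w \<notin> half s"
  using half_Cons[of "linv s" w] by simp

lemma half_Cons_comm: "comm (fst s) (fst t) \<Longrightarrow> s # w \<in> half t \<longleftrightarrow> w \<in> half t"
  by (simp add: half_def pile_simps top_is_lop_comm)

lemma half_set: "w \<in> half s \<Longrightarrow> s \<in> set w"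
proof -
  have "Some b \<in> set (pile w v) \<Longrightarrow> (v, b) \<in> set w" for v b
  proof (induction w)
    case (Cons t w)
    have *: "x \<in> set l" if "x \<in> set (tl l)" for x and l :: "bool option list"
      using that by (cases l) auto
    have "Some b \<in> set (pile w v) \<or> (v, b) = t"
      using Cons.prems *[of "Some b" "pile w v"]
      by (cases t) (auto simp: pile_simps lop_def pop_def push_def split: if_splits)
    then show ?case using Cons.IH by auto
  qed (simp add: pile_simps)
  moreover assume "w \<in> half s"
  ultimately show ?thesis by (cases s) (auto simp: half_def top_is_def)
qed

text \<open>These words give the subgroup generated by the link of the label of \<open>s\<close>. It
  stabilizes \<open>half s\<close>, and the edges dual to the bounding hyperplane are those from
  \<open>c\<close> to \<open>c @ [s]\<close> with \<open>c\<close> in this subgroup.\<close>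

definition lkw :: "'v \<times> bool \<Rightarrow> 'v word \<Rightarrow> bool" where
  "lkw s c \<longleftrightarrow> (\<forall>t\<in>set c. comm (fst t) (fst s))"

lemma lkw_simps [simp]: "lkw s []" "lkw s (t # c) \<longleftrightarrow> comm (fst t) (fst s) \<and> lkw s c"
  "lkw s (c @ d) \<longleftrightarrow> lkw s c \<and> lkw s d" "lkw (linv s) c \<longleftrightarrow> lkw s c" "lkw s (winv c) \<longleftrightarrow> lkw s c"
  by (auto simp: lkw_def winv_def)

lemma half_lkw: "lkw s c \<Longrightarrow> c @ w \<in> half s \<longleftrightarrow> w \<in> half s"
  by (induction c) (auto simp: half_Cons_comm)

lemma eqw_lkw_move: "lkw s c \<Longrightarrow> s # c \<doteq> c @ [s]"
  by (rule eqw_move) (auto simp: lkw_def)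

lemma eqw_lkw_cancel: "lkw s c \<Longrightarrow> linv s # c @ [s] \<doteq> c"
  by (meson eqw_Cons eqw_cancel_Cons(2) eqw_lkw_move eqw_sym eqw_trans)

section \<open>Reduced words\<close>

text \<open>Computing the pile of such a word never cancels a letter.\<close>

fun pushy :: "'v word \<Rightarrow> bool" where
  "pushy [] \<longleftrightarrow> True"
| "pushy (s # w) \<longleftrightarrow> w \<notin> half (linv s) \<and> pushy w"

lemma pushy_half:
  assumes "pushy w" "w \<in> half q"
  shows "\<exists>u1 u2. w = u1 @ q # u2 \<and> lkw q u1"
  using assms
proof (induction w)
  case (Cons s w)
  show ?case
  proof (cases "s = q")
    case True
    then show ?thesis by (intro exI[of _ "[]"] exI[of _ w]) auto
  next
    case False
    have "s # w \<in> half s" using Cons.prems half_Cons by simp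
    then have c: "comm (fst s) (fst q)" using half_disjoint[of "s # w" s q] Cons.prems False by auto
    then have "w \<in> half q" using Cons.prems half_Cons_comm by blast
    then obtain u1 u2 where "w = u1 @ q # u2" "lkw q u1" using Cons by auto
    then show ?thesis using c by (intro exI[of _ "s # u1"] exI[of _ u2]) auto
  qed
qed simp

text \<open>At the rightmost place where a letter cancels, the rest of the word is still
  \<open>pushy\<close>, so the partner of that letter is preceded there only by letters commuting
  with it.\<close>

lemma not_pushy:
  assumes "\<not> pushy w"
  shows "\<exists>u1 q u2 u3. w = u1 @ linv q # u2 @ q # u3 \<and> lkw q u2"
  using assms
proof (induction w)
  case (Cons s w)
  show ?case
  proof (cases "pushy w")
    case True
    then have "w \<in> half (linv s)" using Cons by auto
    then obtain u1 u2 where "w = u1 @ linv s # u2" "lkw (linv s) u1" using pushy_half True by blast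
    then show ?thesis
      by (intro exI[of _ "[]"] exI[of _ "linv s"] exI[of _ u1] exI[of _ u2]) auto
  next
    case False
    then obtain u1 q u2 u3 where "w = u1 @ linv q # u2 @ q # u3" "lkw q u2" using Cons by blast
    then show ?thesis by (intro exI[of _ "s # u1"] exI[of _ q] exI[of _ u2] exI[of _ u3]) auto
  qed
qed simp

text \<open>The cancellation never has to lengthen the word first: this is what allows
  edge loops in a special cube complex to be contracted by following their labels.\<close>

lemma eqw_Nil_pattern:
  assumes "w \<doteq> []" "w \<noteq> []"
  obtains u1 q u2 u3 where "w = u1 @ linv q # u2 @ q # u3" "lkw q u2"
proof -
  have "\<not> pushy w"
  proof
    assume p: "pushy w"
    obtain s w' where w: "w = s # w'" using assms(2) by (meson neq_Nil_conv)
    then have "w \<in> half s" using p half_Cons by auto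
    then show False using half_eqw[OF assms(1)] by auto
  qed
  then show ?thesis using not_pushy that by blast
qed

definition geo :: "'v word \<Rightarrow> bool" where
  "geo w \<longleftrightarrow> (\<forall>w'. w \<doteq> w' \<longrightarrow> length w \<le> length w')"

lemma geo_ex: "\<exists>w'. w \<doteq> w' \<and> geo w' \<and> length w' \<le> length w"
proof -
  define n where "n = (LEAST n. \<exists>w'. w \<doteq> w' \<and> length w' = n)"
  have "\<exists>w'. w \<doteq> w' \<and> length w' = n" unfolding n_def by (rule LeastI_ex) (use eqw_refl in blast)
  then obtain w' where w': "w \<doteq> w'" "length w' = n" by blast
  have le: "n \<le> length v" if "w \<doteq> v" for v
    unfolding n_def by (rule Least_le) (use that in blast)
  have "geo w'" unfolding geo_def using w' le eqw_trans by metis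
  then show ?thesis using w' le[of w] by auto
qed

lemma geo_append: assumes "geo (u @ w)" shows "geo u" "geo w"
proof -
  show "geo u" unfolding geo_def
  proof (intro allI impI)
    fix v assume "u \<doteq> v"
    then have "u @ w \<doteq> v @ w" by (intro eqw_append) auto
    then show "length u \<le> length v" using assms by (force simp: geo_def)
  qed
  show "geo w" unfolding geo_def
  proof (intro allI impI)
    fix v assume "w \<doteq> v"
    then have "u @ w \<doteq> u @ v" by (intro eqw_append) auto
    then show "length w \<le> length v" using assms by (force simp: geo_def)
  qed
qed

lemma geo_Cons: "geo (s # w) \<Longrightarrow> geo w"
  using geo_append(2)[of "[s]" w] by simp

lemma geo_pushy: assumes "geo w" shows "pushy w"
proof (rule ccontr)
  assume "\<not> pushy w"
  then obtain u1 q u2 u3 where w: "w = u1 @ linv q # u2 @ q # u3" "lkw q u2" using not_pushy by blast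
  have "u1 @ (linv q # u2 @ [q]) @ u3 \<doteq> u1 @ u2 @ u3"
    by (rule eqw_cong, rule eqw_lkw_cancel, rule w)
  then have "w \<doteq> u1 @ u2 @ u3" using w by simp
  then have "length w \<le> length (u1 @ u2 @ u3)" using assms by (auto simp: geo_def)
  then show False using w by simp
qed

lemma geo_winv: "geo w \<Longrightarrow> geo (winv w)"
  unfolding geo_def by (metis eqw_winv winv_simps(4,5))

lemma geo_Cons_half: "geo (s # w) \<Longrightarrow> s # w \<in> half s" "geo (s # w) \<Longrightarrow> w \<notin> half (linv s)"
  using geo_pushy[of "s # w"] half_Cons by auto

text \<open>In a geodesic form some occurrence of \<open>s\<close> is preceded only by letters
  commuting with it, and moving it to the front keeps the length.\<close>

lemma half_geo: assumes "w \<in> half s" obtains y where "geo (s # y)" "w \<doteq> s # y" "Suc (length y) \<le> length w"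
proof -
  obtain w' where w': "w \<doteq> w'" "geo w'" "length w' \<le> length w" using geo_ex by blast
  then have "w' \<in> half s" using assms half_eqw by blast
  then obtain u1 u2 where u: "w' = u1 @ s # u2" "lkw s u1" using pushy_half geo_pushy w' by blast
  have "(s # u1) @ u2 \<doteq> (u1 @ [s]) @ u2"
    by (rule eqw_append[OF eqw_lkw_move[OF u(2)]]) auto
  then have e: "s # u1 @ u2 \<doteq> w'" using u by simp
  moreover have "geo (s # u1 @ u2)"
    unfolding geo_def
  proof (intro allI impI)
    fix v assume "s # u1 @ u2 \<doteq> v"
    then have "w' \<doteq> v" using e eqw_sym eqw_trans by blast
    then show "length (s # u1 @ u2) \<le> length v" using w'(2) u(1) by (auto simp: geo_def)
  qed
  moreover have "w \<doteq> s # u1 @ u2" using w'(1) e eqw_sym eqw_trans by blast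
  ultimately show ?thesis using that[of "u1 @ u2"] w'(3) u by auto
qed

text \<open>Induction on the first letter \<open>q\<close> of a geodesic form of \<open>z\<close>.
  If \<open>q\<close> commutes with \<open>r\<close>, it can be removed. If not,
  \<open>half q\<close> and \<open>half r\<close> are disjoint, so the edge that enters
  \<open>half r\<close> also leaves \<open>half q\<close>. With \<open>q\<close> removed it enters
  \<open>half (linv q)\<close>, and the induction hypothesis collapses its end to a word in the link
  of \<open>q\<close>, which cannot lie in \<open>half r\<close>.\<close>

lemma boundary:
  assumes "z \<notin> half r" "z @ [t] \<in> half r"
  shows "t = r \<and> (\<exists>c. z \<doteq> c \<and> lkw r c)"
proof -
  have *: "geo z \<Longrightarrow> z \<notin> half r \<Longrightarrow> z @ [t] \<in> half r \<Longrightarrow> t = r \<and> (\<exists>c. z \<doteq> c \<and> lkw r c)" for z r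
  proof (induction z arbitrary: r)
    case Nil
    then have "t = r" using half_set[of "[t]" r] by auto
    then show ?case by (auto intro!: exI[of _ "[]"])
  next
    case (Cons q z)
    have z: "geo z" "q # z \<in> half q" "z \<notin> half (linv q)"
      using Cons.prems geo_Cons geo_Cons_half by blast+
    show ?case
    proof (cases "comm (fst q) (fst r)")
      case True
      then have "z \<notin> half r" "z @ [t] \<in> half r" using Cons.prems half_Cons_comm[of q r] by auto
      then obtain c where "t = r" "z \<doteq> c" "lkw r c" using Cons.IH z by blast
      then show ?thesis using True eqw_Cons[of z c q] by (intro conjI exI[of _ "q # c"]) auto
    next
      case nc: False
      have "q \<noteq> r" using z(2) Cons.prems by auto
      have "q # z @ [t] \<notin> half q"
        using half_disjoint[of "q # z @ [t]" q r] nc Cons.prems \<open>q \<noteq> r\<close> by auto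
      then have zt: "z @ [t] \<in> half (linv q)" using half_Cons by blast
      then obtain c where c: "t = linv q" "z \<doteq> c" "lkw q c" using Cons.IH[of "linv q"] z by auto
      have "q # z @ [t] \<doteq> q # c @ [t]" using eqw_Cons_append c by blast
      also have "\<dots> \<doteq> c" using c eqw_lkw_cancel[of "linv q" c] by simp
      finally have e: "q # z @ [t] \<doteq> c" .
      then have "c \<in> half r" using Cons.prems half_eqw by auto
      then have "r \<in> set c" by (rule half_set)
      then have "comm (fst r) (fst q)" using c by (auto simp: lkw_def)
      then show ?thesis using nc comm_sym by blast
    qed
  qed
  obtain z' where z': "z \<doteq> z'" "geo z'" using geo_ex by blast
  have "z' \<notin> half r" "z' @ [t] \<in> half r"
    using assms half_eqw[OF z'(1)] half_eqw[OF eqw_append[OF z'(1) eqw_refl[of "[t]"]]] by auto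
  then show ?thesis using *[of z' r] z' eqw_trans by blast
qed

lemma boundary': assumes "z \<in> half r" "z @ [t] \<notin> half r"
  shows "t = linv r \<and> (\<exists>c. z @ [t] \<doteq> c \<and> lkw r c)"
proof -
  have "(z @ [t]) @ [linv t] \<doteq> z" using eqw_inv_cancel_r(2)[of z "[t]"] by simp
  then have "(z @ [t]) @ [linv t] \<in> half r" using assms half_eqw by blast
  then show ?thesis using boundary[of "z @ [t]" r "linv t"] assms by auto
qed

section \<open>Translates of halfspaces\<close>

definition tr :: "'v word \<Rightarrow> 'v word set \<Rightarrow> 'v word set" where
  "tr a h = {x. winv a @ x \<in> h}"

text \<open>The side containing \<open>a @ [s]\<close> of the hyperplane dual to the edge from
  \<open>a\<close> to \<open>a @ [s]\<close> of the Cayley graph.\<close>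

definition hsp :: "'v word \<Rightarrow> 'v \<times> bool \<Rightarrow> 'v word set" where
  "hsp a s = tr a (half s)"

text \<open>Saturated sets of words are sets of group elements; for them translation by
  \<open>a\<close> is undone by translation by \<open>winv a\<close>.\<close>

definition sat :: "'v word set \<Rightarrow> bool" where
  "sat h \<longleftrightarrow> (\<forall>x y. x \<doteq> y \<longrightarrow> x \<in> h \<longrightarrow> y \<in> h)"

definition halfspaces :: "'v word set set" where
  "halfspaces = {hsp a s | a s. True}"

lemma tr_Nil [simp]: "tr [] h = h"
  by (simp add: tr_def)

lemma tr_append: "tr (a @ b) h = tr a (tr b h)"
  by (simp add: tr_def)

lemma tr_hsp: "tr a (hsp b s) = hsp (a @ b) s"
  by (simp add: hsp_def tr_append)

lemma tr_mono: "h \<subseteq> k \<Longrightarrow> tr a h \<subseteq> tr a k"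
  by (auto simp: tr_def)

lemma tr_compl: "tr a (- h) = - tr a h"
  by (auto simp: tr_def)

lemma sat_mem: "sat h \<Longrightarrow> x \<doteq> y \<Longrightarrow> x \<in> h \<longleftrightarrow> y \<in> h"
  unfolding sat_def using eqw_sym by blast

lemma sat_tr: "sat h \<Longrightarrow> sat (tr a h)"
  unfolding sat_def tr_def by (auto intro: eqw_append)

lemma sat_half: "sat (half s)"
  by (auto simp: sat_def half_eqw)

lemma sat_hsp [simp]: "sat (hsp a s)"
  by (simp add: hsp_def sat_tr sat_half)

lemma sat_halfspaces: "h \<in> halfspaces \<Longrightarrow> sat h"
  by (auto simp: halfspaces_def)

lemma hsp_in [simp]: "hsp a s \<in> halfspaces"
  unfolding halfspaces_def by blast

lemma halfspacesE: assumes "h \<in> halfspaces" obtains a s where "h = hsp a s"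
  using assms unfolding halfspaces_def by blast

lemma tr_halfspaces: "h \<in> halfspaces \<Longrightarrow> tr a h \<in> halfspaces"
  by (erule halfspacesE) (simp add: tr_hsp)

lemma tr_eqw: "sat h \<Longrightarrow> a \<doteq> b \<Longrightarrow> tr a h = tr b h"
  unfolding tr_def by (auto simp: sat_mem[OF _ eqw_append[OF eqw_winv eqw_refl]])

lemma hsp_eqw: "a \<doteq> b \<Longrightarrow> hsp a s = hsp b s"
  by (simp add: hsp_def tr_eqw sat_half)

lemma tr_inv: "sat h \<Longrightarrow> tr (winv a) (tr a h) = h" "sat h \<Longrightarrow> tr a (tr (winv a) h) = h"
  using tr_eqw[OF _ eqw_linv[of a]] tr_eqw[OF _ eqw_rinv[of a]] by (auto simp flip: tr_append)

lemma tr_subset: "sat h \<Longrightarrow> sat k \<Longrightarrow> tr a h \<subseteq> tr a k \<longleftrightarrow> h \<subseteq> k"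
  using tr_mono[of h k a] tr_mono[of "tr a h" "tr a k" "winv a"] by (auto simp: tr_inv)

lemma tr_psubset: "sat h \<Longrightarrow> sat k \<Longrightarrow> tr a h \<subset> tr a k \<longleftrightarrow> h \<subset> k"
  by (simp add: less_le_not_le tr_subset)

lemma tr_psubset_mono: "sat h \<Longrightarrow> sat k \<Longrightarrow> h \<subset> k \<Longrightarrow> tr a h \<subset> tr a k"
  by (simp add: tr_psubset)

lemma tr_inj: "sat h \<Longrightarrow> sat k \<Longrightarrow> tr a h = tr a k \<longleftrightarrow> h = k"
  by (metis tr_inv(1))

lemma tr_mem: "sat h \<Longrightarrow> a @ x \<in> tr a h \<longleftrightarrow> x \<in> h"
  unfolding tr_def using sat_mem[OF _ eqw_inv_cancel(1)] by auto

lemma hsp_compl: "- hsp a s = hsp (a @ [s]) (linv s)"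
  using half_linv_Cons[of s] by (auto simp: hsp_def tr_def)

lemma hsp_compl_in: "h \<in> halfspaces \<Longrightarrow> - h \<in> halfspaces"
  by (erule halfspacesE) (simp add: hsp_compl)

lemma hsp_lkw: "lkw s c \<Longrightarrow> hsp (a @ c) s = hsp a s"
  using half_lkw[of s "winv c"] by (auto simp: hsp_def tr_def)

lemma hsp_self: "a \<notin> hsp a s" "a @ [s] \<in> hsp a s"
proof -
  have "winv a @ a \<doteq> []" by (rule eqw_linv)
  then show "a \<notin> hsp a s" using half_eqw by (auto simp: hsp_def tr_def)
  have "winv a @ a @ [s] \<doteq> [s]" by (rule eqw_inv_cancel)
  moreover have "[s] \<in> half s" by (simp add: half_Cons)
  ultimately show "a @ [s] \<in> hsp a s" using half_eqw by (auto simp: hsp_def tr_def)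
qed

text \<open>The translate of \<open>boundary\<close>: every edge crossing a hyperplane carries its
  label and can serve as its base edge, and base points differ by the link subgroup.\<close>

lemma separate:
  assumes "x \<notin> hsp a s" "x @ [t] \<in> hsp a s"
  shows "t = s" "hsp a s = hsp x s" "\<exists>c. lkw s c \<and> x \<doteq> a @ c"
proof -
  have "winv a @ x \<notin> half s" "(winv a @ x) @ [t] \<in> half s" using assms by (auto simp: hsp_def tr_def)
  then obtain c where c: "t = s" "winv a @ x \<doteq> c" "lkw s c" using boundary by blast
  show "t = s" by (rule c)
  have "x \<doteq> a @ winv a @ x" by (rule eqw_sym, rule eqw_inv_cancel)
  also have "\<dots> \<doteq> a @ c" using c by (intro eqw_append) auto
  finally have x: "x \<doteq> a @ c" .
  then show "\<exists>c. lkw s c \<and> x \<doteq> a @ c" using c by blast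
  show "hsp a s = hsp x s" using hsp_eqw[OF x, of s] hsp_lkw[OF c(3), of a] by simp
qed

lemma separate':
  assumes "x \<in> hsp a s" "x @ [t] \<notin> hsp a s"
  shows "t = linv s" "- hsp a s = hsp x t" "\<exists>c. lkw s c \<and> x @ [t] \<doteq> a @ c"
proof -
  have "x \<notin> hsp (a @ [s]) (linv s)" "x @ [t] \<in> hsp (a @ [s]) (linv s)"
    using assms hsp_compl[of a s] by auto
  note * = separate[OF this]
  show "t = linv s" "- hsp a s = hsp x t" using * by (auto simp: hsp_compl)
  obtain c where c: "lkw s c" "x \<doteq> a @ s # c" using *(3) by auto
  have "x @ [t] \<doteq> (a @ s # c) @ [linv s]"
    using eqw_append[OF c(2) eqw_refl[of "[linv s]"]] *(1) by simp
  also have "\<dots> \<doteq> a @ (s # c @ [linv s]) @ []" by simp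
  also have "\<dots> \<doteq> a @ c @ []" using eqw_lkw_cancel[of "linv s" c] c by (intro eqw_cong) auto
  finally show "\<exists>c. lkw s c \<and> x @ [t] \<doteq> a @ c" using c by auto
qed

lemma crossing_prefix:
  assumes "P []" "\<not> P c"
  shows "\<exists>c1 u c2. c = c1 @ u # c2 \<and> P c1 \<and> \<not> P (c1 @ [u])"
  using assms
proof (induction c rule: rev_induct)
  case (snoc u c)
  then show ?case
  proof (cases "P c")
    case False
    then obtain c1 w c2 where "c = c1 @ w # c2" "P c1" "\<not> P (c1 @ [w])" using snoc by blast
    then show ?thesis by (intro exI[of _ c1] exI[of _ w] exI[of _ "c2 @ [u]"]) auto
  qed auto
qed auto

text \<open>Each point of the halfspace is joined to \<open>a @ [s]\<close> by a geodesic beginning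
  with \<open>s\<close>, and the nonempty prefixes of that geodesic stay inside. Membership in
  \<open>K\<close> is constant along it.\<close>

lemma hsp_connected:
  assumes K: "sat K"
    and step: "\<And>x t. x \<in> hsp a s \<Longrightarrow> x @ [t] \<in> hsp a s \<Longrightarrow> x \<in> K \<longleftrightarrow> x @ [t] \<in> K"
  shows "hsp a s \<subseteq> K \<or> hsp a s \<inter> K = {}"
proof -
  have "x \<in> K \<longleftrightarrow> a @ [s] \<in> K" if "x \<in> hsp a s" for x
  proof -
    have "winv a @ x \<in> half s" using that by (simp add: hsp_def tr_def)
    then obtain y where y: "geo (s # y)" "winv a @ x \<doteq> s # y" using half_geo by blast
    have x: "x \<doteq> a @ s # y"
      using eqw_trans[OF eqw_sym[OF eqw_inv_cancel(2)[of a x]] eqw_append[OF eqw_refl y(2)]] by simp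
    have "geo (s # y) \<Longrightarrow> a @ s # y \<in> K \<longleftrightarrow> a @ [s] \<in> K"
    proof (induction y rule: rev_induct)
      case (snoc t y)
      have g: "geo (s # y)" using geo_append(1)[of "s # y" "[t]"] snoc by simp
      have "a @ z \<in> hsp a s" if "z \<in> half s" for z
        using that tr_mem[OF sat_half] by (simp add: hsp_def)
      then have "a @ s # y \<in> hsp a s" "(a @ s # y) @ [t] \<in> hsp a s"
        using geo_Cons_half g snoc.prems by auto
      then show ?case using step[of "a @ s # y" t] snoc.IH[OF g] by simp
    qed simp
    then show ?thesis using y x sat_mem[OF K x] by simp
  qed
  then show ?thesis by blast
qed

section \<open>Nesting and crossing of halfspaces\<close>

definition nested :: "'v word set \<Rightarrow> 'v word set \<Rightarrow> bool" where
  "nested h k \<longleftrightarrow> h \<subseteq> k \<or> k \<subseteq> h \<or> h \<inter> k = {} \<or> h \<union> k = UNIV"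

text \<open>Suppose all base points \<open>a @ c\<close> of the first hyperplane lie on one side of
  the second. Then the side of the second hyperplane opposite to \<open>a\<close> contains no end of
  an edge dual to the first. Being connected, it lies entirely in \<open>hsp a s\<close> or in its
  complement.\<close>

lemma nested_or_crossing:
  "nested (hsp a s) (hsp b t) \<or> (\<exists>c. lkw s c \<and> (a \<in> hsp b t) \<noteq> (a @ c \<in> hsp b t))"
proof (rule ccontr)
  define k where "k = hsp b t"
  assume "\<not> ?thesis"
  then have nn: "\<not> nested (hsp a s) k" and same: "\<And>c. lkw s c \<Longrightarrow> a \<in> k \<longleftrightarrow> a @ c \<in> k"
    by (auto simp: k_def)
  \<comment> \<open>If \<open>k\<close> separated the ends of a dual edge, that edge would be dual
    to both hyperplanes, and the halfspaces would be equal or complementary.\<close>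
  have same': "a \<in> k \<longleftrightarrow> a @ c @ [s] \<in> k" if c: "lkw s c" for c
  proof (rule ccontr)
    assume ne: "\<not> ?thesis"
    have h: "hsp (a @ c) s = hsp a s" using hsp_lkw c by blast
    show False
    proof (cases "a @ c \<in> k")
      case True
      then have "- k = hsp (a @ c) s"
        using separate'(2)[of "a @ c" b t s] ne same[OF c] by (auto simp: k_def)
      then show False using nn h by (auto simp: nested_def)
    next
      case False
      then have "s = t" "k = hsp (a @ c) t"
        using separate[of "a @ c" b t s] ne same[OF c] by (auto simp: k_def)
      then show False using nn h by (auto simp: nested_def)
    qed
  qed
  have K: "sat k" by (simp add: k_def)
  have bd: "(x \<in> k \<longleftrightarrow> a \<in> k) \<and> (x @ [u] \<in> k \<longleftrightarrow> a \<in> k)" if ne: "(x \<in> hsp a s) \<noteq> (x @ [u] \<in> hsp a s)" for x u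
  proof (cases "x \<in> hsp a s")
    case True
    then obtain c where c: "u = linv s" "lkw s c" "x @ [u] \<doteq> a @ c"
      using separate'(1,3)[of x a s u] ne True by blast
    have "x \<doteq> (x @ [u]) @ [s]" using c(1) eqw_inv_cancel_r(1)[of x "[s]"] eqw_sym by auto
    also have "\<dots> \<doteq> (a @ c) @ [s]" by (rule eqw_append[OF c(3) eqw_refl])
    finally show ?thesis using sat_mem[OF K] c same same'[of c] by auto
  next
    case False
    then obtain c where c: "u = s" "lkw s c" "x \<doteq> a @ c"
      using separate(1,3)[of x a s u] ne False by blast
    then have "x @ [u] \<doteq> (a @ c) @ [s]" using eqw_append[OF c(3) eqw_refl] by simp
    then show ?thesis using sat_mem[OF K] c same same'[of c] by auto
  qed
  show False
  proof (cases "a \<in> k")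
    case True
    have k': "- k = hsp (b @ [t]) (linv t)" by (simp add: k_def hsp_compl)
    have "hsp (b @ [t]) (linv t) \<subseteq> hsp a s \<or> hsp (b @ [t]) (linv t) \<inter> hsp a s = {}"
    proof (rule hsp_connected[OF sat_hsp])
      fix x u assume "x \<in> hsp (b @ [t]) (linv t)"
      then have "x \<notin> k" using k' by blast
      then show "x \<in> hsp a s \<longleftrightarrow> x @ [u] \<in> hsp a s" using bd[of x u] True by blast
    qed
    then show False using nn k' unfolding nested_def by blast
  next
    case False
    have "hsp b t \<subseteq> hsp a s \<or> hsp b t \<inter> hsp a s = {}"
    proof (rule hsp_connected[OF sat_hsp])
      fix x u assume "x \<in> hsp b t"
      then show "x \<in> hsp a s \<longleftrightarrow> x @ [u] \<in> hsp a s" using bd[of x u] False by (auto simp: k_def)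
    qed
    then show False using nn unfolding nested_def k_def by blast
  qed
qed

text \<open>On the way along the first hyperplane from \<open>a\<close> to \<open>a @ c\<close>, the
  second is crossed by a letter of \<open>c\<close>. This letter has the label of \<open>t\<close>,
  and every letter of \<open>c\<close> commutes with \<open>s\<close>. Since no label commutes with
  itself, halfspaces with equal labels are nested.\<close>

lemma not_nested_comm:
  assumes "\<not> nested (hsp a s) (hsp b t)"
  shows "comm (fst s) (fst t)"
proof -
  obtain c where c: "lkw s c" "(a \<in> hsp b t) \<noteq> (a @ c \<in> hsp b t)"
    using nested_or_crossing[of a s b t] assms by blast
  obtain c1 u c2 where u: "c = c1 @ u # c2" "(a @ c1 \<in> hsp b t) \<noteq> (a @ c1 @ [u] \<in> hsp b t)"
    using crossing_prefix[of "\<lambda>c. (a \<in> hsp b t) = (a @ c \<in> hsp b t)" c] c by auto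
  then have "u = t \<or> u = linv t"
    using separate(1)[of "a @ c1" b t u] separate'(1)[of "a @ c1" b t u] by auto
  then have "fst u = fst t" by auto
  then show ?thesis using c u by (auto dest: comm_sym)
qed

text \<open>Each letter of a word leading from \<open>x\<close> to \<open>y\<close> crosses a single
  hyperplane.\<close>

lemma finite_between: "finite {k \<in> halfspaces. x \<notin> k \<and> y \<in> k}"
proof -
  have *: "finite {k \<in> halfspaces. x \<notin> k \<and> x @ w \<in> k}" for w
  proof (induction w rule: rev_induct)
    case (snoc t w)
    have "{k \<in> halfspaces. x \<notin> k \<and> x @ w @ [t] \<in> k} \<subseteq>
        insert (hsp (x @ w) t) {k \<in> halfspaces. x \<notin> k \<and> x @ w \<in> k}"
    proof
      fix k assume k: "k \<in> {k \<in> halfspaces. x \<notin> k \<and> x @ w @ [t] \<in> k}"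
      then obtain a s where a: "k = hsp a s" using halfspacesE by blast
      show "k \<in> insert (hsp (x @ w) t) {k \<in> halfspaces. x \<notin> k \<and> x @ w \<in> k}"
      proof (cases "x @ w \<in> k")
        case False
        then have "t = s" "k = hsp (x @ w) s" using separate(1,2)[of "x @ w" a s t] k a by auto
        then show ?thesis by simp
      qed (use k in auto)
    qed
    then have "finite {k \<in> halfspaces. x \<notin> k \<and> x @ w @ [t] \<in> k}"
      by (rule finite_subset) (use snoc in simp)
    then show ?case by simp
  qed auto
  have y: "y \<doteq> x @ winv x @ y" by (rule eqw_sym, rule eqw_inv_cancel)
  have "{k \<in> halfspaces. x \<notin> k \<and> y \<in> k} = {k \<in> halfspaces. x \<notin> k \<and> x @ winv x @ y \<in> k}"
    by (intro Collect_cong conj_cong refl) (rule sat_mem[OF sat_halfspaces y])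
  then show ?thesis using *[of "winv x @ y"] by simp
qed

lemma halfspace_nonempty: "h \<in> halfspaces \<Longrightarrow> h \<noteq> {}" "h \<in> halfspaces \<Longrightarrow> h \<noteq> UNIV"
  by (metis hsp_self(2) halfspacesE empty_iff, metis hsp_self(1) halfspacesE UNIV_I)

section \<open>Skewered halfspaces\<close>

text \<open>Increasing and decreasing chains are treated at once: either would give infinitely many
  halfspaces separating \<open>z\<close> from \<open>y\<close>.\<close>

lemma no_infinite_chain:
  assumes "\<And>n. f n \<in> halfspaces" "\<And>n::nat. f (Suc n) \<subset> f n \<or> f n \<subset> f (Suc n)"
    and mono: "(\<forall>n. f (Suc n) \<subseteq> f n) \<or> (\<forall>n. f n \<subseteq> f (Suc n))"
    and "\<And>n. y \<in> f n" "\<And>n. z \<notin> f n"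
  shows False
proof -
  have "inj f"
  proof (cases "\<forall>n. f (Suc n) \<subseteq> f n")
    case True
    then have "f (Suc n) \<subset> f n" for n using assms(2)[of n] by blast
    then have "m < n \<Longrightarrow> f n \<subset> f m" for m n
      by (induction n) (auto simp: less_Suc_eq)
    then show ?thesis by (metis injI less_irrefl linorder_neqE_nat)
  next
    case False
    then have "f n \<subset> f (Suc n)" for n using assms(2)[of n] mono by blast
    then have "m < n \<Longrightarrow> f m \<subset> f n" for m n
      by (induction n) (auto simp: less_Suc_eq)
    then show ?thesis by (metis injI less_irrefl linorder_neqE_nat)
  qed
  moreover have "range f \<subseteq> {k \<in> halfspaces. z \<notin> k \<and> y \<in> k}" using assms by blast
  then have "finite (range f)" using finite_between finite_subset by blast
  ultimately show False using finite_imageD infinite_UNIV_nat by blast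
qed

text \<open>Nesting means that \<open>k\<close> is contained in, or contains, some \<open>A\<close>
  among \<open>h\<close> and \<open>- h\<close>, both fixed by \<open>B\<close>. In the first case
  the growing translates of \<open>k\<close> by powers of the inverse of \<open>B\<close> stay
  inside \<open>A\<close>; in the second the shrinking translates by powers of \<open>B\<close>
  still contain \<open>A\<close>. Either way infinitely many halfspaces separate two points.\<close>

lemma skewered_not_nested:
  assumes k: "k \<in> halfspaces" "tr B k \<subset> k" and h: "h \<in> halfspaces" "tr B h = h"
  shows "\<not> nested k h"
proof
  assume n: "nested k h"
  have below: False if A: "k \<subseteq> A" "tr B A = A" "sat A" "A \<noteq> UNIV" for A
  proof -
    define f where "f n = (tr (winv B) ^^ n) k" for n
    have f: "f n \<in> halfspaces" for n by (induction n) (auto simp: f_def k tr_halfspaces)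
    have up: "f n \<subset> f (Suc n)" for n
    proof (induction n)
      case 0
      have "tr (winv B) (tr B k) \<subset> tr (winv B) k"
        using k sat_halfspaces sat_tr by (subst tr_psubset) auto
      then show ?case using k by (simp add: f_def tr_inv sat_halfspaces)
    next
      case (Suc n)
      have "tr (winv B) (f n) \<subset> tr (winv B) (f (Suc n))"
        by (intro tr_psubset_mono sat_halfspaces f Suc)
      then show ?case by (simp add: f_def)
    qed
    have "tr (winv B) A = A" using A tr_inv(1)[of A B] by simp
    then have "f n \<subseteq> A" for n
    proof (induction n)
      case (Suc n)
      then show ?case using tr_mono[of "f n" A "winv B"] \<open>tr (winv B) A = A\<close> by (simp add: f_def)
    qed (use A in \<open>simp add: f_def\<close>)
    moreover obtain z where "z \<notin> A" using A by blast
    moreover obtain y where y: "y \<in> k" using halfspace_nonempty k by blast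
    moreover have "y \<in> f n" for n
    proof (induction n)
      case (Suc n)
      then show ?case using up[of n] by blast
    qed (use y in \<open>simp add: f_def\<close>)
    ultimately show False by (intro no_infinite_chain[of f y z]) (use f up in \<open>auto simp: less_le\<close>)
  qed
  have above: False if A: "A \<subseteq> k" "tr B A = A" "sat A" "A \<noteq> {}" for A
  proof -
    define f where "f n = (tr B ^^ n) k" for n
    have f: "f n \<in> halfspaces" for n by (induction n) (auto simp: f_def k tr_halfspaces)
    have down: "f (Suc n) \<subset> f n" for n
    proof (induction n)
      case (Suc n)
      have "tr B (f (Suc n)) \<subset> tr B (f n)"
        by (intro tr_psubset_mono sat_halfspaces f Suc)
      then show ?case by (simp add: f_def)
    qed (use k in \<open>simp add: f_def\<close>)
    have "A \<subseteq> f n" for n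
    proof (induction n)
      case (Suc n)
      then show ?case using tr_mono[of A "f n" B] A by (simp add: f_def)
    qed (use A in \<open>simp add: f_def\<close>)
    moreover obtain y where "y \<in> A" using A by blast
    moreover obtain z where z: "z \<notin> k" using halfspace_nonempty k by blast
    moreover have "z \<notin> f n" for n
    proof (induction n)
      case (Suc n)
      then show ?case using down[of n] by blast
    qed (use z in \<open>simp add: f_def\<close>)
    ultimately show False by (intro no_infinite_chain[of f y z]) (use f down in \<open>auto simp: less_le\<close>)
  qed
  have hh: "sat h" "sat (- h)" "tr B (- h) = - h" "h \<noteq> {}" "- h \<noteq> {}" "h \<noteq> UNIV" "- h \<noteq> UNIV"
    using h sat_halfspaces hsp_compl_in[OF h(1)] halfspace_nonempty[OF h(1)] by (auto simp: tr_compl)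
  show False
    using n below[of h] below[of "- h"] above[of h] above[of "- h"] hh h unfolding nested_def by blast
qed

section \<open>Words of minimal length in their conjugacy class\<close>

definition cmin :: "'v word \<Rightarrow> bool" where
  "cmin b \<longleftrightarrow> (\<forall>x w. winv x @ b @ x \<doteq> w \<longrightarrow> length b \<le> length w)"

lemma cmin_geo: "cmin b \<Longrightarrow> geo b"
  unfolding cmin_def geo_def by (metis append_Nil append_Nil2 winv_simps(1))

lemma cmin_ex: "\<exists>x b. winv x @ f @ x \<doteq> b \<and> cmin b"
proof -
  define n where "n = (LEAST n. \<exists>x b. winv x @ f @ x \<doteq> b \<and> length b = n)"
  have "\<exists>x b. winv x @ f @ x \<doteq> b \<and> length b = n"
    unfolding n_def by (rule LeastI_ex) blast
  then obtain x b where b: "winv x @ f @ x \<doteq> b" "length b = n" by blast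
  have "length b \<le> length w" if "winv y @ b @ y \<doteq> w" for y w
  proof -
    have "winv (x @ y) @ f @ (x @ y) \<doteq> winv y @ b @ y"
      using eqw_cong[OF b(1), of "winv y" y] by simp
    then have "winv (x @ y) @ f @ (x @ y) \<doteq> w" using that eqw_trans by blast
    then show ?thesis unfolding b(2) n_def by (intro Least_le) blast
  qed
  then show ?thesis using b unfolding cmin_def by blast
qed

lemma cmin_rotate: assumes "cmin (u @ w)" shows "cmin (w @ u)"
  unfolding cmin_def
proof (intro allI impI)
  fix x v assume v: "winv x @ (w @ u) @ x \<doteq> v"
  have "winv (u @ x) @ (u @ w) @ (u @ x) = winv x @ (winv u @ u) @ (w @ u @ x)" by simp
  also have "\<dots> \<doteq> winv x @ [] @ (w @ u @ x)" by (rule eqw_cong, rule eqw_linv)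
  also have "\<dots> \<doteq> v" using v by simp
  finally have "length (u @ w) \<le> length v" using assms unfolding cmin_def by blast
  then show "length (w @ u) \<le> length v" by simp
qed

text \<open>The two halfspaces have the same label, so they are nested. The point \<open>[]\<close>
  lies in neither, \<open>B\<close> in \<open>half s\<close> only, and \<open>B @ [s]\<close> in
  both; this leaves only the strict inclusion.\<close>

lemma cmin_skewers_first: assumes "cmin (s # b)" shows "tr (s # b) (half s) \<subset> half s"
proof -
  define B where "B = s # b"
  have g: "geo B" using assms cmin_geo B_def by blast
  have B: "B \<in> half s" using g geo_Cons_half B_def by auto
  have h: "tr B (half s) = hsp B s" "half s = hsp [] s" by (auto simp: hsp_def)
  have e: "B \<notin> hsp B s" "B @ [s] \<in> hsp B s" using hsp_self by auto
  \<comment> \<open>Otherwise \<open>B\<close> could be written so as to begin with \<open>s\<close>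
    and end with \<open>linv s\<close>, and conjugation by \<open>s\<close> would shorten it by two
    letters.\<close>
  have inv: "winv B \<notin> half s"
  proof
    assume "winv B \<in> half s"
    then obtain y where y: "winv B \<doteq> s # y" "Suc (length y) \<le> length (winv B)" using half_geo by blast
    have By: "B \<doteq> winv y @ [linv s]" using eqw_winv[OF y(1)] by simp
    then have "winv y @ [linv s] \<in> half s" using B half_eqw by blast
    then have "winv y \<in> half s" using boundary[of "winv y" s "linv s"] by auto
    then obtain z where z: "winv y \<doteq> s # z" "Suc (length z) \<le> length (winv y)" using half_geo by blast
    have "winv [s] @ B @ [s] \<doteq> [linv s] @ (winv y @ [linv s]) @ [s]"
      using eqw_cong[OF By, of "[linv s]" "[s]"] by simp
    also have "\<dots> = ([linv s] @ winv y) @ winv [s] @ [s]" by simp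
    also have "\<dots> \<doteq> [linv s] @ winv y" by (rule eqw_inv_cancel_r)
    also have "\<dots> \<doteq> [linv s] @ s # z" using z by (intro eqw_append) auto
    also have "\<dots> \<doteq> z" using eqw_cancel_Cons(2)[of s z] by simp
    finally have "length B \<le> length z" using assms unfolding cmin_def B_def by blast
    then show False using y z by simp
  qed
  then have "[] \<notin> hsp B s" by (simp add: hsp_def tr_def)
  moreover have "[] \<notin> half s" by simp
  moreover have "B @ [s] \<in> half s" using boundary'[of B s s] B by auto
  moreover have "nested (hsp B s) (hsp [] s)" using not_nested_comm[of B s "[]" s] by auto
  ultimately show ?thesis using B e h unfolding nested_def B_def by blast
qed

text \<open>A rotation makes \<open>t\<close> the first letter, and conjugation by \<open>u\<close>
  leads back to the original word. So a word of minimal length skewers the hyperplane of each of its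
  letters.\<close>

lemma cmin_skewers: assumes "cmin (u @ t # w)" shows "tr (u @ t # w) (hsp u t) \<subset> hsp u t"
proof -
  have "cmin (t # (w @ u))" using cmin_rotate[OF assms] by simp
  then have "tr (t # (w @ u)) (half t) \<subset> half t" by (rule cmin_skewers_first)
  then have "tr u (tr (t # (w @ u)) (half t)) \<subset> tr u (half t)"
    by (subst tr_psubset) (auto simp: sat_half sat_tr)
  then show ?thesis by (simp add: hsp_def flip: tr_append)
qed

text \<open>\<open>f\<close> is conjugate to a word of minimal length, whose first letter provides
  the halfspace.\<close>

lemma skewer_ex: assumes "\<not> f \<doteq> []" shows "\<exists>a s. tr f (hsp a s) \<subset> hsp a s"
proof -
  obtain x b where b: "winv x @ f @ x \<doteq> b" "cmin b" using cmin_ex by blast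
  have fx: "f @ x \<doteq> x @ b"
    using eqw_trans[OF eqw_sym[OF eqw_inv_cancel(2)[of x "f @ x"]] eqw_append[OF eqw_refl b(1)]] by simp
  have "b \<noteq> []"
  proof
    assume "b = []"
    then have "f @ x \<doteq> [] @ x" using fx by simp
    then show False using eqw_cancel_right assms by blast
  qed
  then obtain s w where s: "b = s # w" by (meson neq_Nil_conv)
  have "tr b (half s) \<subset> half s" using cmin_skewers_first b s by blast
  then have "tr x (tr b (half s)) \<subset> tr x (half s)" by (subst tr_psubset) (auto simp: sat_half sat_tr)
  moreover have "tr x (tr b (half s)) = tr f (hsp x s)"
    using hsp_eqw[OF fx, of s] by (simp add: hsp_def tr_append)
  ultimately show ?thesis by (metis hsp_def)
qed

text \<open>Every hyperplane along \<open>b\<close> is skewered by \<open>b @ b\<close>, hence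
  crosses each halfspace fixed by \<open>b @ b\<close>; so the letters of \<open>b\<close> commute
  with \<open>s\<close>. This settles halfspaces based at \<open>[]\<close>. The induction shortens
  the base point \<open>x\<close>, either because it may be moved along its hyperplane or because
  its first letter commutes with \<open>b\<close> too.\<close>

lemma cmin_sqrt_stab:
  assumes b: "cmin b" and h: "tr (b @ b) (hsp x s) = hsp x s"
  shows "tr b (hsp x s) = hsp x s"
proof -
  have skew: "tr (b @ b) k \<subset> k" if "tr b k \<subset> k" "sat k" for k
    using that tr_psubset[of "tr b k" k b] sat_tr[of k b] by (simp add: tr_append)
  have letter: "\<exists>u w. b = u @ t # w \<and> tr (b @ b) (hsp u t) \<subset> hsp u t" if t: "t \<in> set b" for t
  proof -
    obtain u w where u: "b = u @ t # w" using t by (meson split_list)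
    then have "tr b (hsp u t) \<subset> hsp u t" using cmin_skewers b by blast
    then have "tr (b @ b) (hsp u t) \<subset> hsp u t" by (rule skew) simp
    then show ?thesis using u by blast
  qed
  have lk: "lkw s b"
    unfolding lkw_def
  proof
    fix t assume "t \<in> set b"
    then obtain u where "tr (b @ b) (hsp u t) \<subset> hsp u t" using letter by blast
    then have "\<not> nested (hsp u t) (hsp x s)" using skewered_not_nested h hsp_in by blast
    then show "comm (fst t) (fst s)" by (rule not_nested_comm)
  qed
  have "geo x \<Longrightarrow> tr (b @ b) (hsp x s) = hsp x s \<Longrightarrow> tr b (hsp x s) = hsp x s" for x
  proof (induction x)
    case Nil
    then show ?case using hsp_lkw[OF lk, of "[]"] by (simp add: tr_hsp)
  next
    case (Cons q x1)
    define x where "x = q # x1"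
    define h where "h = hsp x s"
    define m where "m = half q"
    have g1: "geo x1" using Cons.prems geo_Cons by blast
    have xm: "x \<in> m" using Cons.prems geo_Cons_half by (simp add: x_def m_def)
    have mh: "m = hsp [] q" by (simp add: m_def hsp_def)
    have stab: "tr (b @ b) h = h" using Cons.prems by (simp add: h_def x_def)
    \<comment> \<open>Either a base point of \<open>h\<close> lies outside \<open>m\<close>, so that
      the hyperplane of \<open>h\<close> reaches both sides of that of \<open>m\<close>, or the two
      halfspaces are nested.\<close>
    consider (cross) c where "lkw s c" "x @ c \<notin> m" | (nest) "nested h m"
      using nested_or_crossing[of x s "[]" q] xm by (auto simp: h_def mh)
    then show ?case
    proof cases
      case cross
      obtain c1 u c2 where u: "c = c1 @ u # c2" "x @ c1 \<in> m" "x @ c1 @ [u] \<notin> m"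
        using crossing_prefix[of "\<lambda>c. x @ c \<in> m" c] cross xm by auto
      obtain d where d: "u = linv q" "x @ c1 @ [u] \<doteq> d" "lkw q d"
        using boundary'[of "x @ c1" q u] u by (auto simp: m_def)
      have lk1: "lkw s (c1 @ [u])" using cross u by simp
      have "hsp x s = hsp d s" using hsp_lkw[OF lk1, of x] hsp_eqw[OF d(2)] by simp
      \<comment> \<open>The hyperplane of \<open>h\<close> has a base point \<open>d\<close> in the
        link of \<open>q\<close>. Since \<open>q\<close> commutes with \<open>d\<close>, removing
        \<open>q\<close> from the front of the base point does not change the hyperplane.\<close>
      moreover have "hsp x1 s = hsp d s"
      proof -
        have "x1 @ c1 \<doteq> linv q # (q # x1 @ c1)" by (rule eqw_sym, rule eqw_cancel_Cons)
        also have "\<dots> = linv q # x @ c1" by (simp add: x_def)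
        also have "\<dots> \<doteq> linv q # (x @ c1) @ winv [q] @ [q]"
          by (rule eqw_Cons, rule eqw_sym, rule eqw_inv_cancel_r)
        also have "\<dots> = linv q # (x @ c1 @ [u]) @ [q]" using d by simp
        also have "\<dots> \<doteq> linv q # d @ [q]" by (rule eqw_Cons_append, rule d)
        also have "\<dots> \<doteq> d" by (rule eqw_lkw_cancel, rule d)
        finally have "hsp (x1 @ c1) s = hsp d s" by (rule hsp_eqw)
        then show ?thesis using hsp_lkw[of s c1 x1] lk1 by simp
      qed
      ultimately show ?thesis using Cons.IH g1 Cons.prems by (simp add: x_def)
    next
      case nest
      have xh: "x \<notin> h" "x @ [s] \<in> h" using hsp_self by (auto simp: h_def)
      have "\<exists>A. (A = h \<or> A = - h) \<and> A \<subseteq> m"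
      proof (cases "h \<inter> m = {}")
        case True
        then have "x @ [s] \<notin> m" using xh by blast
        then obtain c where "s = linv q" "x @ [s] \<doteq> c" "lkw q c"
          using boundary'[of x q s] xm by (auto simp: m_def)
        then have "- h = m"
          using hsp_eqw[of "x @ [s]" c q] hsp_lkw[of q c "[]"] by (simp add: h_def hsp_compl mh)
        then show ?thesis by blast
      next
        case False
        then show ?thesis using nest xh xm unfolding nested_def by blast
      qed
      then obtain A where A: "A = h \<or> A = - h" "A \<subseteq> m" by blast
      have A': "A \<in> halfspaces" "tr (b @ b) A = A"
        using A stab hsp_compl_in[of h] by (auto simp: h_def tr_compl)
      have m': "\<not> tr b m \<subset> m"
      proof
        assume "tr b m \<subset> m"
        then have "\<not> nested m A"
          using skewered_not_nested[of m "b @ b" A] A' skew[of m] by (simp add: mh)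
        then show False using A by (auto simp: nested_def)
      qed
      \<comment> \<open>A minimal word that can begin with \<open>q\<close> skewers
        \<open>half q\<close>, which the preceding fact excludes.\<close>
      have bm: "b \<notin> m"
      proof
        assume "b \<in> m"
        then obtain y where y: "b \<doteq> q # y" "Suc (length y) \<le> length b" using half_geo m_def by metis
        have "cmin (q # y)" unfolding cmin_def
        proof (intro allI impI)
          fix z w assume "winv z @ (q # y) @ z \<doteq> w"
          then have "winv z @ b @ z \<doteq> w" using eqw_cong[OF y(1)] eqw_trans by blast
          then show "length (q # y) \<le> length w" using b y unfolding cmin_def by force
        qed
        then have "tr (q # y) (half q) \<subset> half q" by (rule cmin_skewers_first)
        then show False using m' tr_eqw[OF sat_half y(1)] m_def by metis
      qed
      \<comment> \<open>A hyperplane \<open>k\<close> along \<open>b\<close> separates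
        \<open>[]\<close> from \<open>b\<close>, and both points lie outside \<open>m\<close>. As
        \<open>k\<close> is not nested with \<open>A\<close>, which lies in \<open>m\<close>, it
        cannot be nested with \<open>m\<close> either.\<close>
      have lkq: "lkw q b"
        unfolding lkw_def
      proof
        fix t assume "t \<in> set b"
        then obtain u w where u: "b = u @ t # w" "tr (b @ b) (hsp u t) \<subset> hsp u t" using letter by blast
        define k where "k = hsp u t"
        have nn: "\<not> nested k A" using skewered_not_nested[of k "b @ b" A] A' u by (simp add: k_def)
        have gb: "geo (u @ t # w)" using cmin_geo b u by blast
        have "t # w \<in> half t" using gb geo_append(2) geo_Cons_half by blast
        then have bk: "b \<in> k" using tr_mem[OF sat_half] u by (simp add: k_def hsp_def)
        have "geo (winv (u @ [t]))" using gb geo_append(1)[of "u @ [t]" w] geo_winv[of "u @ [t]"] by simp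
        then have "winv u \<notin> half t" using geo_Cons_half(2)[of "linv t" "winv u"] by (simp add: winv_def)
        then have "[] \<notin> k" by (simp add: k_def hsp_def tr_def)
        moreover have "[] \<notin> m" by (simp add: m_def)
        ultimately have "\<not> nested k m" using nn A(2) bk bm unfolding nested_def by blast
        then show "comm (fst t) (fst q)" using not_nested_comm unfolding k_def mh by blast
      qed
      have move: "c @ q # x1 \<doteq> [q] @ c @ x1" if "lkw q c" for c
        using eqw_append[OF eqw_sym[OF eqw_lkw_move[OF that]] eqw_refl[of x1]] by simp
      have c1: "b @ q # x1 \<doteq> [q] @ b @ x1" using move lkq by blast
      have c2: "b @ b @ q # x1 \<doteq> [q] @ b @ b @ x1" using move[of "b @ b"] lkq by simp
      have "tr [q] (tr (b @ b) (hsp x1 s)) = tr [q] (hsp x1 s)"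
        using stab hsp_eqw[OF c2, of s] by (simp add: h_def x_def tr_hsp)
      then have "tr (b @ b) (hsp x1 s) = hsp x1 s" by (subst (asm) tr_inj) (simp_all add: sat_tr)
      then have "tr b (hsp x1 s) = hsp x1 s" using Cons.IH g1 by blast
      then have "tr [q] (tr b (hsp x1 s)) = hsp (q # x1) s" by (simp add: tr_hsp)
      then show ?thesis using hsp_eqw[OF c1, of s] by (simp add: tr_hsp)
    qed
  qed
  moreover obtain x' where "x \<doteq> x'" "geo x'" using geo_ex by blast
  ultimately show ?thesis using h hsp_eqw by metis
qed

text \<open>In particular no element exchanges two distinct halfspaces: this is what rules out
  reversed copies of a chain.\<close>

lemma sqrt_stab:
  assumes "h \<in> halfspaces" "tr f (tr f h) = h"
  shows "tr f h = h"
proof -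
  obtain x b where b: "winv x @ f @ x \<doteq> b" "cmin b" using cmin_ex by blast
  obtain a s where a: "h = hsp a s" using assms by (auto simp: halfspaces_def)
  have sat: "sat k" if "k = tr c h" for k c using that a by (simp add: tr_hsp)
  have conj: "tr b (tr (winv x) k) = tr (winv x) (tr f k)" if "sat k" for k
  proof -
    have "tr b (tr (winv x) k) = tr (winv x @ f @ x) (tr (winv x) k)"
      using that b sat_tr tr_eqw by metis
    also have "\<dots> = tr (winv x) (tr f (tr x (tr (winv x) k)))" by (simp add: tr_append)
    finally show ?thesis using that by (simp add: tr_inv)
  qed
  have s: "sat h" "sat (tr f h)" using a by (auto simp: tr_hsp)
  have "tr (b @ b) (hsp (winv x @ a) s) = hsp (winv x @ a) s"
    using conj[OF s(1)] conj[OF s(2)] assms(2) a by (simp add: tr_append flip: tr_hsp)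
  from cmin_sqrt_stab[OF b(2) this] have "tr b (tr (winv x) h) = tr (winv x) h"
    unfolding a tr_hsp .
  then show ?thesis using conj[OF s(1)] s tr_inj by metis
qed

end

section \<open>Counting copies of a chain of halfspaces\<close>

context raag
begin

definition walls :: "'v \<Rightarrow> 'v word set set" where
  "walls v = {hsp a s | a s. fst s = v}"

definition sep :: "'v \<Rightarrow> 'v word \<Rightarrow> 'v word \<Rightarrow> 'v word set set" where
  "sep v x y = {k \<in> walls v. x \<notin> k \<and> y \<in> k}"

lemma walls_halfspaces: "k \<in> walls v \<Longrightarrow> k \<in> halfspaces"
  unfolding walls_def halfspaces_def by blast

lemma walls_sat: "k \<in> walls v \<Longrightarrow> sat k"
  using walls_halfspaces sat_halfspaces by blast

lemma wallsE: assumes "k \<in> walls v" obtains a s where "k = hsp a s" "fst s = v"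
  using assms unfolding walls_def by blast

lemma hsp_walls: "fst s = v \<Longrightarrow> hsp a s \<in> walls v"
  unfolding walls_def by blast

lemma tr_walls: "k \<in> walls v \<Longrightarrow> tr a k \<in> walls v"
  by (erule wallsE) (simp add: tr_hsp hsp_walls)

lemma compl_walls: "k \<in> walls v \<Longrightarrow> - k \<in> walls v"
  by (erule wallsE) (simp add: hsp_compl hsp_walls)

lemma walls_nested: assumes "k \<in> walls v" "k' \<in> walls v" shows "nested k k'"
proof -
  obtain a s where "k = hsp a s" "fst s = v" using assms(1) by (rule wallsE)
  moreover obtain b t where "k' = hsp b t" "fst t = v" using assms(2) by (rule wallsE)
  ultimately show ?thesis using not_nested_comm[of a s b t] by auto
qed

lemma walls_psubset:
  assumes "k \<in> walls v" "k' \<in> walls v" "x \<notin> k" "x \<notin> k'" "y \<in> k" "y \<in> k'" "z \<in> k" "z \<notin> k'"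
  shows "k' \<subset> k"
  using walls_nested[OF assms(1,2)] assms unfolding nested_def by blast

lemma finite_sep: "finite (sep v x y)"
  by (rule finite_subset[OF _ finite_between[of x y]]) (auto simp: sep_def walls_halfspaces)

lemma sep_eqw: assumes "x \<doteq> x'" "y \<doteq> y'" shows "sep v x y = sep v x' y'"
  unfolding sep_def
  by (intro Collect_cong conj_cong refl arg_cong[where f = Not])
     (rule sat_mem[OF walls_sat assms(1)] sat_mem[OF walls_sat assms(2)]; assumption)+

end

locale raag_chain = raag comm for comm :: "'v \<Rightarrow> 'v \<Rightarrow> bool" +
  fixes v :: 'v and hs :: "'v word set list"
  assumes hs_walls: "set hs \<subseteq> walls v" and hs_nonempty: "hs \<noteq> []"
    and hs_sorted: "sorted_wrt (\<lambda>h k. k \<subset> h) hs"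
begin

text \<open>The elements of \<open>fs\<close> carry the chain to copies without overlap, each
  strictly inside the preceding one. The maximum \<open>cnt\<close> is the analogue, for chains of
  halfspaces, of the number of disjoint copies of a word in Brooks's counting
  quasimorphisms.\<close>

definition copies :: "'v word set set \<Rightarrow> 'v word list \<Rightarrow> bool" where
  "copies M fs \<longleftrightarrow> (\<forall>f\<in>set fs. \<forall>h\<in>set hs. tr f h \<in> M) \<and>
     sorted_wrt (\<lambda>f g. tr g (hd hs) \<subset> tr f (last hs)) fs"

definition cnt :: "'v word set set \<Rightarrow> nat" where
  "cnt M = Max (length ` {fs. copies M fs})"

lemma hd_last: "hd hs \<in> set hs" "last hs \<in> set hs" "h \<in> set hs \<Longrightarrow> last hs \<subseteq> h" "h \<in> set hs \<Longrightarrow> h \<subseteq> hd hs"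
proof -
  show "hd hs \<in> set hs" "last hs \<in> set hs" using hs_nonempty by auto
  assume h: "h \<in> set hs"
  have "sorted_wrt (\<lambda>h k. k \<subset> h) (butlast hs @ [last hs])" using hs_sorted hs_nonempty by simp
  moreover have "h \<in> set (butlast hs @ [last hs])" using h hs_nonempty by simp
  ultimately show "last hs \<subseteq> h" unfolding sorted_wrt_append by auto
  have "sorted_wrt (\<lambda>h k. k \<subset> h) (hd hs # tl hs)" "h \<in> set (hd hs # tl hs)"
    using hs_sorted hs_nonempty h by simp_all
  then show "h \<subseteq> hd hs" by auto
qed

lemma copies_length: assumes "copies M fs" "finite M" shows "length fs \<le> card M"
proof -
  have *: "sorted_wrt (\<lambda>f g. tr g (hd hs) \<subset> tr f (last hs)) fs \<Longrightarrow> distinct (map (\<lambda>f. tr f (hd hs)) fs)"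
  proof (induction fs)
    case (Cons f fs)
    have "tr f (last hs) \<subseteq> tr f (hd hs)" using hd_last tr_mono by blast
    then show ?case using Cons by fastforce
  qed simp
  have "set (map (\<lambda>f. tr f (hd hs)) fs) \<subseteq> M" using assms(1) hd_last by (auto simp: copies_def)
  then have "card (set (map (\<lambda>f. tr f (hd hs)) fs)) \<le> card M" using assms(2) card_mono by blast
  then show ?thesis using * assms(1) distinct_card unfolding copies_def by fastforce
qed

lemma copies_finite: assumes "finite M" shows "finite (length ` {fs. copies M fs})"
  by (rule finite_subset[of _ "{..card M}"]) (use copies_length assms in auto)

lemma cnt_ge: "finite M \<Longrightarrow> copies M fs \<Longrightarrow> length fs \<le> cnt M"
  unfolding cnt_def using copies_finite by (intro Max_ge) auto

lemma cnt_ex: assumes "finite M" shows "\<exists>fs. copies M fs \<and> length fs = cnt M"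
proof -
  have "copies M []" by (simp add: copies_def)
  then have "cnt M \<in> length ` {fs. copies M fs}"
    unfolding cnt_def by (intro Max_in copies_finite assms) auto
  then show ?thesis by auto
qed

text \<open>Among the halfspaces separating \<open>x\<close> from \<open>y\<close>, those containing
  \<open>z\<close> contain those missing it, because equal labels force nesting. So families on the
  two sides can be concatenated. Conversely, at most one copy in a family is cut by
  \<open>z\<close>, since each copy lies inside the smallest halfspace of the preceding one.\<close>

lemma cnt_split:
  fixes x y z
  defines "M \<equiv> sep v x y"
  defines "A \<equiv> {k \<in> M. z \<in> k}" and "B \<equiv> {k \<in> M. z \<notin> k}"
  shows "cnt A + cnt B \<le> cnt M + 1" "cnt M \<le> cnt A + cnt B + 1"
proof -
  have fin: "finite M" "finite A" "finite B" using finite_sep by (auto simp: M_def A_def B_def)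
  obtain fs where fs: "copies A fs" "length fs = cnt A" using cnt_ex fin by blast
  obtain gs where gs: "copies B gs" "length gs = cnt B" using cnt_ex fin by blast
  \<comment> \<open>Giving up the last copy \<open>f0\<close> costs the 1 in the bound; it stays as
    a buffer between the remaining copies of the two families.\<close>
  have "copies M (butlast fs @ gs)"
  proof -
    have "tr g (hd hs) \<subset> tr f (last hs)" if f: "f \<in> set (butlast fs)" and g: "g \<in> set gs" for f g
    proof -
      have ne: "fs \<noteq> []" using f by auto
      define f0 where "f0 = last fs"
      have "sorted_wrt (\<lambda>f g. tr g (hd hs) \<subset> tr f (last hs)) (butlast fs @ [f0])"
        using fs ne by (simp add: copies_def f0_def)
      then have 1: "tr f0 (hd hs) \<subset> tr f (last hs)" using f unfolding sorted_wrt_append by auto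
      have "f0 \<in> set fs" using ne f0_def by simp
      then have "tr f0 (hd hs) \<in> A" "tr g (hd hs) \<in> B"
        using fs gs g hd_last by (auto simp: copies_def)
      then have "tr g (hd hs) \<subset> tr f0 (hd hs)"
        by (intro walls_psubset[of _ v _ x y z]) (auto simp: A_def B_def M_def sep_def)
      then show ?thesis using 1 by blast
    qed
    then show ?thesis
      using fs(1) gs(1) unfolding copies_def sorted_wrt_append A_def B_def
      by (auto simp: butlast_conv_take sorted_wrt_take dest: in_set_takeD)
  qed
  then show "cnt A + cnt B \<le> cnt M + 1" using cnt_ge[OF fin(1)] fs(2) gs(2) by fastforce
  obtain cs where cs: "copies M cs" "length cs = cnt M" using cnt_ex fin by blast
  \<comment> \<open>By nesting it suffices to test the smallest halfspace of a copy for containing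
    \<open>z\<close>, and the largest for missing it.\<close>
  define P where "P f \<longleftrightarrow> z \<in> tr f (last hs)" for f
  define Q where "Q f \<longleftrightarrow> z \<notin> tr f (hd hs)" for f
  have cs': "sorted_wrt (\<lambda>f g. tr g (hd hs) \<subset> tr f (last hs)) (filter R cs)" for R
    using cs(1) sorted_wrt_filter unfolding copies_def by blast
  have cs'': "tr f h \<in> M" if "f \<in> set cs" "h \<in> set hs" for f h
    using cs(1) that unfolding copies_def by blast
  have "z \<in> tr f h" if "P f" "h \<in> set hs" for f h
    using that tr_mono[OF hd_last(3)[OF that(2)], of f] unfolding P_def by blast
  then have "copies A (filter P cs)"
    using cs' cs'' by (simp add: copies_def A_def)
  then have a: "length (filter P cs) \<le> cnt A" using cnt_ge fin by blast
  have "z \<notin> tr f h" if "Q f" "h \<in> set hs" for f h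
    using that tr_mono[OF hd_last(4)[OF that(2)], of f] unfolding Q_def by blast
  then have "copies B (filter Q cs)"
    using cs' cs'' by (simp add: copies_def B_def)
  then have b: "length (filter Q cs) \<le> cnt B" using cnt_ge fin by blast
  have c: "length (filter (\<lambda>f. \<not> P f \<and> \<not> Q f) cs) \<le> 1"
  proof (rule ccontr)
    assume "\<not> ?thesis"
    then have "Suc (Suc 0) \<le> length (filter (\<lambda>f. \<not> P f \<and> \<not> Q f) cs)" by simp
    then obtain f g l where l: "filter (\<lambda>f. \<not> P f \<and> \<not> Q f) cs = f # g # l"
      unfolding Suc_le_length_iff by blast
    have "sorted_wrt (\<lambda>f g. tr g (hd hs) \<subset> tr f (last hs)) (f # g # l)"
      using cs' unfolding l[symmetric] by blast
    then have "tr g (hd hs) \<subset> tr f (last hs)" by simp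
    moreover have "f \<in> set (filter (\<lambda>f. \<not> P f \<and> \<not> Q f) cs)" "g \<in> set (filter (\<lambda>f. \<not> P f \<and> \<not> Q f) cs)"
      by (simp_all add: l)
    then have "\<not> P f" "\<not> Q g" by simp_all
    ultimately show False unfolding P_def Q_def by blast
  qed
  have "length cs \<le> length (filter P cs) + length (filter Q cs) + length (filter (\<lambda>f. \<not> P f \<and> \<not> Q f) cs)"
    by (induction cs) auto
  then show "cnt M \<le> cnt A + cnt B + 1" using a b c cs by simp
qed

definition om :: "'v word \<Rightarrow> 'v word \<Rightarrow> int" where
  "om x y = int (cnt (sep v x y)) - int (cnt (sep v y x))"

lemma om_swap: "om y x = - om x y"
  by (simp add: om_def)

text \<open>Each of the six counts is split at the third point; the twelve parts cancel in pairs,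
  and every splitting costs at most 1.\<close>

lemma om_defect: "\<bar>om x y + om y z + om z x\<bar> \<le> 6"
proof -
  define T where "T a b c = cnt {k \<in> walls v. (x \<in> k) = a \<and> (y \<in> k) = b \<and> (z \<in> k) = c}" for a b c
  have sets: "{k \<in> sep v p q. r \<in> k} = {k \<in> walls v. p \<notin> k \<and> q \<in> k \<and> r \<in> k}"
    "{k \<in> sep v p q. r \<notin> k} = {k \<in> walls v. p \<notin> k \<and> q \<in> k \<and> r \<notin> k}" for p q r
    by (auto simp: sep_def)
  have T: "T False True True = cnt {k \<in> sep v x y. z \<in> k}" "T False True True = cnt {k \<in> sep v x z. y \<in> k}"
    "T False True False = cnt {k \<in> sep v x y. z \<notin> k}" "T False True False = cnt {k \<in> sep v z y. x \<notin> k}"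
    "T True False True = cnt {k \<in> sep v y z. x \<in> k}" "T True False True = cnt {k \<in> sep v y x. z \<in> k}"
    "T False False True = cnt {k \<in> sep v y z. x \<notin> k}" "T False False True = cnt {k \<in> sep v x z. y \<notin> k}"
    "T True True False = cnt {k \<in> sep v z x. y \<in> k}" "T True True False = cnt {k \<in> sep v z y. x \<in> k}"
    "T True False False = cnt {k \<in> sep v z x. y \<notin> k}" "T True False False = cnt {k \<in> sep v y x. z \<notin> k}"
    unfolding T_def sets by (rule arg_cong[where f = cnt], blast)+
  show ?thesis
    using cnt_split[of x y z] cnt_split[of y z x] cnt_split[of z x y]
      cnt_split[of y x z] cnt_split[of z y x] cnt_split[of x z y]
    unfolding om_def T[symmetric] by linarith
qed

lemma cnt_sep_tr_le: "cnt (sep v x y) \<le> cnt (sep v (f @ x) (f @ y))"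
proof -
  obtain gs where gs: "copies (sep v x y) gs" "length gs = cnt (sep v x y)" using cnt_ex finite_sep by blast
  have s: "sat (tr g h)" if "h \<in> set hs" for g h
    using that hs_walls walls_sat tr_walls by blast
  have "tr (f @ g) h \<in> sep v (f @ x) (f @ y)" if "g \<in> set gs" "h \<in> set hs" for g h
    using gs(1) that tr_mem[OF s] tr_walls unfolding copies_def sep_def by (auto simp: tr_append)
  moreover have "sorted_wrt (\<lambda>f g. tr g (hd hs) \<subset> tr f (last hs)) (map ((@) f) gs)"
    using gs(1) tr_psubset[OF s s] hd_last unfolding copies_def sorted_wrt_map
    by (auto simp: tr_append)
  ultimately have "copies (sep v (f @ x) (f @ y)) (map ((@) f) gs)" by (auto simp: copies_def)
  then show ?thesis using cnt_ge[OF finite_sep] gs by fastforce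
qed

lemma cnt_sep_tr: "cnt (sep v (f @ x) (f @ y)) = cnt (sep v x y)"
proof (rule antisym)
  have "cnt (sep v (f @ x) (f @ y)) \<le> cnt (sep v (winv f @ f @ x) (winv f @ f @ y))" by (rule cnt_sep_tr_le)
  then show "cnt (sep v (f @ x) (f @ y)) \<le> cnt (sep v x y)"
    using sep_eqw[OF eqw_inv_cancel(1)[of f x] eqw_inv_cancel(1)[of f y]] by simp
qed (rule cnt_sep_tr_le)

lemma om_tr: "om (f @ x) (f @ y) = om x y"
  by (simp add: om_def cnt_sep_tr)

lemma om_eqw: "x \<doteq> x' \<Longrightarrow> y \<doteq> y' \<Longrightarrow> om x y = om x' y'"
  unfolding om_def using sep_eqw[of x x' y y'] sep_eqw[of y y' x x'] by simp

text \<open>The defect bound at the points \<open>p\<close>, \<open>u @ p\<close> and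
  \<open>u @ w @ p\<close>, with the middle term moved back to \<open>p\<close> by left
  translation.\<close>

lemma om_append: "\<bar>om p (u @ w @ p) - om p (u @ p) - om p (w @ p)\<bar> \<le> 6"
  using om_defect[of p "u @ p" "u @ w @ p"] om_tr[of u p "w @ p"] om_swap[of "u @ w @ p" p] by linarith

lemma om_winv: "om p (winv w @ p) = - om p (w @ p)"
proof -
  have "om p (winv w @ p) = om (w @ p) (w @ winv w @ p)" by (simp only: om_tr)
  also have "\<dots> = om (w @ p) p" by (intro om_eqw eqw_inv_cancel eqw_refl)
  finally show ?thesis using om_swap[of "w @ p" p] by linarith
qed

end

section \<open>The quasimorphism attached to a nontrivial element\<close>

lemma finite_chain_list:
  fixes S :: "'a set set"
  assumes "finite S" "\<And>h k. h \<in> S \<Longrightarrow> k \<in> S \<Longrightarrow> h \<subseteq> k \<or> k \<subseteq> h"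
  shows "\<exists>l. set l = S \<and> sorted_wrt (\<lambda>h k. k \<subset> h) l"
  using assms
proof (induction "card S" arbitrary: S)
  case 0
  then show ?case by (intro exI[of _ "[]"]) auto
next
  case (Suc n)
  then have "S \<noteq> {}" by auto
  then obtain m where m: "m \<in> S" "\<And>k. k \<in> S \<Longrightarrow> m \<subseteq> k \<Longrightarrow> m = k"
    using finite_has_maximal[OF Suc.prems(1)] by blast
  have "card (S - {m}) = n" using Suc m by simp
  then obtain l where l: "set l = S - {m}" "sorted_wrt (\<lambda>h k. k \<subset> h) l"
    using Suc.hyps(1)[of "S - {m}"] Suc.prems by blast
  then show ?case using m Suc.prems(2)[OF m(1)] by (intro exI[of _ "m # l"]) auto
qed

abbreviation wpow :: "'v word \<Rightarrow> nat \<Rightarrow> 'v word" where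
  "wpow f n \<equiv> concat (replicate n f)"

context raag
begin

lemma wpow_skewer:
  assumes "sat h" "tr f h \<subset> h"
  shows "tr (wpow f (i + d)) h \<subseteq> tr (wpow f i) h" "tr (wpow f (i + Suc d)) h \<subset> tr (wpow f i) h"
proof -
  have 1: "tr (wpow f (Suc i)) h \<subset> tr (wpow f i) h" for i
  proof -
    have "wpow f (Suc i) = wpow f i @ f"
      using replicate_add[of i 1 f] by simp
    then show ?thesis using assms tr_psubset[OF sat_tr assms(1)] by (simp add: tr_append)
  qed
  have *: "tr (wpow f (i + d)) h \<subseteq> tr (wpow f i) h" for i d
  proof (induction d)
    case (Suc d)
    then show ?case using 1[of "i + d"] by auto
  qed simp
  show "tr (wpow f (i + d)) h \<subseteq> tr (wpow f i) h" by (rule *)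
  show "tr (wpow f (i + Suc d)) h \<subset> tr (wpow f i) h"
    using *[of "Suc i" d] 1[of i] by auto
qed

text \<open>By nesting, \<open>k\<close> either strictly contains \<open>tr (wpow f n) h\<close> or
  lies in it, and this decides whether to descend. The point \<open>x\<close> and a point of the
  smallest translate rule out the other two kinds of nesting.\<close>

lemma between_tr_powers:
  assumes k: "k \<in> walls v" and h: "h \<in> walls v" "tr f h \<subset> h"
    and "k \<subseteq> h" "tr (wpow f n) h \<subset> k" "x \<notin> h"
  shows "\<exists>i<n. k \<subseteq> tr (wpow f i) h \<and> tr (wpow f (Suc i)) h \<subset> k"
  using assms(5)
proof (induction n)
  case 0
  then show ?case using assms(4) by auto
next
  case (Suc n)
  show ?case
  proof (cases "tr (wpow f n) h \<subset> k")
    case True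
    then show ?thesis using Suc.IH less_SucI by blast
  next
    case False
    have "tr (wpow f n) h \<in> walls v" using h tr_walls by blast
    then have "nested k (tr (wpow f n) h)" using k walls_nested by blast
    moreover have sub: "tr (wpow f (Suc n)) h \<subseteq> tr (wpow f n) h" "tr (wpow f n) h \<subseteq> h"
      using wpow_skewer(1)[OF walls_sat[OF h(1)] h(2), of n 1] wpow_skewer(1)[OF walls_sat[OF h(1)] h(2), of 0 n]
      by auto
    moreover have "tr (wpow f (Suc n)) h \<noteq> {}"
      using h tr_walls walls_halfspaces halfspace_nonempty by blast
    ultimately have "k \<subseteq> tr (wpow f n) h"
      using False Suc.prems assms(4,6) unfolding nested_def by blast
    then show ?thesis using Suc.prems by blast
  qed
qed

text \<open>The value at \<open>w\<close> is the signed count between a base point \<open>p\<close>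
  just inside \<open>h\<close> and \<open>w @ p\<close>. The substance is the lower bound: the
  powers of \<open>f\<close> give \<open>n - 1\<close> copies, and the reversed count is shown to
  vanish.\<close>

theorem raag_quasimorphism:
  assumes "\<not> f \<doteq> []"
  shows "\<exists>\<phi> :: 'v word \<Rightarrow> int. (\<forall>u w. u \<doteq> w \<longrightarrow> \<phi> u = \<phi> w) \<and> (\<forall>u w. \<bar>\<phi> (u @ w) - \<phi> u - \<phi> w\<bar> \<le> 6) \<and>
     (\<forall>w. \<phi> (winv w) = - \<phi> w) \<and> (\<forall>n. int n - 1 \<le> \<phi> (wpow f n))"
proof -
  obtain a s where skew: "tr f (hsp a s) \<subset> hsp a s" using skewer_ex assms by blast
  define v where "v = fst s"
  define h where "h = hsp a s"
  define p where "p = a @ [s]"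
  have hw: "h \<in> walls v" by (simp add: h_def v_def hsp_walls)
  have fh: "tr f h \<subset> h" using skew h_def by simp
  have hsat: "sat h" by (simp add: h_def)
  have ap: "a \<notin> h" "p \<in> h" using hsp_self by (auto simp: h_def p_def)
  \<comment> \<open>The edge from \<open>a\<close> to \<open>p\<close> crosses one hyperplane only;
    this pins down both ends of the segment of the axis.\<close>
  have only: "k = hsp a s" if "a \<notin> k" "p \<in> k" "k \<in> walls v" for k
    using that separate(1,2)[of a _ _ s] unfolding p_def by (metis wallsE)
  have pfh: "p \<notin> tr f h"
    using only[of "tr f h"] fh ap tr_walls[OF hw] unfolding h_def by blast
  \<comment> \<open>Including \<open>h\<close> and excluding \<open>tr f h\<close> makes the
    translates of this chain by powers of \<open>f\<close> follow each other without overlap or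
    gap.\<close>
  define S where "S = {k \<in> walls v. tr f h \<subset> k \<and> k \<subseteq> h}"
  obtain y where y: "y \<in> tr f h" using tr_walls[OF hw] walls_halfspaces halfspace_nonempty by blast
  have "finite S" by (rule finite_subset[OF _ finite_sep[of v a y]]) (use ap y in \<open>auto simp: S_def sep_def\<close>)
  moreover have "k \<subseteq> k' \<or> k' \<subseteq> k" if "k \<in> S" "k' \<in> S" for k k'
    using that walls_nested[of k v k'] ap y unfolding S_def nested_def by blast
  ultimately obtain hs where hs: "set hs = S" "sorted_wrt (\<lambda>h k. k \<subset> h) hs"
    using finite_chain_list[of S] by metis
  have hS: "h \<in> S" using hw fh by (simp add: S_def)
  interpret raag_chain comm v hs
    by unfold_locales (use hs hS in \<open>auto simp: S_def\<close>)
  have hd: "hd hs = h" using hd_last(1) hd_last(4)[of h] hS hs by (auto simp: S_def)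
  define r where "r = length hs"
  have r: "r > 0" using hs_nonempty by (simp add: r_def)
  have nthS: "hs ! l \<in> S" if "l < r" for l using that hs by (auto simp: r_def)
  have hs_mono: "hs ! m \<subset> hs ! l" if "l < m" "m < r" for l m
    using sorted_wrt_nth_less[OF hs(2), of l m] that unfolding r_def by simp
  note skp = wpow_skewer[OF hsat fh]
  \<comment> \<open>The halfspaces of the axis in decreasing order; the quotient by the chain length
    \<open>r\<close> gives the power of \<open>f\<close>, the remainder the place in the
    chain.\<close>
  define ax where "ax j = tr (wpow f (j div r)) (hs ! (j mod r))" for j
  have satS: "sat k" if "k \<in> S" for k using that walls_sat by (auto simp: S_def)
  have ax_walls: "ax j \<in> walls v" for j
    using nthS[of "j mod r"] r tr_walls by (auto simp: ax_def S_def)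
  have trS: "tr w (tr f h) \<subset> tr w k \<and> tr w k \<subseteq> tr w h" if "k \<in> S" for w k
    using that hsat satS[OF that] tr_psubset[OF sat_tr[OF hsat] satS[OF that], of w f] tr_mono[of k h w]
    by (auto simp: S_def)
  have ax_step: "ax (Suc j) \<subset> ax j" for j
  proof (cases "Suc (j mod r) = r")
    case False
    then have "Suc (j mod r) < r" using r mod_less_divisor[OF r, of j] by linarith
    then have "Suc j mod r = Suc (j mod r)" "Suc j div r = j div r"
      by (simp_all add: mod_Suc div_Suc)
    then show ?thesis
      using hs_mono[of "j mod r" "Suc (j mod r)"] \<open>Suc (j mod r) < r\<close> nthS satS tr_psubset by (simp add: ax_def)
  next
    case True
    then have 1: "Suc j mod r = 0" "Suc j div r = Suc (j div r)"
      by (simp_all add: mod_Suc div_Suc)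
    have "wpow f (Suc (j div r)) = wpow f (j div r) @ f" using replicate_add[of "j div r" 1 f] by simp
    then have "ax (Suc j) = tr (wpow f (j div r)) (tr f h)"
      using 1 hd hs_nonempty by (simp add: ax_def tr_append flip: hd_conv_nth)
    then show ?thesis using trS[OF nthS[of "j mod r"], of "wpow f (j div r)"] r by (simp add: ax_def)
  qed
  have ax_mono: "ax j' \<subset> ax j" if "j < j'" for j j'
    using that by (induction j') (use ax_step in \<open>auto simp: less_Suc_eq\<close>)
  have ax_less: "j < j'" if "ax j' \<subset> ax j" for j j'
    using that ax_mono[of j' j] by (metis linorder_neqE_nat order.asym order.irrefl)
  define \<phi> where "\<phi> w = om p (w @ p)" for w
  have lower: "int n - 1 \<le> \<phi> (wpow f n)" for n
  proof (cases "n = 0")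
    case True
    then show ?thesis by (simp add: \<phi>_def om_def)
  next
    case n: False
    define q where "q = wpow f n @ p"
    have q: "q \<in> tr (wpow f n) h" using tr_mem[OF hsat] ap by (simp add: q_def)
    \<comment> \<open>The zeroth power is left out because \<open>p\<close> lies in
      \<open>h\<close>, hence the loss of 1.\<close>
    define gs where "gs = map (wpow f) [1..<n]"
    have "copies (sep v p q) gs"
      unfolding copies_def
    proof (intro conjI ballI)
      fix g k assume "g \<in> set gs" and k: "k \<in> set hs"
      then obtain i where i: "1 \<le> i" "i < n" "g = wpow f i" by (auto simp: gs_def)
      have kS: "k \<in> S" using k hs by simp
      have "tr (wpow f i) k \<subseteq> tr (wpow f i) h" using trS kS by blast
      also have "\<dots> \<subseteq> tr (wpow f 1) h" using skp(1)[of 1 "i - 1"] i by simp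
      finally have 1: "p \<notin> tr g k" using pfh i by auto
      have "wpow f (Suc i) = wpow f i @ f" using replicate_add[of i 1 f] by simp
      then have "tr (wpow f (Suc i)) h \<subseteq> tr (wpow f i) k" using trS[OF kS, of "wpow f i"] by (auto simp: tr_append)
      moreover have "tr (wpow f n) h \<subseteq> tr (wpow f (Suc i)) h" using skp(1)[of "Suc i" "n - Suc i"] i by simp
      ultimately have "q \<in> tr g k" using q i by blast
      then show "tr g k \<in> sep v p q" using 1 kS tr_walls by (auto simp: sep_def S_def)
    next
      have "tr (wpow f j) (hd hs) \<subset> tr (wpow f i) (last hs)" if "i < j" for i j
      proof -
        have "last hs \<in> S" using hd_last(2) hs by simp
        then have "tr (wpow f i) (tr f h) \<subset> tr (wpow f i) (last hs)" using trS by blast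
        moreover have "wpow f (Suc i) = wpow f i @ f" using replicate_add[of i 1 f] by simp
        moreover have "tr (wpow f j) h \<subseteq> tr (wpow f (Suc i)) h" using skp(1)[of "Suc i" "j - Suc i"] that by simp
        ultimately show ?thesis using hd by (auto simp: tr_append)
      qed
      then show "sorted_wrt (\<lambda>f g. tr g (hd hs) \<subset> tr f (last hs)) gs"
        unfolding gs_def sorted_wrt_map by (intro sorted_wrt_mono_rel[OF _ sorted_wrt_upt])
    qed
    then have up: "n - 1 \<le> cnt (sep v p q)" using cnt_ge[OF finite_sep] by (fastforce simp: gs_def)
    \<comment> \<open>A separating halfspace \<open>k\<close> lies between \<open>h\<close> and
      \<open>tr (wpow f n) h\<close>, since \<open>only\<close> excludes anything else at either
      end. Unless it equals the latter, it falls between two successive translates of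
      \<open>h\<close>, and translating it back puts it into \<open>S\<close>.\<close>
    have axis: "\<exists>j. k = ax j" if k: "k \<in> sep v p q" for k
    proof -
      have kw: "k \<in> walls v" "p \<notin> k" "q \<in> k" using k by (auto simp: sep_def)
      have qh: "q \<in> h" using q skp(1)[of 0 n] by auto
      have kh: "k \<subseteq> h"
      proof (rule ccontr)
        assume "\<not> ?thesis"
        then have "k \<union> h = UNIV"
          using walls_nested[OF kw(1) hw] kw ap qh unfolding nested_def by blast
        then have "a \<in> k" using ap by blast
        then have "- k = hsp a s" using kw by (intro only compl_walls) auto
        then show False using kw qh by (auto simp: h_def)
      qed
      define N where "N = tr (wpow f n) h"
      have Nw: "N \<in> walls v" using tr_walls hw by (simp add: N_def)
      have "N \<subseteq> tr f h" using skp(1)[of 1 "n - 1"] n by (simp add: N_def)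
      then have pN: "p \<notin> N" using pfh by blast
      have "N \<subseteq> k"
      proof (rule ccontr)
        assume not: "\<not> ?thesis"
        then have kN: "k \<subset> N"
          using walls_nested[OF kw(1) Nw] kw pN q unfolding nested_def N_def by blast
        define k' where "k' = tr (winv (wpow f n)) k"
        have k': "tr (wpow f n) k' = k" "k' \<in> walls v"
          using kw walls_sat tr_inv tr_walls by (auto simp: k'_def)
        have "a \<notin> k'" using kN ap k' tr_mem[OF walls_sat[OF k'(2)], of "wpow f n" a] tr_mem[OF hsat, of "wpow f n" a]
          by (auto simp: N_def)
        moreover have "p \<in> k'" using kw k' tr_mem[OF walls_sat[OF k'(2)], of "wpow f n" p] by (simp add: q_def)
        ultimately have "k' = h" using only k' by (simp add: h_def)
        then show False using kN k' by (simp add: N_def)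
      qed
      show ?thesis
      proof (cases "k = N")
        case True
        have "ax (n * r) = N" using r hd hs_nonempty by (simp add: ax_def N_def flip: hd_conv_nth)
        then show ?thesis using True by metis
      next
        case False
        then obtain i where i: "k \<subseteq> tr (wpow f i) h" "tr (wpow f (Suc i)) h \<subset> k"
          using between_tr_powers[OF kw(1) hw fh kh _ ap(1), of n] \<open>N \<subseteq> k\<close> N_def by blast
        define k' where "k' = tr (winv (wpow f i)) k"
        have k': "tr (wpow f i) k' = k" "k' \<in> walls v"
          using kw walls_sat tr_inv tr_walls by (auto simp: k'_def)
        have "wpow f (Suc i) = wpow f i @ f" using replicate_add[of i 1 f] by simp
        then have "tr (wpow f i) (tr f h) \<subset> tr (wpow f i) k'" using i k' by (simp add: tr_append)
        then have "tr f h \<subset> k'" using tr_psubset[OF sat_tr[OF hsat] walls_sat[OF k'(2)]] by blast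
        moreover have "k' \<subseteq> h" using i k' tr_subset[OF walls_sat[OF k'(2)] hsat] by blast
        ultimately have "k' \<in> S" using k' by (simp add: S_def)
        then obtain l where l: "l < r" "hs ! l = k'" using hs by (metis in_set_conv_nth r_def)
        have "ax (i * r + l) = k" using l k' by (simp add: ax_def)
        then show ?thesis by metis
      qed
    qed
    \<comment> \<open>The complements of the halfspaces of a reversed copy would lie on the axis, in
      reversed order, at positions called \<sigma> below.\<close>
    have "cnt (sep v q p) = 0"
    proof (rule ccontr)
      assume "cnt (sep v q p) \<noteq> 0"
      then obtain gs where "copies (sep v q p) gs" "gs \<noteq> []" using cnt_ex[OF finite_sep] by fastforce
      then obtain g where g: "\<And>k. k \<in> set hs \<Longrightarrow> tr g k \<in> sep v q p"
        unfolding copies_def by (meson hd_in_set)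
      have "\<exists>j. - tr g (hs ! l) = ax j" if "l < r" for l
      proof -
        have "tr g (hs ! l) \<in> sep v q p" using g that by (simp add: r_def)
        then have "- tr g (hs ! l) \<in> sep v p q" using compl_walls by (auto simp: sep_def)
        then show ?thesis by (rule axis)
      qed
      then obtain \<sigma> where \<sigma>: "\<And>l. l < r \<Longrightarrow> - tr g (hs ! l) = ax (\<sigma> l)" by metis
      \<comment> \<open>No position is skipped: a halfspace of the axis in between would come from
        one strictly between two neighbours of the chain, which already contains everything of its
        label between \<open>tr f h\<close> and \<open>h\<close>.\<close>
      have step: "\<sigma> l = Suc (\<sigma> (Suc l))" if l: "Suc l < r" for l
      proof -
        have L: "hs ! l \<in> S" "hs ! Suc l \<in> S" "hs ! Suc l \<subset> hs ! l" using nthS hs_mono l by auto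
        have "tr g (hs ! Suc l) \<subset> tr g (hs ! l)" by (intro tr_psubset_mono satS L)
        then have "ax (\<sigma> l) \<subset> ax (\<sigma> (Suc l))" using \<sigma>[of l] \<sigma>[of "Suc l"] l by auto
        then have lt: "\<sigma> (Suc l) < \<sigma> l" by (rule ax_less)
        show ?thesis
        proof (rule ccontr)
          assume "\<not> ?thesis"
          then have lt2: "\<sigma> (Suc l) < \<sigma> l - 1" "\<sigma> l - 1 < \<sigma> l" using lt by auto
          define k where "k = tr (winv g) (- ax (\<sigma> l - 1))"
          have kw: "k \<in> walls v" by (simp add: k_def tr_walls compl_walls ax_walls)
          have gk: "tr g k = - ax (\<sigma> l - 1)"
            unfolding k_def using ax_walls compl_walls walls_sat tr_inv by blast
          have "tr g (hs ! Suc l) \<subset> tr g k" "tr g k \<subset> tr g (hs ! l)"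
            using ax_mono[OF lt2(1)] ax_mono[OF lt2(2)] \<sigma>[of l] \<sigma>[of "Suc l"] l gk by auto
          then have kk: "hs ! Suc l \<subset> k" "k \<subset> hs ! l"
            using tr_psubset[OF satS[OF L(2)] walls_sat[OF kw]] tr_psubset[OF walls_sat[OF kw] satS[OF L(1)]]
            by simp_all
          then have "k \<in> S" using L kw by (auto simp: S_def)
          then obtain m where m: "m < r" "hs ! m = k" using hs by (metis in_set_conv_nth r_def)
          consider "m < l" | "m = l" | "m = Suc l" | "Suc l < m" by linarith
          then show False
            by cases (use kk m hs_mono[of m l] hs_mono[of "Suc l" m] l in auto)
        qed
      qed
      have \<sigma>0: "\<sigma> l + l = \<sigma> 0" if "l < r" for l
        using that
      proof (induction l)
        case (Suc l)
        then show ?case using step[of l] by simp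
      qed simp
      define t where "t = \<sigma> 0 mod r"
      define Q where "Q = \<sigma> 0 div r"
      \<comment> \<open>\<open>F\<close> sends \<open>hs ! l\<close> to the complement of
        \<open>hs ! m\<close> when \<open>l + m = t\<close>. For even \<open>t\<close> the middle
        halfspace goes to its own complement; for odd \<open>t\<close> each of the two middle ones
        goes to the complement of the other. The square of \<open>F\<close> fixes them, so
        \<open>sqrt_stab\<close> applies.\<close>
      define F where "F = winv (wpow f Q) @ g"
      have tr_: "t < r" "\<sigma> 0 = Q * r + t" using r by (simp_all add: t_def Q_def)
      have F: "tr F (hs ! l) = - (hs ! m)" if "l < r" "m < r" "\<sigma> l = Q * r + m" for l m
      proof -
        have "ax (\<sigma> l) = tr (wpow f Q) (hs ! m)" using that r by (simp add: ax_def)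
        then have "tr g (hs ! l) = - tr (wpow f Q) (hs ! m)" using \<sigma>[OF that(1)] by auto
        then have "tr F (hs ! l) = - tr (winv (wpow f Q)) (tr (wpow f Q) (hs ! m))"
          by (simp add: F_def tr_append flip: tr_compl)
        then show ?thesis using tr_inv satS nthS that by simp
      qed
      have stab: "tr F (hs ! l) = hs ! l" if "l < r" "tr F (tr F (hs ! l)) = hs ! l" for l
        using that nthS[of l] walls_halfspaces[of "hs ! l" v] by (intro sqrt_stab) (simp_all add: S_def)
      show False
      proof (cases "even t")
        case True
        define l where "l = t div 2"
        have l: "l < r" "\<sigma> l = Q * r + l" using \<sigma>0[of l] tr_ True by (auto simp: l_def)
        have 1: "tr F (hs ! l) = - (hs ! l)" using F l by blast
        then have "tr F (tr F (hs ! l)) = hs ! l" by (simp add: tr_compl)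
        then show False using stab l 1 by blast
      next
        case False
        define l where "l = t div 2"
        have tl: "t = Suc (2 * l)" using False by (simp add: l_def)
        have l: "Suc l < r" "\<sigma> l = Q * r + Suc l" "\<sigma> (Suc l) = Q * r + l"
          using \<sigma>0[of l] \<sigma>0[of "Suc l"] tr_ tl by auto
        have 1: "tr F (hs ! l) = - (hs ! Suc l)" "tr F (hs ! Suc l) = - (hs ! l)"
          using F[of l "Suc l"] F[of "Suc l" l] l by auto
        then have "tr F (tr F (hs ! l)) = hs ! l" by (simp add: tr_compl)
        then have "hs ! l = - (hs ! Suc l)" using stab[of l] l 1 by simp
        moreover have "hs ! Suc l \<subset> hs ! l" using hs_mono l by simp
        ultimately have "hs ! l = UNIV" by blast
        moreover have "hs ! l \<in> halfspaces" using nthS[of l] l walls_halfspaces[of "hs ! l" v] by (simp add: S_def)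
        ultimately show False using halfspace_nonempty(2) by blast
      qed
    qed
    then show ?thesis using up n by (simp add: \<phi>_def om_def q_def)
  qed
  show ?thesis
    using lower om_append om_winv om_eqw[OF eqw_refl eqw_append[OF _ eqw_refl]]
    by (intro exI[of _ \<phi>]) (auto simp: \<phi>_def)
qed

end

section \<open>Stable commutator length and quasimorphisms\<close>

text \<open>Division with remainder compares \<open>f n\<close> with multiples of a nearly optimal
  \<open>f m\<close>; the remainders are bounded by the constant \<open>C\<close>, which disappears
  after division by \<open>n\<close>. The term \<open>f 0\<close> enters because it is not assumed
  to vanish.\<close>

lemma fekete:
  fixes f :: "nat \<Rightarrow> real"
  assumes sub: "\<And>m n. f (m + n) \<le> f m + f n" and pos: "\<And>n. 0 \<le> f n"
  shows "convergent (\<lambda>n. f n / real n)"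
proof -
  define A where "A = (\<lambda>n. f n / real n) ` {1..}"
  define L where "L = Inf A"
  have bdd: "bdd_below A" unfolding A_def by (rule bdd_belowI2[of _ 0]) (simp add: pos)
  have low: "L \<le> f n / real n" if "n \<ge> 1" for n
    unfolding L_def by (rule cInf_lower[OF _ bdd]) (use that in \<open>auto simp: A_def\<close>)
  have mult: "f (q * m) \<le> real q * f m + f 0" for q m
  proof (induction q)
    case (Suc q)
    have "f (Suc q * m) \<le> f m + f (q * m)" using sub[of m "q * m"] by simp
    then show ?case using Suc by (simp add: algebra_simps)
  qed simp
  have "(\<lambda>n. f n / real n) \<longlonglongrightarrow> L"
  proof (rule LIMSEQ_I)
    fix e :: real assume e: "0 < e"
    have "\<exists>x\<in>A. x < L + e / 2"
      using cInf_less_iff[of A "L + e / 2"] bdd e unfolding L_def by (auto simp: A_def)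
    then obtain m where m: "m \<ge> 1" "f m / real m < L + e / 2" by (auto simp: A_def)
    define C where "C = f 0 + (\<Sum>r<m. f r)"
    have C: "C \<ge> 0" unfolding C_def using pos by (simp add: sum_nonneg)
    obtain N where N: "real N > 2 * C / e" using reals_Archimedean2 by blast
    have "norm (f n / real n - L) < e" if n: "n \<ge> max 1 N" for n
    proof -
      have n1: "n \<ge> 1" "real n > 2 * C / e" using n N by auto
      define q r where "q = n div m" and "r = n mod m"
      have nq: "n = q * m + r" "r < m" using m by (auto simp: q_def r_def)
      have "f r \<le> (\<Sum>r<m. f r)" using nq by (intro member_le_sum) (auto simp: pos)
      then have "f n \<le> real q * f m + C" using sub[of "q * m" r] mult[of q m] nq by (simp add: C_def)
      also have "real q * f m = real q * real m * (f m / real m)" using m by simp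
      also have "\<dots> \<le> real n * (f m / real m)"
      proof (rule mult_right_mono)
        show "real q * real m \<le> real n" using nq by simp
      qed (simp add: pos)
      finally have "f n \<le> real n * (f m / real m) + C" by simp
      then have "f n / real n \<le> (real n * (f m / real m) + C) / real n" by (intro divide_right_mono) auto
      also have "\<dots> = f m / real m + C / real n" using n1 by (simp add: add_divide_distrib)
      also have "C / real n < e / 2" using n1 e C
        by (simp add: divide_simps mult.commute) 
      finally have "f n / real n < L + e" using m by linarith
      then show ?thesis using low[OF n1(1)] by simp
    qed
    then show "\<exists>no. \<forall>n\<ge>no. norm (f n / real n - L) < e" by blast
  qed
  then show ?thesis by (rule convergentI)
qed

context group
begin

lemma foldr_mult_closed: "set cs \<subseteq> carrier G \<Longrightarrow> foldr (\<lambda>x y. x \<otimes> y) cs \<one> \<in> carrier G"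
  by (induction cs) auto

lemma foldr_mult_append: "set cs \<subseteq> carrier G \<Longrightarrow> set ds \<subseteq> carrier G \<Longrightarrow>
  foldr (\<lambda>x y. x \<otimes> y) (cs @ ds) \<one> = foldr (\<lambda>x y. x \<otimes> y) cs \<one> \<otimes> foldr (\<lambda>x y. x \<otimes> y) ds \<one>"
  by (induction cs) (auto simp: m_assoc foldr_mult_closed simp del: foldr_append)

lemma derived_set_carrier: "derived_set G (carrier G) \<subseteq> carrier G"
  by auto

lemma derived_set_inv: assumes "c \<in> derived_set G (carrier G)" shows "inv c \<in> derived_set G (carrier G)"
proof -
  obtain a b where ab: "a \<in> carrier G" "b \<in> carrier G" "c = a \<otimes> b \<otimes> inv a \<otimes> inv b" using assms by auto
  then have "inv c = b \<otimes> a \<otimes> inv b \<otimes> inv a" by (simp add: inv_mult_group m_assoc)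
  then show ?thesis using ab by blast
qed

lemma derived_foldr:
  assumes "x \<in> derived G (carrier G)"
  shows "\<exists>cs. set cs \<subseteq> derived_set G (carrier G) \<and> foldr (\<lambda>x y. x \<otimes> y) cs \<one> = x"
  using assms unfolding derived_def
proof (induction x rule: generate.induct)
  case one
  then show ?case by (intro exI[of _ "[]"]) auto
next
  case (incl h)
  then have "h \<in> carrier G" using derived_set_carrier by (rule subsetD[rotated])
  then show ?case using incl by (intro exI[of _ "[h]"]) (simp del: UN_iff)
next
  case (inv h)
  have "inv h \<in> derived_set G (carrier G)" by (rule derived_set_inv[OF inv])
  moreover from this have "inv h \<in> carrier G" using derived_set_carrier by (rule subsetD[rotated])
  ultimately show ?case by (intro exI[of _ "[inv h]"]) (simp del: UN_iff)
next
  case (eng h1 h2)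
  then obtain cs ds where "set cs \<subseteq> derived_set G (carrier G)" "foldr (\<lambda>x y. x \<otimes> y) cs \<one> = h1"
    "set ds \<subseteq> derived_set G (carrier G)" "foldr (\<lambda>x y. x \<otimes> y) ds \<one> = h2" by blast
  moreover from calculation have "set cs \<subseteq> carrier G" "set ds \<subseteq> carrier G"
    using derived_set_carrier by (meson order_trans)+
  ultimately show ?case using foldr_mult_append[of cs ds]
    by (intro exI[of _ "cs @ ds"]) (simp del: foldr_append UN_iff)
qed

text \<open>Membership in the derived subgroup provides a witness; without one the
  \<open>LEAST\<close> in \<open>cl\<close> would be unspecified.\<close>

lemma cl_attained:
  assumes "x \<in> derived G (carrier G)"
  shows "\<exists>cs. length cs = cl G x \<and> set cs \<subseteq> derived_set G (carrier G) \<and> foldr (\<lambda>x y. x \<otimes> y) cs \<one> = x"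
  unfolding cl_def by (rule LeastI_ex) (use derived_foldr[OF assms] in blast)

lemma cl_mult_le:
  assumes "x \<in> derived G (carrier G)" "y \<in> derived G (carrier G)"
  shows "cl G (x \<otimes> y) \<le> cl G x + cl G y"
proof -
  obtain cs ds where cs: "length cs = cl G x" "set cs \<subseteq> derived_set G (carrier G)" "foldr (\<lambda>x y. x \<otimes> y) cs \<one> = x"
    and ds: "length ds = cl G y" "set ds \<subseteq> derived_set G (carrier G)" "foldr (\<lambda>x y. x \<otimes> y) ds \<one> = y"
    using cl_attained assms by meson
  have "set cs \<subseteq> carrier G" "set ds \<subseteq> carrier G"
    using cs ds derived_set_carrier by (meson order_trans)+
  then have "foldr (\<lambda>x y. x \<otimes> y) (cs @ ds) \<one> = x \<otimes> y"
    using foldr_mult_append[of cs ds] cs ds by simp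
  then show ?thesis
    unfolding cl_def[of G "x \<otimes> y"] using cs ds
    by (intro Least_le exI[of _ "cs @ ds"]) (simp del: foldr_append UN_iff)
qed

lemma derived_pow: "x \<in> derived G (carrier G) \<Longrightarrow> x [^] (n::nat) \<in> derived G (carrier G)"
proof (induction n)
  case 0
  then show ?case by (simp add: derived_def generate.one)
next
  case (Suc n)
  then show ?case unfolding derived_def by (simp add: generate.eng)
qed

text \<open>Subadditivity of \<open>cl\<close> makes the sequence converge, so \<open>lim\<close> in
  the definition of \<open>scl_derived\<close> denotes an actual limit.\<close>

lemma scl_derived_limit:
  assumes "x \<in> derived G (carrier G)"
  shows "(\<lambda>n. real (cl G (x [^] n)) / real n) \<longlonglongrightarrow> scl_derived G x"
proof -
  have x: "x \<in> carrier G" using assms derived_in_carrier[of "carrier G"] by blast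
  have "convergent (\<lambda>n. real (cl G (x [^] n)) / real n)"
  proof (rule fekete)
    fix m n :: nat
    have "cl G (x [^] (m + n)) \<le> cl G (x [^] m) + cl G (x [^] n)"
      using cl_mult_le[OF derived_pow[OF assms, of m] derived_pow[OF assms, of n]] nat_pow_mult[OF x, of m n]
      by simp
    then show "real (cl G (x [^] (m + n))) \<le> real (cl G (x [^] m)) + real (cl G (x [^] n))" by simp
  qed simp
  then show ?thesis unfolding scl_derived_def convergent_LIMSEQ_iff .
qed

text \<open>With \<open>4k\<close> factors whose values cancel, a product of \<open>k\<close> commutators has value at most
  \<open>4kD\<close>; no homogenization is needed.\<close>

lemma scl_ge_quasimorphism:
  fixes \<psi> :: "'a \<Rightarrow> real"
  assumes quasi: "\<And>a b. a \<in> carrier G \<Longrightarrow> b \<in> carrier G \<Longrightarrow> \<bar>\<psi> (a \<otimes> b) - \<psi> a - \<psi> b\<bar> \<le> D"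
    and anti: "\<And>a. a \<in> carrier G \<Longrightarrow> \<psi> (inv a) = - \<psi> a"
    and g: "g \<in> carrier G" and low: "\<And>n::nat. real n - C \<le> \<psi> (g [^] n)" and D: "0 < D"
  shows "ereal (1 / (4 * D)) \<le> scl G g"
proof -
  have one: "\<psi> \<one> = 0" using anti[of \<one>] by simp
  \<comment> \<open>Three products, each with an error of at most \<open>D\<close>, while the values
    of the four factors cancel in pairs.\<close>
  have comm: "\<bar>\<psi> c\<bar> \<le> 3 * D" if c: "c \<in> derived_set G (carrier G)" for c
  proof -
    obtain a b where ab: "a \<in> carrier G" "b \<in> carrier G" "c = a \<otimes> b \<otimes> inv a \<otimes> inv b" using c by auto
    then show ?thesis
      using quasi[of a b] quasi[of "a \<otimes> b" "inv a"] quasi[of "a \<otimes> b \<otimes> inv a" "inv b"] anti[of a] anti[of b]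
      by (simp add: abs_le_iff)
  qed
  have prod: "\<bar>\<psi> (foldr (\<lambda>x y. x \<otimes> y) cs \<one>)\<bar> \<le> 4 * D * real (length cs)"
    if "set cs \<subseteq> derived_set G (carrier G)" for cs
    using that
  proof (induction cs)
    case (Cons c cs)
    have "c \<in> carrier G" "foldr (\<lambda>x y. x \<otimes> y) cs \<one> \<in> carrier G"
      using Cons.prems derived_set_carrier foldr_mult_closed by auto
    then show ?case using quasi[of c "foldr (\<lambda>x y. x \<otimes> y) cs \<one>"] comm[of c] Cons
      by (simp add: abs_le_iff algebra_simps)
  qed (simp add: one)
  have cl: "\<psi> x \<le> 4 * D * real (cl G x)" if "x \<in> derived G (carrier G)" for x
  proof -
    obtain cs where "length cs = cl G x" "set cs \<subseteq> derived_set G (carrier G)" "foldr (\<lambda>x y. x \<otimes> y) cs \<one> = x"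
      using cl_attained[OF \<open>x \<in> _\<close>] by blast
    then show ?thesis using prod[of cs] by simp
  qed
  show ?thesis
  proof (cases "\<exists>n\<ge>1. g [^] (n::nat) \<in> derived G (carrier G)")
    case True
    define n where "n = (LEAST n::nat. n \<ge> 1 \<and> g [^] n \<in> derived G (carrier G))"
    have "n \<ge> 1 \<and> g [^] n \<in> derived G (carrier G)"
      unfolding n_def by (rule LeastI_ex) (use True in blast)
    then have n: "n \<ge> 1" "g [^] n \<in> derived G (carrier G)" by auto
    define h where "h = g [^] n"
    have "real n / (4 * D) \<le> scl_derived G h"
    proof (rule tendsto_le[OF _ scl_derived_limit])
      show "h \<in> derived G (carrier G)" using n by (simp add: h_def)
      show "(\<lambda>m. real n / (4 * D) - C / (4 * D) / real m) \<longlonglongrightarrow> real n / (4 * D)"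
        using tendsto_diff[OF tendsto_const lim_const_over_n[of "C / (4 * D)"], of "real n / (4 * D)"] by simp
      show "\<forall>\<^sub>F m in sequentially. real n / (4 * D) - C / (4 * D) / real m \<le> real (cl G (h [^] m)) / real m"
      proof (rule eventually_sequentiallyI)
        fix m :: nat assume m: "1 \<le> m"
        have "h [^] m = g [^] (n * m)" using g by (simp add: h_def nat_pow_pow)
        then have "real (n * m) - C \<le> \<psi> (h [^] m)" using low[of "n * m"] by simp
        also have "\<dots> \<le> 4 * D * real (cl G (h [^] m))" using cl derived_pow n h_def by blast
        finally have "(real (n * m) - C) / (4 * D) \<le> real (cl G (h [^] m))"
          using D by (simp add: divide_le_eq mult.commute)
        then have "(real (n * m) - C) / (4 * D) / real m \<le> real (cl G (h [^] m)) / real m"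
          by (rule divide_right_mono) simp
        moreover have "(real (n * m) - C) / (4 * D) / real m = real n / (4 * D) - C / (4 * D) / real m"
          using m D by (simp add: field_simps)
        ultimately show "real n / (4 * D) - C / (4 * D) / real m \<le> real (cl G (h [^] m)) / real m" by simp
      qed
    qed simp
    then have "real n / (4 * D) / real n \<le> scl_derived G h / real n" by (rule divide_right_mono) simp
    then have "1 / (4 * D) \<le> scl_derived G h / real n" using n by simp
    then show ?thesis using True unfolding scl_def Let_def n_def[symmetric] h_def by simp
  next
    case False
    then have "scl G g = \<infinity>" unfolding scl_def by (rule if_not_P)
    then show ?thesis by simp
  qed
qed

end

section \<open>Faces of cubes\<close>

text \<open>\<open>aff n J \<kappa> A b\<close> is the inclusion of a face of the \<open>n\<close>-cube: the coordinates in \<open>J\<close> are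
  read off (via \<open>\<kappa>\<close>, reversed on \<open>A\<close>), the others are frozen at \<open>b\<close>.\<close>

definition aff :: "nat \<Rightarrow> nat set \<Rightarrow> (nat \<Rightarrow> nat) \<Rightarrow> nat set \<Rightarrow> (nat \<Rightarrow> real) \<Rightarrow> (nat \<Rightarrow> real) \<Rightarrow> nat \<Rightarrow> real" where
  "aff n J \<kappa> A b x = (\<lambda>i. if i < n then if i \<in> J then if i \<in> A then 1 - x (\<kappa> i) else x (\<kappa> i) else b i else 0)"

lemma cubeI: "(\<And>i. i < n \<Longrightarrow> 0 \<le> x i \<and> x i \<le> 1) \<Longrightarrow> (\<And>i. i \<ge> n \<Longrightarrow> x i = 0) \<Longrightarrow> x \<in> cube n"
  by (simp add: cube_def)

lemma cubeD: "x \<in> cube n \<Longrightarrow> 0 \<le> x i" "x \<in> cube n \<Longrightarrow> x i \<le> 1" "x \<in> cube n \<Longrightarrow> i \<ge> n \<Longrightarrow> x i = 0"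
  by (auto simp: cube_def) (metis linorder_not_less order.refl zero_le_one)+

lemma open_cube_subset: "open_cube n \<subseteq> cube n"
  by (auto simp: open_cube_def cube_def less_imp_le)

lemma zero_cube [simp]: "(\<lambda>_. 0) \<in> cube n"
  by (simp add: cube_def)

lemma aff_cube:
  assumes "x \<in> cube k" "\<And>i. i < n \<Longrightarrow> i \<notin> J \<Longrightarrow> b i \<in> {0..1}"
  shows "aff n J \<kappa> A b x \<in> cube n"
  using assms cubeD[OF assms(1)] by (auto intro!: cubeI simp: aff_def)

lemma aff_cong:
  assumes "\<And>i. i < n \<Longrightarrow> i \<in> J \<Longrightarrow> x (\<kappa> i) = y (\<kappa>' i)" "\<And>i. i < n \<Longrightarrow> i \<notin> J \<Longrightarrow> b i = b' i"
    "\<And>i. i < n \<Longrightarrow> i \<in> J \<Longrightarrow> i \<in> A \<longleftrightarrow> i \<in> A'"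
  shows "aff n J \<kappa> A b x = aff n J \<kappa>' A' b' y"
  using assms by (auto simp: aff_def)

lemma aff_convex: "aff n J \<kappa> A b (\<lambda>i. (1 - s) * x i + s * y i) =
   (\<lambda>i. (1 - s) * aff n J \<kappa> A b x i + s * aff n J \<kappa> A b y i)"
  by (auto simp: aff_def fun_eq_iff algebra_simps)

locale cubes =
  fixes S :: "'a::topological_space set" and K :: "nat \<Rightarrow> ((nat \<Rightarrow> real) \<Rightarrow> 'a) set"
  assumes complex: "cube_complex S K"
begin

lemma K_ext: "\<phi> \<in> K n \<Longrightarrow> \<phi> \<in> extensional (cube n)"
  and K_cont: "\<phi> \<in> K n \<Longrightarrow> continuous_on (cube n) \<phi>"
  and K_inj: "\<phi> \<in> K n \<Longrightarrow> inj_on \<phi> (open_cube n)"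
  using complex[unfolded cube_complex_def, THEN conjunct1, rule_format] by simp_all

lemma K_face: "\<phi> \<in> K n \<Longrightarrow> i < n \<Longrightarrow> b \<in> {0, 1} \<Longrightarrow> face n i b \<phi> \<in> K (n - 1)"
  by (rule complex[unfolded cube_complex_def, THEN conjunct2, THEN conjunct1, rule_format])

lemma K_reparam: "\<phi> \<in> K n \<Longrightarrow> \<pi> permutes {..<n} \<Longrightarrow> A \<subseteq> {..<n} \<Longrightarrow> reparam n \<pi> A \<phi> \<in> K n"
  by (rule complex[unfolded cube_complex_def, THEN conjunct2, THEN conjunct2, THEN conjunct1, rule_format])

lemma S_cells: "S = (\<Union>n. \<Union>\<phi>\<in>K n. \<phi> ` open_cube n)"
  by (rule complex[unfolded cube_complex_def, THEN conjunct2, THEN conjunct2, THEN conjunct2, THEN conjunct1])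

lemma K_match: "\<phi> \<in> K m \<Longrightarrow> \<psi> \<in> K n \<Longrightarrow> \<phi> ` open_cube m \<inter> \<psi> ` open_cube n \<noteq> {} \<Longrightarrow>
    m = n \<and> (\<exists>\<pi> A. \<pi> permutes {..<n} \<and> A \<subseteq> {..<n} \<and> \<psi> = reparam n \<pi> A \<phi>)"
  by (rule complex[unfolded cube_complex_def, THEN conjunct2, THEN conjunct2, THEN conjunct2, THEN conjunct2, THEN conjunct1, rule_format])

lemma weak_closed: "C \<subseteq> S \<Longrightarrow> (\<And>n \<phi>. \<phi> \<in> K n \<Longrightarrow> closedin (top_of_set (cube n)) {x \<in> cube n. \<phi> x \<in> C}) \<Longrightarrow>
    closedin (top_of_set S) C"
  by (rule complex[unfolded cube_complex_def, THEN conjunct2, THEN conjunct2, THEN conjunct2, THEN conjunct2, THEN conjunct2, rule_format])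

text \<open>Closure of \<open>K\<close> under codimension one faces and under symmetries gives all
  face inclusions: frozen coordinates are removed one at a time until a symmetry remains.\<close>

lemma aff_K:
  assumes "\<phi> \<in> K n" "J \<subseteq> {..<n}" "bij_betw \<kappa> J {..<k}" "\<And>i. i < n \<Longrightarrow> i \<notin> J \<Longrightarrow> b i \<in> {0, 1}"
  shows "restrict (\<phi> \<circ> aff n J \<kappa> A b) (cube k) \<in> K k"
  using assms
proof (induction n arbitrary: \<phi> J \<kappa> A b rule: less_induct)
  case (less n)
  note b = less.prems(4)
  show ?case
  proof (cases "J = {..<n}")
    case True
    then have "k = n" using bij_betw_same_card[OF less.prems(3)] by simp
    define \<pi> where "\<pi> i = (if i < n then \<kappa> i else i)" for i
    have "bij_betw \<pi> {..<n} {..<n}"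
      using less.prems(3) True \<open>k = n\<close> by (subst bij_betw_cong[of _ _ \<kappa>]) (auto simp: \<pi>_def)
    then have "\<pi> permutes {..<n}" by (rule bij_imp_permutes) (simp add: \<pi>_def)
    then have "reparam n \<pi> (A \<inter> {..<n}) \<phi> \<in> K n" using less.prems by (intro K_reparam) auto
    moreover have "cube_sym n \<pi> (A \<inter> {..<n}) = aff n J \<kappa> A b"
      using True by (auto simp: cube_sym_def aff_def \<pi>_def fun_eq_iff)
    ultimately show ?thesis by (simp only: reparam_def \<open>k = n\<close>)
  next
    case False
    then obtain i0 where i0: "i0 < n" "i0 \<notin> J" using less.prems(2) by auto
    \<comment> \<open>Renumbers the coordinates of the smaller cube so as to skip
      \<open>i0\<close>.\<close>
    define sk where "sk j = (if j < i0 then j else Suc j)" for j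
    define J' where "J' = {j. j < n - 1 \<and> sk j \<in> J}"
    define \<phi>' where "\<phi>' = face n i0 (b i0) \<phi>"
    define A' where "A' = {j. sk j \<in> A}"
    have f1: "\<phi>' \<in> K (n - 1)" unfolding \<phi>'_def using less.prems i0 by (intro K_face) auto
    have f2: "J' \<subseteq> {..<n - 1}" by (auto simp: J'_def)
    have f3: "bij_betw (\<kappa> \<circ> sk) J' {..<k}"
    proof (rule bij_betw_trans[OF _ less.prems(3)])
      have "J \<subseteq> sk ` J'"
      proof
        fix j assume j: "j \<in> J"
        then have "j < n" "j \<noteq> i0" using less.prems(2) i0 by auto
        then have "sk (if j < i0 then j else j - 1) = j" "(if j < i0 then j else j - 1) < n - 1"
          using i0 by (auto simp: sk_def)
        then show "j \<in> sk ` J'" using j by (intro image_eqI[of _ _ "if j < i0 then j else j - 1"]) (simp_all only: J'_def mem_Collect_eq)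
      qed
      then show "bij_betw sk J' J"
        unfolding bij_betw_def by (auto simp: inj_on_def sk_def J'_def split: if_splits)
    qed
    have f4: "\<And>i. i < n - 1 \<Longrightarrow> i \<notin> J' \<Longrightarrow> (b \<circ> sk) i \<in> {0, 1}"
      using b i0 by (auto simp: J'_def sk_def split: if_splits)
    have "n - 1 < n" using i0 by simp
    from less.IH[OF this f1 f2 f3 f4]
    have "restrict (\<phi>' \<circ> aff (n - 1) J' (\<kappa> \<circ> sk) A' (b \<circ> sk)) (cube k) \<in> K k" .
    moreover have "(\<phi>' \<circ> aff (n - 1) J' (\<kappa> \<circ> sk) A' (b \<circ> sk)) x = (\<phi> \<circ> aff n J \<kappa> A b) x" if x: "x \<in> cube k" for x
    proof -
      have "aff (n - 1) J' (\<kappa> \<circ> sk) A' (b \<circ> sk) x \<in> cube (n - 1)"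
        using f4 by (intro aff_cube[OF x]) fastforce
      moreover have "face_map i0 (b i0) (aff (n - 1) J' (\<kappa> \<circ> sk) A' (b \<circ> sk) x) = aff n J \<kappa> A b x"
      proof
        fix j
        consider "j < i0" | "j = i0" | "j > i0" by linarith
        then show "face_map i0 (b i0) (aff (n - 1) J' (\<kappa> \<circ> sk) A' (b \<circ> sk) x) j = aff n J \<kappa> A b x j"
          using i0 by cases (auto simp: face_map_def aff_def J'_def A'_def sk_def)
      qed
      ultimately show ?thesis by (simp add: \<phi>'_def face_def)
    qed
    ultimately show ?thesis by (metis (no_types, lifting) restrict_ext)
  qed
qed

lemma face_of_point:
  assumes "a \<in> cube n"
  obtains J \<kappa> k y where "J = {i. i < n \<and> 0 < a i \<and> a i < 1}" "bij_betw \<kappa> J {..<k}"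
    "y \<in> open_cube k" "aff n J \<kappa> {} a y = a" "\<forall>i<n. i \<notin> J \<longrightarrow> a i \<in> {0, 1}"
proof -
  define J where "J = {i. i < n \<and> 0 < a i \<and> a i < 1}"
  have "finite J" by (simp add: J_def)
  then obtain \<kappa> where "bij_betw \<kappa> J {0..<card J}" using ex_bij_betw_finite_nat by blast
  then have \<kappa>: "bij_betw \<kappa> J {..<card J}" by (simp add: atLeast0LessThan)
  define y where "y j = (if j < card J then a (inv_into J \<kappa> j) else 0)" for j
  have inv: "inv_into J \<kappa> (\<kappa> i) = i" if "i \<in> J" for i
    using \<kappa> that by (simp add: bij_betw_inv_into_left)
  have "inv_into J \<kappa> j \<in> J" if "j < card J" for j
    using that \<kappa> by (metis bij_betw_def inv_into_into lessThan_iff)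
  then have "y \<in> open_cube (card J)" by (auto simp: open_cube_def y_def J_def)
  moreover have "\<kappa> i < card J" if "i \<in> J" for i using \<kappa> that bij_betwE by blast
  then have "aff n J \<kappa> {} a y = a" using inv cubeD(3)[OF assms] by (auto simp: aff_def y_def fun_eq_iff)
  moreover have "a i \<in> {0, 1}" if "i < n" "i \<notin> J" for i
    using that cubeD(1,2)[OF assms, of i] by (auto simp: J_def)
  ultimately show ?thesis using that[OF J_def \<kappa>] by blast
qed

lemma K_in_S: assumes "\<phi> \<in> K n" "a \<in> cube n" shows "\<phi> a \<in> S"
proof -
  obtain J \<kappa> k y where y: "J = {i. i < n \<and> 0 < a i \<and> a i < 1}" "bij_betw \<kappa> J {..<k}"
    "y \<in> open_cube k" "aff n J \<kappa> {} a y = a" "\<forall>i<n. i \<notin> J \<longrightarrow> a i \<in> {0, 1}"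
    by (rule face_of_point[OF assms(2)])
  have "restrict (\<phi> \<circ> aff n J \<kappa> {} a) (cube k) \<in> K k"
    using y by (intro aff_K[OF assms(1)]) auto
  moreover have "restrict (\<phi> \<circ> aff n J \<kappa> {} a) (cube k) y = \<phi> a"
    using y open_cube_subset by (auto simp: restrict_def)
  ultimately show ?thesis unfolding S_cells using y(3) by (metis (no_types, lifting) UN_iff image_eqI UNIV_I)
qed

lemma S_rep: assumes "y \<in> S" obtains n \<phi> x where "\<phi> \<in> K n" "x \<in> open_cube n" "\<phi> x = y"
  using assms unfolding S_cells by blast

text \<open>If two cubes meet in a point, they share the face whose interior contains it.\<close>

lemma common_face:
  assumes \<phi>: "\<phi> \<in> K n" and \<psi>: "\<psi> \<in> K m" and a: "a \<in> cube n" and z: "z \<in> cube m" and eq: "\<phi> a = \<psi> z"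
  obtains J \<kappa> J' \<kappa>' A k y where
    "J = {i. i < n \<and> 0 < a i \<and> a i < 1}" "bij_betw \<kappa> J {..<k}" "\<forall>i<n. i \<notin> J \<longrightarrow> a i \<in> {0, 1}"
    "J' = {i. i < m \<and> 0 < z i \<and> z i < 1}" "bij_betw \<kappa>' J' {..<k}" "\<forall>i<m. i \<notin> J' \<longrightarrow> z i \<in> {0, 1}"
    "y \<in> open_cube k" "aff n J \<kappa> {} a y = a" "aff m J' \<kappa>' A z y = z"
    "\<forall>x\<in>cube k. \<phi> (aff n J \<kappa> {} a x) = \<psi> (aff m J' \<kappa>' A z x)"
proof -
  obtain J \<kappa> k y where y: "J = {i. i < n \<and> 0 < a i \<and> a i < 1}" "bij_betw \<kappa> J {..<k}"
    "y \<in> open_cube k" "aff n J \<kappa> {} a y = a" "\<forall>i<n. i \<notin> J \<longrightarrow> a i \<in> {0, 1}"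
    by (rule face_of_point[OF a])
  obtain J' \<kappa>' k' y' where y': "J' = {i. i < m \<and> 0 < z i \<and> z i < 1}" "bij_betw \<kappa>' J' {..<k'}"
    "y' \<in> open_cube k'" "aff m J' \<kappa>' {} z y' = z" "\<forall>i<m. i \<notin> J' \<longrightarrow> z i \<in> {0, 1}"
    by (rule face_of_point[OF z])
  define \<phi>1 where "\<phi>1 = restrict (\<phi> \<circ> aff n J \<kappa> {} a) (cube k)"
  define \<psi>1 where "\<psi>1 = restrict (\<psi> \<circ> aff m J' \<kappa>' {} z) (cube k')"
  have \<phi>1: "\<phi>1 \<in> K k" unfolding \<phi>1_def using y by (intro aff_K[OF \<phi>]) auto
  have \<psi>1: "\<psi>1 \<in> K k'" unfolding \<psi>1_def using y' by (intro aff_K[OF \<psi>]) auto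
  have e: "\<phi>1 y = \<phi> a" "\<psi>1 y' = \<psi> z"
    using y y' open_cube_subset by (auto simp: restrict_def \<phi>1_def \<psi>1_def)
  then have "\<psi>1 ` open_cube k' \<inter> \<phi>1 ` open_cube k \<noteq> {}" using y(3) y'(3) eq by (metis disjoint_iff image_eqI)
  then obtain \<pi> A where kk: "k' = k" and \<pi>: "\<pi> permutes {..<k}" "A \<subseteq> {..<k}" "\<phi>1 = reparam k \<pi> A \<psi>1"
    using K_match[OF \<psi>1 \<phi>1] by blast
  have sym: "cube_sym k \<pi> A x \<in> cube k" if "x \<in> cube k" for x
    using that cubeD[OF that] by (auto simp: cube_sym_def intro!: cubeI)
  have symo: "cube_sym k \<pi> A y \<in> open_cube k"
    using y(3) permutes_in_image[OF \<pi>(1)] by (auto simp: cube_sym_def open_cube_def)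
  have rel: "\<phi>1 x = \<psi>1 (cube_sym k \<pi> A x)" if "x \<in> cube k" for x
    using that \<pi>(3) by (simp add: reparam_def)
  have "\<psi>1 (cube_sym k \<pi> A y) = \<psi>1 y'" using rel[OF subsetD[OF open_cube_subset y(3)]] e eq by simp
  then have y'_eq: "cube_sym k \<pi> A y = y'"
    using K_inj[OF \<psi>1] symo y'(3) kk unfolding inj_on_def by blast
  define A' where "A' = {i. \<kappa>' i \<in> A}"
  have aff': "aff m J' \<kappa>' {} z (cube_sym k \<pi> A x) = aff m J' (\<pi> \<circ> \<kappa>') A' z x" for x
    using bij_betwE[OF y'(2)] kk by (auto simp: aff_def cube_sym_def A'_def fun_eq_iff)
  show ?thesis
  proof (rule that[OF y(1,2,5) y'(1) _ y'(5) y(3,4)])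
    show "bij_betw (\<pi> \<circ> \<kappa>') J' {..<k}"
      using y'(2) kk permutes_imp_bij[OF \<pi>(1)] bij_betw_trans by blast
    show "aff m J' (\<pi> \<circ> \<kappa>') A' z y = z" using aff'[of y] y'_eq y'(4) by simp
    show "\<forall>x\<in>cube k. \<phi> (aff n J \<kappa> {} a x) = \<psi> (aff m J' (\<pi> \<circ> \<kappa>') A' z x)"
      using rel sym aff' kk by (simp add: \<phi>1_def \<psi>1_def)
  qed
qed

lemma weak_open:
  assumes "U \<subseteq> S" "\<And>n \<phi>. \<phi> \<in> K n \<Longrightarrow> openin (top_of_set (cube n)) {x \<in> cube n. \<phi> x \<in> U}"
  shows "openin (top_of_set S) U"
proof -
  have "closedin (top_of_set S) (S - U)"
  proof (rule weak_closed)
    fix n \<phi> assume \<phi>: "\<phi> \<in> K n"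
    have "{x \<in> cube n. \<phi> x \<in> S - U} = cube n - {x \<in> cube n. \<phi> x \<in> U}" using K_in_S[OF \<phi>] by blast
    then show "closedin (top_of_set (cube n)) {x \<in> cube n. \<phi> x \<in> S - U}"
      using assms(2)[OF \<phi>] by (simp add: openin_closedin_eq)
  qed auto
  then show ?thesis using assms(1) by (simp add: openin_closedin_eq)
qed

section \<open>Parallel edges and hyperplanes\<close>

definition edge :: "nat \<Rightarrow> ((nat \<Rightarrow> real) \<Rightarrow> 'a) \<Rightarrow> nat \<Rightarrow> (nat \<Rightarrow> real) \<Rightarrow> (nat \<Rightarrow> real) \<Rightarrow> 'a" where
  "edge n \<phi> i b = restrict (\<phi> \<circ> aff n {i} (\<lambda>_. 0) {} b) (cube 1)"

lemma edge_K: "\<phi> \<in> K n \<Longrightarrow> i < n \<Longrightarrow> (\<And>j. j < n \<Longrightarrow> b j \<in> {0, 1}) \<Longrightarrow> edge n \<phi> i b \<in> K 1"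
  unfolding edge_def by (rule aff_K) (auto simp: bij_betw_def)

lemma edge_cong: "(\<And>j. j < n \<Longrightarrow> j \<noteq> i \<Longrightarrow> b j = b' j) \<Longrightarrow> edge n \<phi> i b = edge n \<phi> i b'"
  unfolding edge_def by (intro arg_cong[where f = "\<lambda>g. restrict (\<phi> \<circ> g) (cube 1)"] ext aff_cong) auto

lemma axis_edge_eq: assumes "i < n" shows "axis_edge i \<phi> = edge n \<phi> i (\<lambda>_. 0)"
proof -
  have "aff n {i} (\<lambda>_. 0) {} (\<lambda>_. 0) t = (\<lambda>j. if j = i then t 0 else 0)" for t
    using assms by (auto simp: aff_def)
  then show ?thesis by (simp add: axis_edge_def edge_def o_def)
qed

lemma axis_edge_K: "\<phi> \<in> K n \<Longrightarrow> i < n \<Longrightarrow> axis_edge i \<phi> \<in> K 1"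
  by (simp only: axis_edge_eq, rule edge_K) auto

lemma square_K:
  assumes "\<phi> \<in> K n" "i < n" "j < n" "i \<noteq> j" "\<And>l. l < n \<Longrightarrow> b l \<in> {0, 1}"
  shows "restrict (\<phi> \<circ> aff n {i, j} (\<lambda>m. if m = i then 0 else 1) {} b) (cube 2) \<in> K 2"
  using assms by (intro aff_K) (auto simp: bij_betw_def lessThan_def)

lemma face_map_square: "t \<in> cube 1 \<Longrightarrow> c \<in> {0, 1} \<Longrightarrow> face_map 1 c t \<in> cube 2"
  by (auto simp: cube_def face_map_def)

lemma edge_opposite:
  assumes "\<phi> \<in> K n" "i < n" "j < n" "i \<noteq> j" "\<And>l. l < n \<Longrightarrow> b l \<in> {0, 1}"
  shows "opposite_sides K (edge n \<phi> i (b(j := 0))) (edge n \<phi> i (b(j := 1)))"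
proof -
  define \<sigma> where "\<sigma> = restrict (\<phi> \<circ> aff n {i, j} (\<lambda>m. if m = i then 0 else 1) {} b) (cube 2)"
  have "face 2 1 c \<sigma> = edge n \<phi> i (b(j := c))" if c: "c \<in> {0, 1}" for c
  proof -
    have "aff n {i, j} (\<lambda>m. if m = i then 0 else 1) {} b (face_map 1 c t) = aff n {i} (\<lambda>_. 0) {} (b(j := c)) t" for t
      using assms by (auto simp: aff_def face_map_def fun_eq_iff)
    moreover have "2 - 1 = (1::nat)" by simp
    ultimately show ?thesis using face_map_square[OF _ c]
      unfolding face_def edge_def \<sigma>_def by (simp only:) (rule restrict_ext, simp)
  qed
  note * = this[of 0] this[of 1]
  have "\<sigma> \<in> K 2" unfolding \<sigma>_def by (rule square_K[OF assms])
  then show ?thesis unfolding opposite_sides_def using * by (intro bexI[of _ \<sigma>]) simp_all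
qed

lemma parallel_refl [simp]: "parallel K e e"
  by (simp add: parallel_def)

lemma parallel_sym: "parallel K e f \<Longrightarrow> parallel K f e"
  unfolding parallel_def by (rule equivclp_sym)

lemma parallel_trans: "parallel K e f \<Longrightarrow> parallel K f g \<Longrightarrow> parallel K e g"
  unfolding parallel_def by (rule equivclp_trans)

lemma opposite_parallel: "opposite_sides K e f \<Longrightarrow> parallel K e f"
  unfolding parallel_def by (rule r_into_equivclp)

text \<open>Two vertices of a cube are joined by changing one coordinate at a time, and each change
  of a coordinate other than \<open>i\<close> slides the edge across a square.\<close>

lemma edge_parallel:
  assumes "\<phi> \<in> K n" "i < n" "\<And>l. l < n \<Longrightarrow> b l \<in> {0, 1}" "\<And>l. l < n \<Longrightarrow> b' l \<in> {0, 1}"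
  shows "parallel K (edge n \<phi> i b) (edge n \<phi> i b')"
proof -
  have step: "parallel K (edge n \<phi> i c) (edge n \<phi> i (c(j := d)))"
    if c: "\<And>l. l < n \<Longrightarrow> c l \<in> {0, 1}" and d: "d \<in> {0, 1}" and j: "j < n" for c j d
  proof (cases "j = i")
    case True
    then have "edge n \<phi> i c = edge n \<phi> i (c(j := d))" by (intro edge_cong) auto
    then show ?thesis by simp
  next
    case False
    have p: "parallel K (edge n \<phi> i (c(j := 0))) (edge n \<phi> i (c(j := 1)))"
      using assms c j False by (intro opposite_parallel edge_opposite) auto
    have "c = c(j := c j)" by simp
    moreover have "c j \<in> {0, 1}" using c j by blast
    ultimately show ?thesis using p parallel_sym[OF p] d by (metis insertE parallel_refl singletonD)
  qed
  define B where "B m j = (if j < m then b' j else b j)" for m j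
  have "m \<le> n \<Longrightarrow> parallel K (edge n \<phi> i b) (edge n \<phi> i (B m))" for m
  proof (induction m)
    case (Suc m)
    have "B (Suc m) = (B m)(m := b' m)" by (auto simp: B_def fun_eq_iff less_Suc_eq)
    moreover have "parallel K (edge n \<phi> i (B m)) (edge n \<phi> i ((B m)(m := b' m)))"
      using assms Suc.prems by (intro step) (auto simp: B_def)
    ultimately show ?case using Suc.IH Suc.prems parallel_trans[of _ "edge n \<phi> i (B m)"] by (simp del: fun_upd_apply)
  next
    case 0
    have "B 0 = b" by (simp add: B_def fun_eq_iff)
    then show ?case by simp
  qed
  moreover have "edge n \<phi> i (B n) = edge n \<phi> i b'" by (rule edge_cong) (simp add: B_def)
  ultimately show ?thesis by (metis order_refl)
qed

lemma rev_edge_apply: "t \<in> cube 1 \<Longrightarrow> rev_edge e t = e (\<lambda>i. if i = 0 then 1 - t 0 else 0)"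
  unfolding rev_edge_def reparam_def cube_sym_def by (auto intro!: arg_cong[where f = e])

lemma cube1_sym: "t \<in> cube 1 \<Longrightarrow> (\<lambda>i. if i = 0 then 1 - t 0 else 0) \<in> cube 1"
  by (auto simp: cube_def)

lemma rev_edge_K: "e \<in> K 1 \<Longrightarrow> rev_edge e \<in> K 1"
  unfolding rev_edge_def by (rule K_reparam) (auto simp: permutes_id)

lemma rev_rev_edge: assumes "e \<in> K 1" shows "rev_edge (rev_edge e) = e"
proof (rule extensionalityI[of _ "cube 1"])
  show "e \<in> extensional (cube 1)" using K_ext assms by blast
  show "rev_edge (rev_edge e) \<in> extensional (cube 1)" using K_ext rev_edge_K assms by blast
  fix t :: "nat \<Rightarrow> real" assume t: "t \<in> cube 1"
  then have "(\<lambda>i. if i = 0 then t 0 else 0) = t" by (auto simp: cube_def fun_eq_iff)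
  then show "rev_edge (rev_edge e) t = e t" using t cube1_sym[OF t] by (simp add: rev_edge_apply cong: if_cong)
qed

text \<open>Reflecting a square in its first coordinate reverses two opposite sides at once.\<close>

lemma parallel_rev: assumes "parallel K e f" shows "parallel K (rev_edge e) (rev_edge f)"
proof -
  have opp_rev: "opposite_sides K (rev_edge e) (rev_edge f)" if opp: "opposite_sides K e f" for e f
  proof -
    obtain \<sigma> where \<sigma>: "\<sigma> \<in> K 2" "e = face 2 1 0 \<sigma>" "f = face 2 1 1 \<sigma>" using opp unfolding opposite_sides_def by blast
    define \<sigma>' where "\<sigma>' = reparam 2 id {0} \<sigma>"
    have "\<sigma>' \<in> K 2" unfolding \<sigma>'_def using \<sigma> by (intro K_reparam) (auto simp: permutes_id)
    have "rev_edge (face 2 1 c \<sigma>) = face 2 1 c \<sigma>'" if c: "c \<in> {0, 1}" for c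
    proof
      fix t :: "nat \<Rightarrow> real"
      show "rev_edge (face 2 1 c \<sigma>) t = face 2 1 c \<sigma>' t"
      proof (cases "t \<in> cube 1")
        case True
        have "rev_edge (face 2 1 c \<sigma>) t = \<sigma> (face_map 1 c (\<lambda>i. if i = 0 then 1 - t 0 else 0))"
          using True cube1_sym by (simp add: rev_edge_apply face_def)
        moreover have "face 2 1 c \<sigma>' t = \<sigma> (cube_sym 2 id {0} (face_map 1 c t))"
          using True face_map_square[OF True c] by (simp add: face_def \<sigma>'_def reparam_def)
        moreover have "cube_sym 2 id {0} (face_map 1 c t) = face_map 1 c (\<lambda>i. if i = 0 then 1 - t 0 else 0)"
          by (auto simp: cube_sym_def face_map_def fun_eq_iff)
        ultimately show ?thesis by simp
      next
        case False
        then show ?thesis by (simp add: rev_edge_def reparam_def face_def)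
      qed
    qed
    note * = this[of 0] this[of 1]
    then show ?thesis unfolding opposite_sides_def using \<sigma> \<open>\<sigma>' \<in> K 2\<close> by (intro bexI[of _ \<sigma>']) simp_all
  qed
  show ?thesis using assms unfolding parallel_def
  proof (induction rule: equivclp_induct)
    case (step y z)
    then have "parallel K (rev_edge y) (rev_edge z)"
      using opp_rev opposite_parallel parallel_sym by blast
    then show ?case using step.IH unfolding parallel_def by (rule equivclp_trans[rotated])
  qed simp
qed

section \<open>Labels of oriented edges\<close>

definition hyp :: "((nat \<Rightarrow> real) \<Rightarrow> 'a) \<Rightarrow> ((nat \<Rightarrow> real) \<Rightarrow> 'a) set" where
  "hyp e = dual_hyperplane K e"

text \<open>Each hyperplane is oriented by an arbitrary dual edge; the sign of a label records whether
  the edge agrees with it.\<close>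

definition lab :: "((nat \<Rightarrow> real) \<Rightarrow> 'a) \<Rightarrow> ((nat \<Rightarrow> real) \<Rightarrow> 'a) set \<times> bool" where
  "lab e = (hyp e, parallel K (SOME f. f \<in> hyp e) e)"

lemma hyp_self: "e \<in> K 1 \<Longrightarrow> e \<in> hyp e"
  by (simp add: hyp_def dual_hyperplane_def)

lemma parallel_cong: "parallel K e f \<Longrightarrow> parallel K e g \<longleftrightarrow> parallel K f g"
  using parallel_trans parallel_sym by metis

lemma hyp_parallel: "parallel K e f \<Longrightarrow> hyp e = hyp f"
  unfolding hyp_def dual_hyperplane_def
  by (intro Collect_cong) (simp only: parallel_cong[of e f] parallel_cong[OF parallel_rev, of e f])

lemma hyp_rev: "e \<in> K 1 \<Longrightarrow> hyp (rev_edge e) = hyp e"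
  unfolding hyp_def dual_hyperplane_def by (auto simp: rev_rev_edge)

lemma hyp_hyperplanes: "e \<in> K 1 \<Longrightarrow> hyp e \<in> hyperplanes K"
  unfolding hyperplanes_def hyp_def by blast

lemma lab_parallel: "parallel K e f \<Longrightarrow> lab e = lab f"
  unfolding lab_def using hyp_parallel[of e f] parallel_trans[of _ e f] parallel_trans[OF _ parallel_sym, of _ f e] by auto

lemma forms_corner_axes:
  assumes "\<phi> \<in> K n" "i < n" "j < n" "i \<noteq> j"
  shows "forms_corner K (axis_edge i \<phi>) (axis_edge j \<phi>)"
proof -
  define \<sigma> where "\<sigma> = restrict (\<phi> \<circ> aff n {i, j} (\<lambda>m. if m = i then 0 else 1) {} (\<lambda>_. 0)) (cube 2)"
  have 1: "aff n {i, j} (\<lambda>m. if m = i then 0 else 1) {} (\<lambda>_. 0) (\<lambda>l. if l = c then r else 0) =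
    (\<lambda>l. if l = (if c = 0 then i else j) then r else 0)" if "c < 2" for c :: nat and r :: real
    using assms that by (auto simp: aff_def fun_eq_iff)
  have 2: "(\<lambda>l. if l = c then t 0 else 0) \<in> cube 2" if "t \<in> cube 1" "c < 2" for t :: "nat \<Rightarrow> real" and c :: nat
    using that by (auto simp: cube_def)
  have "axis_edge c \<sigma> = axis_edge (if c = 0 then i else j) \<phi>" if "c < 2" for c
    using 1[OF that] 2[OF _ that] unfolding axis_edge_def \<sigma>_def by (auto intro!: restrict_ext)
  from this[of 0] this[of 1] show ?thesis
    unfolding forms_corner_def using square_K[OF assms, of "\<lambda>_. 0"] \<sigma>_def by force
qed

lemma forms_corner_sym: assumes "forms_corner K e f" shows "forms_corner K f e"
proof -
  obtain \<sigma> where \<sigma>: "\<sigma> \<in> K 2" "e = axis_edge 0 \<sigma>" "f = axis_edge 1 \<sigma>" using assms forms_corner_def by blast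
  then show ?thesis using forms_corner_axes[OF \<sigma>(1), of 1 0] by simp
qed

end

section \<open>Coordinates on a special cube complex\<close>

text \<open>The distance in the circle of reals modulo 1, for representatives in the unit
  interval.\<close>

definition cd :: "real \<Rightarrow> real \<Rightarrow> real" where
  "cd a b = min \<bar>a - b\<bar> (1 - \<bar>a - b\<bar>)"

text \<open>For points at distance less than 1/2 on the circle \<open>\<real>/\<int>\<close>: the signed crossing of 1/2
  on the short arc from \<open>a\<close> to \<open>b\<close>.\<close>

definition cross :: "real \<Rightarrow> real \<Rightarrow> int" where
  "cross a b = (if a < 1/2 \<and> 1/2 \<le> b \<and> b - a < 1/2 then 1
                else if b < 1/2 \<and> 1/2 \<le> a \<and> a - b < 1/2 then - 1 else 0)"

lemma cd_less: "cd a b < r \<longleftrightarrow> \<bar>a - b\<bar> < r \<or> 1 - r < a - b \<or> 1 - r < b - a"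
  unfolding cd_def by linarith

text \<open>With pairwise distances below 1/4 the three points lie on an arc shorter than 1/2, along
  which signed crossings add up.\<close>

lemma cross_cocycle:
  assumes "0 \<le> a" "a < 1" "0 \<le> b" "b < 1" "0 \<le> c" "c < 1" "cd a b < 1/4" "cd b c < 1/4" "cd a c < 1/4"
  shows "cross a b + cross b c = cross a c"
  using assms(7-9) unfolding cd_less
  by (cases "a < 1/2"; cases "b < 1/2"; cases "c < 1/2") (use assms(1-6) in \<open>auto simp: cross_def\<close>)

lemma cross_nonzero: "0 \<le> a \<Longrightarrow> 0 \<le> b \<Longrightarrow> cross a b \<noteq> 0 \<Longrightarrow> a \<noteq> 0 \<and> b \<noteq> 0"
  by (auto simp: cross_def split: if_splits)

lemma cross_refl [simp]: "cross a a = 0"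
  by (auto simp: cross_def)

lemma cross_values: "cross a b \<noteq> 0 \<Longrightarrow> cross a b = (if 0 < cross a b then 1 else - 1)"
  by (simp add: cross_def split: if_splits)

lemma cd_triangle:
  assumes "0 \<le> a" "a < 1" "0 \<le> b" "b < 1" "0 \<le> c" "c < 1" "cd a c < 1/8" "cd b c < 1/8"
  shows "cd a b < 1/4"
  using assms unfolding cd_less by linarith

lemma frac_01: "0 \<le> t \<Longrightarrow> t \<le> 1 \<Longrightarrow> frac t = (if t < 1 then t else (0::real))"
  by (auto simp: frac_eq)

lemma cd_frac: assumes "0 \<le> t" "t \<le> 1" "0 \<le> c" "c < 1" shows "cd (frac t) c = cd t c"
  using assms by (auto simp: frac_01 cd_def min_def abs_if)

locale special_complex = cubes S K for S :: "'a::topological_space set" and K +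
  assumes special: "special_cube_complex S K"
begin

lemma embedded: assumes "e \<in> H" "f \<in> H" "H \<in> hyperplanes K" shows "\<not> forms_corner K e f"
  using special assms unfolding special_cube_complex_def hyperplanes_embedded_def by meson

lemma two_sided: "e \<in> K 1 \<Longrightarrow> \<not> parallel K e (rev_edge e)"
  using special unfolding special_cube_complex_def hyperplanes_two_sided_def by meson

lemma no_self_osculation:
  "e \<in> K 1 \<Longrightarrow> f \<in> K 1 \<Longrightarrow> parallel K e f \<Longrightarrow> initial e = initial f \<Longrightarrow> e \<noteq> f \<Longrightarrow> forms_corner K e f"
  using special unfolding special_cube_complex_def hyperplanes_self_osculate_def by meson

lemma no_inter_osculation:
  assumes "H \<in> hyperplanes K" "H' \<in> hyperplanes K" "H \<noteq> H'" "hyperplanes_cross K H H'"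
    "e \<in> H" "f \<in> H'" "initial e = initial f"
  shows "forms_corner K e f"
  using special assms unfolding special_cube_complex_def hyperplanes_osculate_def by meson

text \<open>By two-sidedness exactly one of an edge and its reverse is parallel to the edge that
  orients their hyperplane.\<close>

lemma lab_rev: assumes e: "e \<in> K 1" shows "lab (rev_edge e) = linv (lab e)"
proof -
  define r where "r = (SOME f. f \<in> hyp e)"
  have "r \<in> hyp e" unfolding r_def by (rule someI[of _ e]) (rule hyp_self[OF e])
  then have "parallel K e r \<or> parallel K (rev_edge e) r" by (simp add: hyp_def dual_hyperplane_def)
  then have "parallel K r (rev_edge e) \<longleftrightarrow> \<not> parallel K r e"
    using two_sided[OF e] parallel_sym parallel_trans by metis
  then show ?thesis by (simp add: lab_def linv_def hyp_rev[OF e] flip: r_def)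
qed

text \<open>Edges dual to the same hyperplane are parallel up to reversal, and reversal would change
  the sign of the label.\<close>

lemma lab_eq_parallel: assumes "e \<in> K 1" "f \<in> K 1" "lab e = lab f" shows "parallel K e f"
proof (rule ccontr)
  assume no: "\<not> parallel K e f"
  have "f \<in> hyp e" using hyp_self[OF assms(2)] assms(3) by (simp add: lab_def)
  then have "parallel K (rev_edge e) f" using no by (simp add: hyp_def dual_hyperplane_def)
  then have "linv (lab e) = lab e" using lab_parallel lab_rev assms by metis
  then show False by simp
qed

definition xing :: "((nat \<Rightarrow> real) \<Rightarrow> 'a) set \<Rightarrow> ((nat \<Rightarrow> real) \<Rightarrow> 'a) set \<Rightarrow> bool" where
  "xing H H' \<longleftrightarrow> H \<in> hyperplanes K \<and> H' \<in> hyperplanes K \<and> hyperplanes_cross K H H'"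

sublocale raag xing
proof
  show "\<not> xing H H" for H using embedded by (auto simp: xing_def hyperplanes_cross_def)
  show "xing H' H" if "xing H H'" for H H'
    using that forms_corner_sym unfolding xing_def hyperplanes_cross_def by blast
qed

notation eqw (infix "\<doteq>" 50)

definition axl :: "((nat \<Rightarrow> real) \<Rightarrow> 'a) \<Rightarrow> nat \<Rightarrow> ((nat \<Rightarrow> real) \<Rightarrow> 'a) set \<times> bool" where
  "axl \<phi> i = lab (axis_edge i \<phi>)"

lemma axl_xing: assumes "\<phi> \<in> K n" "i < n" "j < n" "i \<noteq> j" shows "xing (fst (axl \<phi> i)) (fst (axl \<phi> j))"
  using forms_corner_axes[OF assms] hyp_self[OF axis_edge_K[OF assms(1,2)]] hyp_self[OF axis_edge_K[OF assms(1,3)]]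
    hyp_hyperplanes[OF axis_edge_K[OF assms(1,2)]] hyp_hyperplanes[OF axis_edge_K[OF assms(1,3)]]
  unfolding axl_def lab_def xing_def hyperplanes_cross_def by auto

lemma axl_inj: "\<phi> \<in> K n \<Longrightarrow> i < n \<Longrightarrow> j < n \<Longrightarrow> fst (axl \<phi> i) = fst (axl \<phi> j) \<Longrightarrow> i = j"
  using axl_xing[of \<phi> n i j] comm_irrefl by metis

text \<open>An axis of the face is an edge of the cube at another vertex, parallel to the
  corresponding axis at the origin or to its reverse.\<close>

lemma axl_aff:
  assumes \<phi>: "\<phi> \<in> K n" and J: "J \<subseteq> {..<n}" "bij_betw \<kappa> J {..<k}" and b: "\<forall>i<n. i \<notin> J \<longrightarrow> b i \<in> {0, 1}"
    and i: "i \<in> J"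
  shows "axl (restrict (\<phi> \<circ> aff n J \<kappa> A b) (cube k)) (\<kappa> i) = (if i \<in> A then linv (axl \<phi> i) else axl \<phi> i)"
proof -
  define \<psi> where "\<psi> = restrict (\<phi> \<circ> aff n J \<kappa> A b) (cube k)"
  define b' where "b' j = (if j \<in> J then if j \<in> A then 1 else 0 else b j)" for j
  have ki: "\<kappa> i < k" using J i bij_betwE by blast
  have ni: "i < n" using i J by auto
  have b': "\<And>l. l < n \<Longrightarrow> b' l \<in> {0, 1}" using b by (auto simp: b'_def)
  have inj: "\<kappa> j = \<kappa> i \<longleftrightarrow> j = i" if "j \<in> J" for j using J(2) i that by (auto simp: bij_betw_def inj_on_def)
  have e: "edge n \<phi> i b' \<in> K 1" using edge_K \<phi> ni b' by blast
  have cb: "(\<lambda>j. if j = \<kappa> i then t 0 else 0) \<in> cube k" if "t \<in> cube 1" for t :: "nat \<Rightarrow> real"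
    using that ki by (auto simp: cube_def)
  have ax: "axis_edge (\<kappa> i) \<psi> = restrict (\<lambda>t. \<phi> (aff n J \<kappa> A b (\<lambda>j. if j = \<kappa> i then t 0 else 0))) (cube 1)"
    unfolding axis_edge_def \<psi>_def by (rule restrict_ext) (use cb in simp)
  have "axis_edge (\<kappa> i) \<psi> = (if i \<in> A then rev_edge (edge n \<phi> i b') else edge n \<phi> i b')"
  proof (cases "i \<in> A")
    case True
    have "aff n J \<kappa> A b (\<lambda>j. if j = \<kappa> i then t 0 else 0) =
      aff n {i} (\<lambda>_. 0) {} b' (\<lambda>j. if j = 0 then 1 - t 0 else 0)" for t :: "nat \<Rightarrow> real"
      using True inj by (auto simp: aff_def b'_def fun_eq_iff i)
    moreover have "rev_edge (edge n \<phi> i b') =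
      restrict (\<lambda>t. edge n \<phi> i b' (\<lambda>j. if j = 0 then 1 - t 0 else 0)) (cube 1)"
    proof
      fix t show "rev_edge (edge n \<phi> i b') t =
        restrict (\<lambda>t. edge n \<phi> i b' (\<lambda>j. if j = 0 then 1 - t 0 else 0)) (cube 1) t"
        by (cases "t \<in> cube 1") (simp only: rev_edge_apply restrict_apply' , simp add: rev_edge_def reparam_def)
    qed
    moreover have "\<dots> = restrict (\<lambda>t. \<phi> (aff n {i} (\<lambda>_. 0) {} b' (\<lambda>j. if j = 0 then 1 - t 0 else 0))) (cube 1)"
      by (rule restrict_ext) (use cube1_sym in \<open>simp add: edge_def\<close>)
    ultimately show ?thesis using True ax by simp
  next
    case False
    have "aff n J \<kappa> A b (\<lambda>j. if j = \<kappa> i then t 0 else 0) = aff n {i} (\<lambda>_. 0) {} b' t" for t :: "nat \<Rightarrow> real"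
      using False inj by (auto simp: aff_def b'_def fun_eq_iff i)
    then show ?thesis using False ax by (simp add: edge_def o_def)
  qed
  moreover have "lab (edge n \<phi> i b') = axl \<phi> i"
    unfolding axl_def axis_edge_eq[OF ni] using \<phi> ni b' by (intro lab_parallel edge_parallel) auto
  ultimately show ?thesis using lab_rev[OF e] by (simp add: axl_def \<psi>_def)
qed

text \<open>At most one axis of a cube is dual to \<open>H\<close>, so at most one summand matters:
  the position across \<open>H\<close>, measured along its orientation. A cube that \<open>H\<close>
  misses gets the value 0.\<close>

definition co :: "nat \<Rightarrow> ((nat \<Rightarrow> real) \<Rightarrow> 'a) \<Rightarrow> (nat \<Rightarrow> real) \<Rightarrow> ((nat \<Rightarrow> real) \<Rightarrow> 'a) set \<Rightarrow> real" where
  "co n \<phi> x H = (\<Sum>i<n. if fst (axl \<phi> i) = H then if snd (axl \<phi> i) then x i else 1 - x i else 0)"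

lemma co_label:
  assumes "\<phi> \<in> K n" "i < n"
  shows "co n \<phi> x (fst (axl \<phi> i)) = (if snd (axl \<phi> i) then x i else 1 - x i)"
proof -
  have "co n \<phi> x (fst (axl \<phi> i)) = (\<Sum>j<n. if j = i then if snd (axl \<phi> i) then x i else 1 - x i else 0)"
    unfolding co_def using axl_inj[OF assms(1) _ assms(2)] by (intro sum.cong) auto
  then show ?thesis using assms by simp
qed

lemma co_none: "(\<And>i. i < n \<Longrightarrow> fst (axl \<phi> i) \<noteq> H) \<Longrightarrow> co n \<phi> x H = 0"
  unfolding co_def by (intro sum.neutral) auto

lemma co_range: assumes "\<phi> \<in> K n" "x \<in> cube n" shows "0 \<le> co n \<phi> x H" "co n \<phi> x H \<le> 1"
proof -
  have "0 \<le> co n \<phi> x H \<and> co n \<phi> x H \<le> 1"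
  proof (cases "\<exists>i<n. fst (axl \<phi> i) = H")
    case True
    then obtain i where "i < n" "fst (axl \<phi> i) = H" by blast
    then show ?thesis using co_label[OF assms(1), of i x] cubeD[OF assms(2), of i] by auto
  next
    case False
    then show ?thesis using co_none[of n \<phi> H x] by simp
  qed
  then show "0 \<le> co n \<phi> x H" "co n \<phi> x H \<le> 1" by auto
qed

text \<open>A frozen coordinate is 0 or 1 in the cube, while the face misses its hyperplane and has
  coordinate 0. The values agree only modulo 1, which is why coordinates are taken in a
  circle.\<close>

lemma frac_co_aff:
  assumes \<phi>: "\<phi> \<in> K n" and J: "J \<subseteq> {..<n}" "bij_betw \<kappa> J {..<k}" and b: "\<forall>i<n. i \<notin> J \<longrightarrow> b i \<in> {0, 1}"
  shows "frac (co n \<phi> (aff n J \<kappa> A b y) H) = frac (co k (restrict (\<phi> \<circ> aff n J \<kappa> A b) (cube k)) y H)"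
proof -
  define \<psi> where "\<psi> = restrict (\<phi> \<circ> aff n J \<kappa> A b) (cube k)"
  have \<psi>: "\<psi> \<in> K k" unfolding \<psi>_def using b by (intro aff_K[OF \<phi> J]) auto
  have ax: "axl \<psi> (\<kappa> i) = (if i \<in> A then linv (axl \<phi> i) else axl \<phi> i)" if "i \<in> J" for i
    unfolding \<psi>_def by (rule axl_aff[OF \<phi> J b that])
  have surj: "\<exists>i\<in>J. j = \<kappa> i" if "j < k" for j using J(2) that by (auto simp: bij_betw_def)
  show ?thesis
  proof (cases "\<exists>i<n. fst (axl \<phi> i) = H")
    case True
    then obtain i where i: "i < n" "fst (axl \<phi> i) = H" by blast
    note l = co_label[OF \<phi> i(1), of "aff n J \<kappa> A b y", unfolded i(2)]
    show ?thesis
    proof (cases "i \<in> J")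
      case iJ: True
      then have "\<kappa> i < k" "fst (axl \<psi> (\<kappa> i)) = H" using J(2) bij_betwE ax i by auto
      then have "co k \<psi> y H = (if snd (axl \<psi> (\<kappa> i)) then y (\<kappa> i) else 1 - y (\<kappa> i))"
        using co_label[OF \<psi>, of "\<kappa> i" y] by simp
      then show ?thesis using l ax[OF iJ] iJ i by (auto simp: aff_def \<psi>_def)
    next
      case False
      have "fst (axl \<psi> j) \<noteq> H" if jk: "j < k" for j
      proof -
        obtain i' where i': "i' \<in> J" "j = \<kappa> i'" using surj jk by blast
        then have "fst (axl \<psi> j) = fst (axl \<phi> i')" using ax by simp
        moreover have "i' \<noteq> i" "i' < n" using False i' J by auto
        ultimately show ?thesis using axl_inj[OF \<phi> _ i(1)] i by metis
      qed
      then have "co k \<psi> y H = 0" by (rule co_none)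
      moreover have "aff n J \<kappa> A b y i \<in> {0, 1}" using False i b by (auto simp: aff_def)
      then have "frac (co n \<phi> (aff n J \<kappa> A b y) H) = 0" using l by (auto simp: frac_def)
      ultimately show ?thesis by (simp add: \<psi>_def)
    qed
  next
    case False
    have "fst (axl \<psi> j) \<noteq> H" if jk: "j < k" for j
    proof -
      obtain i' where i': "i' \<in> J" "j = \<kappa> i'" using surj jk by blast
      then have "fst (axl \<psi> j) = fst (axl \<phi> i')" using ax by simp
      moreover have "i' < n" using i' J by auto
      ultimately show ?thesis using False by auto
    qed
    then have "co k \<psi> y H = 0" by (rule co_none)
    moreover have "co n \<phi> (aff n J \<kappa> A b y) H = 0" using False by (intro co_none) auto
    ultimately show ?thesis by (simp add: \<psi>_def)
  qed
qed

definition crd :: "'a \<Rightarrow> ((nat \<Rightarrow> real) \<Rightarrow> 'a) set \<Rightarrow> real" where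
  "crd y H = (SOME c. \<exists>n \<phi> x. \<phi> \<in> K n \<and> x \<in> cube n \<and> \<phi> x = y \<and> c = frac (co n \<phi> x H))"

text \<open>Cubes meeting in a point share a face there, and on it their coordinates agree modulo 1;
  so the choice in \<open>crd\<close> is immaterial.\<close>

lemma crd_eq: assumes "\<phi> \<in> K n" "x \<in> cube n" shows "crd (\<phi> x) H = frac (co n \<phi> x H)"
proof -
  have "frac (co m \<psi> z H) = frac (co n \<phi> x H)" if \<psi>: "\<psi> \<in> K m" and z: "z \<in> cube m" and e: "\<psi> z = \<phi> x" for m \<psi> z
  proof -
    obtain J \<kappa> J' \<kappa>' A k y where f:
      "J = {i. i < m \<and> 0 < z i \<and> z i < 1}" "bij_betw \<kappa> J {..<k}" "\<forall>i<m. i \<notin> J \<longrightarrow> z i \<in> {0, 1}"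
      "J' = {i. i < n \<and> 0 < x i \<and> x i < 1}" "bij_betw \<kappa>' J' {..<k}" "\<forall>i<n. i \<notin> J' \<longrightarrow> x i \<in> {0, 1}"
      "y \<in> open_cube k" "aff m J \<kappa> {} z y = z" "aff n J' \<kappa>' A x y = x"
      "\<forall>u\<in>cube k. \<psi> (aff m J \<kappa> {} z u) = \<phi> (aff n J' \<kappa>' A x u)"
      by (rule common_face[OF \<psi> assms(1) z assms(2) e])
    have "frac (co m \<psi> (aff m J \<kappa> {} z y) H) = frac (co k (restrict (\<psi> \<circ> aff m J \<kappa> {} z) (cube k)) y H)"
      using f by (intro frac_co_aff[OF \<psi>]) auto
    moreover have "frac (co n \<phi> (aff n J' \<kappa>' A x y) H) = frac (co k (restrict (\<phi> \<circ> aff n J' \<kappa>' A x) (cube k)) y H)"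
      using f by (intro frac_co_aff[OF assms(1)]) auto
    moreover have "restrict (\<psi> \<circ> aff m J \<kappa> {} z) (cube k) = restrict (\<phi> \<circ> aff n J' \<kappa>' A x) (cube k)"
      using f(10) by (intro restrict_ext) simp
    ultimately show ?thesis using f(8,9) by simp
  qed
  then show ?thesis unfolding crd_def using assms by (intro some_equality) blast+
qed

lemma crd_range: assumes "y \<in> S" shows "0 \<le> crd y H" "crd y H < 1"
proof -
  obtain n \<phi> x where "\<phi> \<in> K n" "x \<in> open_cube n" "\<phi> x = y" using S_rep[OF assms] .
  then show "0 \<le> crd y H" "crd y H < 1"
    using crd_eq[of \<phi> n x H] open_cube_subset frac_lt_1 by (auto simp: subset_iff)
qed

text \<open>For a point of \<open>S\<close>, the hyperplanes that meet the open cube containing it.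
  They are dual to the directions of one cube, so distinct ones cross.\<close>

definition supp :: "'a \<Rightarrow> ((nat \<Rightarrow> real) \<Rightarrow> 'a) set set" where
  "supp y = {H. crd y H \<noteq> 0}"

lemma supp_label:
  assumes "\<phi> \<in> K n" "x \<in> cube n" "H \<in> supp (\<phi> x)"
  shows "\<exists>i<n. fst (axl \<phi> i) = H"
proof (rule ccontr)
  assume "\<not> ?thesis"
  then have "co n \<phi> x H = 0" by (intro co_none) auto
  then show False using assms crd_eq[OF assms(1,2), of H] by (simp add: supp_def)
qed

lemma supp_finite: "y \<in> S \<Longrightarrow> finite (supp y)"
  and supp_xing: "y \<in> S \<Longrightarrow> H \<in> supp y \<Longrightarrow> H' \<in> supp y \<Longrightarrow> H = H' \<or> xing H H'"
proof -
  assume "y \<in> S"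
  then obtain n \<phi> x where x: "\<phi> \<in> K n" "x \<in> open_cube n" "\<phi> x = y" by (rule S_rep)
  then have l: "\<exists>i<n. fst (axl \<phi> i) = H" if "H \<in> supp y" for H
    using supp_label[of \<phi> n x H] that open_cube_subset by blast
  then have "supp y \<subseteq> (\<lambda>i. fst (axl \<phi> i)) ` {..<n}" by blast
  then show "finite (supp y)" by (rule finite_subset) simp
  show "H = H' \<or> xing H H'" if "H \<in> supp y" "H' \<in> supp y"
    using l[OF that(1)] l[OF that(2)] axl_xing[OF x(1)] by metis
qed

section \<open>Nearby points\<close>

definition nbh :: "'a \<Rightarrow> 'a set" where
  "nbh w = {y \<in> S. \<forall>H. cd (crd y H) (crd w H) < 1/8}"

lemma nbh_self: "w \<in> S \<Longrightarrow> w \<in> nbh w"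
  by (simp add: nbh_def cd_def)

text \<open>There may be infinitely many hyperplanes, but on one cube only the coordinates of its
  own directions vary. All others are 0, so their conditions hold on the whole cube or nowhere, and
  finitely many open conditions remain.\<close>

lemma nbh_open: assumes w: "w \<in> S" shows "openin (top_of_set S) (nbh w)"
proof (rule weak_open)
  show "nbh w \<subseteq> S" by (auto simp: nbh_def)
  fix n \<phi> assume \<phi>: "\<phi> \<in> K n"
  define c where "c = crd w"
  have c: "0 \<le> c H" "c H < 1" for H using crd_range[OF w] by (auto simp: c_def)
  define f where "f i x = cd (if snd (axl \<phi> i) then x i else 1 - x i) (c (fst (axl \<phi> i)))" for i and x :: "nat \<Rightarrow> real"
  have mem: "\<phi> x \<in> nbh w \<longleftrightarrow> (\<forall>H. cd (co n \<phi> x H) (c H) < 1/8)" if x: "x \<in> cube n" for x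
    using K_in_S[OF \<phi> x] crd_eq[OF \<phi> x] co_range[OF \<phi> x] c by (simp add: nbh_def cd_frac flip: c_def)
  have fi: "f i x = cd (co n \<phi> x (fst (axl \<phi> i))) (c (fst (axl \<phi> i)))" if "i < n" for i x
    using co_label[OF \<phi> that] by (simp add: f_def)
  show "openin (top_of_set (cube n)) {x \<in> cube n. \<phi> x \<in> nbh w}"
  proof (cases "\<forall>H. (\<forall>i<n. fst (axl \<phi> i) \<noteq> H) \<longrightarrow> cd 0 (c H) < 1/8")
    case True
    have "\<phi> x \<in> nbh w \<longleftrightarrow> (\<forall>i<n. f i x < 1/8)" if x: "x \<in> cube n" for x
    proof
      assume R: "\<forall>i<n. f i x < 1/8"
      have "cd (co n \<phi> x H) (c H) < 1/8" for H
      proof (cases "\<exists>i<n. fst (axl \<phi> i) = H")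
        case False
        then show ?thesis using True co_none[of n \<phi> H x] by auto
      qed (use R fi in auto)
      then show "\<phi> x \<in> nbh w" using mem[OF x] by blast
    qed (use mem[OF x] fi in auto)
    then have "{x \<in> cube n. \<phi> x \<in> nbh w} = cube n \<inter> (\<Inter>i\<in>{..<n}. {x. f i x < 1/8})" by auto
    moreover have "open {x. f i x < 1/8}" for i
    proof (rule open_Collect_less)
      have "continuous_on UNIV (\<lambda>x::nat \<Rightarrow> real. x i)" by (rule continuous_on_product_coordinates)
      then show "continuous_on UNIV (f i)"
        unfolding f_def cd_def by (cases "snd (axl \<phi> i)") (auto intro!: continuous_intros)
    qed simp
    then have "open (\<Inter>i\<in>{..<n}. {x. f i x < 1/8})" by (intro open_INT) auto
    ultimately show ?thesis by (auto simp: openin_open)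
  next
    case False
    then obtain H where H: "\<forall>i<n. fst (axl \<phi> i) \<noteq> H" "\<not> cd 0 (c H) < 1/8" by blast
    have "\<phi> x \<notin> nbh w" if "x \<in> cube n" for x
      using mem[OF that] co_none[of n \<phi> H x] H by metis
    then have "{x \<in> cube n. \<phi> x \<in> nbh w} = {}" by blast
    then show ?thesis by (simp only: openin_empty)
  qed
qed

definition close :: "'a \<Rightarrow> 'a \<Rightarrow> bool" where
  "close x y \<longleftrightarrow> x \<in> S \<and> y \<in> S \<and> (\<forall>H. cd (crd x H) (crd y H) < 1/4)"

lemma nbh_close: "w \<in> S \<Longrightarrow> x \<in> nbh w \<Longrightarrow> y \<in> nbh w \<Longrightarrow> close x y"
  unfolding close_def nbh_def by (auto intro!: cd_triangle[of _ _ "crd w _"] crd_range simp del: less_divide_eq_numeral1)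

section \<open>Holonomy\<close>

text \<open>The word \<open>tau x y\<close> lists, in an arbitrary order, the hyperplanes crossed between two nearby
  points; those letters commute.\<close>

definition tau :: "'a \<Rightarrow> 'a \<Rightarrow> ((nat \<Rightarrow> real) \<Rightarrow> 'a) set word" where
  "tau x y = map (\<lambda>H. (H, 0 < cross (crd x H) (crd y H)))
     (SOME l. distinct l \<and> set l = {H. cross (crd x H) (crd y H) \<noteq> 0})"

lemma cross_supp: "x \<in> S \<Longrightarrow> y \<in> S \<Longrightarrow> cross (crd x H) (crd y H) \<noteq> 0 \<Longrightarrow> H \<in> supp x \<and> H \<in> supp y"
  using cross_nonzero crd_range unfolding supp_def by blast

lemma tau_list:
  assumes "x \<in> S" "y \<in> S"
  shows "\<exists>l. distinct l \<and> set l = {H. cross (crd x H) (crd y H) \<noteq> 0} \<and>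
     tau x y = map (\<lambda>H. (H, 0 < cross (crd x H) (crd y H))) l"
proof -
  have "{H. cross (crd x H) (crd y H) \<noteq> 0} \<subseteq> supp x" using cross_supp assms by blast
  then have "finite {H. cross (crd x H) (crd y H) \<noteq> 0}" using supp_finite assms finite_subset by blast
  then have "\<exists>l. distinct l \<and> set l = {H. cross (crd x H) (crd y H) \<noteq> 0}" using finite_distinct_list by blast
  from someI_ex[OF this] show ?thesis unfolding tau_def by blast
qed

lemma tau_esum: assumes "x \<in> S" "y \<in> S" shows "esum (tau x y) H = cross (crd x H) (crd y H)"
proof -
  obtain l where l: "distinct l" "set l = {H. cross (crd x H) (crd y H) \<noteq> 0}"
    "tau x y = map (\<lambda>H. (H, 0 < cross (crd x H) (crd y H))) l" using tau_list[OF assms] by blast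
  have "distinct l \<Longrightarrow> esum (map (\<lambda>H. (H, 0 < f H)) l) H = (if H \<in> set l then if 0 < f H then 1 else - 1 else 0)"
    for f :: "_ \<Rightarrow> int" and l
    by (induction l) auto
  from this[OF l(1), of "\<lambda>H. cross (crd x H) (crd y H)"] l(2,3) show ?thesis
    using cross_values[of "crd x H" "crd y H"] by auto
qed

lemma tau_set: assumes "x \<in> S" "y \<in> S" "s \<in> set (tau x y)" shows "cross (crd x (fst s)) (crd y (fst s)) \<noteq> 0"
proof -
  obtain l where l: "set l = {H. cross (crd x H) (crd y H) \<noteq> 0}"
    "tau x y = map (\<lambda>H. (H, 0 < cross (crd x H) (crd y H))) l" using tau_list[OF assms(1,2)] by blast
  have "fst s \<in> set l" using assms(3) unfolding l(2) by auto
  then show ?thesis unfolding l(1) by simp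
qed

lemma tau_refl: "x \<in> S \<Longrightarrow> tau x x = []"
  using tau_list[of x x] by auto

text \<open>Every letter involved has a nonzero coordinate at the middle point \<open>y\<close>, so
  the labels commute or coincide. In such a family exponent sums determine the element, and these
  agree because signed crossings are additive.\<close>

lemma tau_cocycle:
  assumes "close x y" "close y z" "close x z"
  shows "tau x y @ tau y z \<doteq> tau x z"
proof (rule commuting_words_eqw)
  have S: "x \<in> S" "y \<in> S" "z \<in> S" using assms by (auto simp: close_def)
  have c: "cross (crd x H) (crd y H) + cross (crd y H) (crd z H) = cross (crd x H) (crd z H)" for H
    using assms crd_range[OF S(1)] crd_range[OF S(2)] crd_range[OF S(3)]
    by (intro cross_cocycle) (auto simp: close_def)
  show "esum (tau x y @ tau y z) H = esum (tau x z) H" for H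
    using c tau_esum S by simp
  have "fst s \<in> supp y" if "s \<in> set (tau x y @ tau y z) \<union> set (tau x z)" for s
  proof -
    have "cross (crd x (fst s)) (crd y (fst s)) \<noteq> 0 \<or> cross (crd y (fst s)) (crd z (fst s)) \<noteq> 0"
      using that tau_set[of _ _ s] S c[of "fst s"] by force
    then show ?thesis using cross_supp S by blast
  qed
  then show "fst s = fst t \<or> xing (fst s) (fst t)"
    if "s \<in> set (tau x y @ tau y z) \<union> set (tau x z)" "t \<in> set (tau x y @ tau y z) \<union> set (tau x z)" for s t
    using that supp_xing[OF S(2)] by blast
qed

lemma tau_cong_ladder:
  assumes "close x y" "close y z" "close x z" "close x w" "close w z"
  shows "tau x y @ tau y z \<doteq> tau x w @ tau w z"
  using tau_cocycle[OF assms(1,2,3)] tau_cocycle[OF assms(4,5,3)] eqw_sym eqw_trans by blast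

text \<open>A Lebesgue number for the cover by preimages of the sets \<open>nbh w\<close>.\<close>

lemma uniformly_close:
  fixes F :: "'e::metric_space \<Rightarrow> 'a"
  assumes Q: "compact Q" and F: "continuous_on Q F" "F ` Q \<subseteq> S"
  shows "\<exists>\<epsilon>>0. \<forall>x\<in>Q. \<forall>y\<in>Q. \<forall>z\<in>Q. dist x y < \<epsilon> \<longrightarrow> dist x z < \<epsilon> \<longrightarrow> close (F y) (F z)"
proof -
  define C where "C = {G. open G \<and> (\<exists>w\<in>S. F ` (Q \<inter> G) \<subseteq> nbh w)}"
  have "Q \<subseteq> \<Union>C"
  proof
    fix x assume x: "x \<in> Q"
    then have w: "F x \<in> S" using F by blast
    have "openin (top_of_set Q) (Q \<inter> F -` nbh (F x))"
      using F nbh_open[OF w] by (intro continuous_openin_preimage[of Q F S]) auto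
    then obtain G where G: "open G" "Q \<inter> F -` nbh (F x) = Q \<inter> G" by (auto simp: openin_open)
    have "F ` (Q \<inter> G) \<subseteq> nbh (F x)" using G(2) by blast
    then have "G \<in> C" using G(1) w by (auto simp: C_def)
    moreover have "x \<in> G" using G(2) x nbh_self[OF w] by blast
    ultimately show "x \<in> \<Union>C" by blast
  qed
  then obtain \<epsilon> where \<epsilon>: "0 < \<epsilon>" "\<And>x. x \<in> Q \<Longrightarrow> \<exists>G\<in>C. ball x \<epsilon> \<subseteq> G"
  proof (rule Heine_Borel_lemma[OF Q])
    show "open G" if "G \<in> C" for G using that by (simp add: C_def)
  qed (assumption | blast)+
  have "close (F y) (F z)" if x: "x \<in> Q" and y: "y \<in> Q" "dist x y < \<epsilon>" and z: "z \<in> Q" "dist x z < \<epsilon>" for x y z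
  proof -
    obtain G w where "ball x \<epsilon> \<subseteq> G" "w \<in> S" "F ` (Q \<inter> G) \<subseteq> nbh w"
      using \<epsilon>(2)[OF x] by (auto simp: C_def)
    moreover have "y \<in> ball x \<epsilon>" "z \<in> ball x \<epsilon>" using y z by simp_all
    ultimately have "F y \<in> nbh w" "F z \<in> nbh w" using y z by blast+
    then show ?thesis using nbh_close \<open>w \<in> S\<close> by blast
  qed
  then show ?thesis using \<epsilon>(1) by blast
qed

text \<open>On a convex compact set the local words integrate to a global one: move along segments from
  the base point in equal steps, and compare neighbouring segments step by step.\<close>

lemma holonomy_lift:
  fixes F :: "'e::real_normed_vector \<Rightarrow> 'a"
  assumes Q: "compact Q" "convex Q" "q0 \<in> Q" and F: "continuous_on Q F" "F ` Q \<subseteq> S"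
  shows "\<exists>a \<epsilon>. 0 < \<epsilon> \<and> a q0 = [] \<and> (\<forall>x\<in>Q. \<forall>y\<in>Q. dist x y < \<epsilon> \<longrightarrow> a y \<doteq> a x @ tau (F x) (F y))"
proof -
  obtain \<epsilon> where \<epsilon>: "0 < \<epsilon>"
    "\<And>x y z. x \<in> Q \<Longrightarrow> y \<in> Q \<Longrightarrow> z \<in> Q \<Longrightarrow> dist x y < \<epsilon> \<Longrightarrow> dist x z < \<epsilon> \<Longrightarrow> close (F y) (F z)"
    using uniformly_close[OF Q(1) F] by blast
  obtain B where B: "B > 0" "\<And>x. x \<in> Q \<Longrightarrow> dist q0 x \<le> B"
  proof -
    have "bounded Q" using Q(1) by (rule compact_imp_bounded)
    then obtain B where "\<forall>x\<in>Q. dist q0 x \<le> B" using bounded_any_center by blast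
    then show ?thesis using that[of "max 1 B"] by fastforce
  qed
  obtain N :: nat where N: "2 * B / \<epsilon> < real N" using reals_Archimedean2 by blast
  have N0: "N > 0" using N B \<epsilon> by (intro gr0I) (auto simp: divide_less_0_iff)
  define p where "p i x = q0 + (real i / real N) *\<^sub>R (x - q0)" for i :: nat and x
  have p_conv: "p i x = (1 - real i / real N) *\<^sub>R q0 + (real i / real N) *\<^sub>R x" for i x
    by (simp add: p_def algebra_simps)
  have pQ: "p i x \<in> Q" if "x \<in> Q" "i \<le> N" for i x
    unfolding p_conv using that Q N0 by (intro convexD) auto
  have p0: "p 0 x = q0" "p N x = x" for x using N0 by (auto simp: p_def)
  have dxy: "dist (p i x) (p i y) \<le> dist x y" if "i \<le> N" for i x y
  proof -
    have "p i x - p i y = (real i / real N) *\<^sub>R (x - y)" by (simp add: p_def algebra_simps)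
    then have "dist (p i x) (p i y) = (real i / real N) * dist x y" by (simp add: dist_norm)
    also have "\<dots> \<le> 1 * dist x y" using that N0 by (intro mult_right_mono) auto
    finally show ?thesis by simp
  qed
  have dstep: "dist (p i x) (p (Suc i) x) < \<epsilon> / 2" if "x \<in> Q" for i x
  proof -
    have "p i x - p (Suc i) x = - ((1 / real N) *\<^sub>R (x - q0))"
      by (simp add: p_def algebra_simps add_divide_distrib)
    then have "dist (p i x) (p (Suc i) x) = dist q0 x / real N" by (simp add: dist_norm norm_minus_commute)
    also have "\<dots> \<le> B / real N" using B that by (intro divide_right_mono) auto
    also have "\<dots> < \<epsilon> / 2" using N N0 \<epsilon> by (simp add: field_simps)
    finally show ?thesis .
  qed
  define A where "A i x = concat (map (\<lambda>j. tau (F (p j x)) (F (p (Suc j) x))) [0..<i])" for i x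
  have A: "A 0 x = []" "A (Suc i) x = A i x @ tau (F (p i x)) (F (p (Suc i) x))" for i x
    by (simp_all add: A_def)
  have ladder: "A i x @ tau (F (p i x)) (F (p i y)) \<doteq> A i y"
    if xy: "x \<in> Q" "y \<in> Q" "dist x y < \<epsilon> / 2" and "i \<le> N" for i x y
    using \<open>i \<le> N\<close>
  proof (induction i)
    case 0
    have "F q0 \<in> S" using F Q by blast
    then show ?case by (simp add: A p0 tau_refl)
  next
    case (Suc i)
    let ?c = "p i x"
    have i: "i \<le> N" "Suc i \<le> N" using Suc.prems by auto
    \<comment> \<open>The four corners of one rung of the ladder are within \<epsilon> of
      \<open>?c\<close>: a step along a segment costs less than half of it, and so does passing from
      \<open>x\<close> to \<open>y\<close>.\<close>
    have d: "dist ?c (p i x) < \<epsilon>" "dist ?c (p (Suc i) x) < \<epsilon>" "dist ?c (p i y) < \<epsilon>" "dist ?c (p (Suc i) y) < \<epsilon>"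
      using \<epsilon>(1) dstep[OF xy(1), of i] dstep[OF xy(2), of i] dxy[OF i(1), of x y] xy(3)
        dist_triangle[of ?c "p (Suc i) y" "p i y"] by (simp_all add: dist_commute)
    have "tau (F (p i x)) (F (p (Suc i) x)) @ tau (F (p (Suc i) x)) (F (p (Suc i) y)) \<doteq>
        tau (F (p i x)) (F (p i y)) @ tau (F (p i y)) (F (p (Suc i) y))"
      by (intro tau_cong_ladder \<epsilon>(2)[of ?c] pQ xy i d)
    then have "A (Suc i) x @ tau (F (p (Suc i) x)) (F (p (Suc i) y)) \<doteq>
        A i x @ tau (F (p i x)) (F (p i y)) @ tau (F (p i y)) (F (p (Suc i) y))"
      using eqw_append[OF eqw_refl[of "A i x"]] by (simp add: A)
    also have "\<dots> \<doteq> A i y @ tau (F (p i y)) (F (p (Suc i) y))"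
      using eqw_append[OF Suc.IH[OF i(1)] eqw_refl] by simp
    finally show ?case by (simp add: A)
  qed
  have p0i: "p i q0 = q0" for i by (simp add: p_def)
  have "A i q0 = []" for i
    using F Q by (induction i) (auto simp: A p0i tau_refl)
  then show ?thesis
    using ladder[of _ _ N] \<epsilon>(1) eqw_sym by (intro exI[of _ "A N"] exI[of _ "\<epsilon> / 2"]) (auto simp: p0)
qed

definition lifts :: "(real \<Rightarrow> 'a) \<Rightarrow> (real \<Rightarrow> ((nat \<Rightarrow> real) \<Rightarrow> 'a) set word) \<Rightarrow> bool" where
  "lifts \<gamma> a \<longleftrightarrow> (\<exists>\<epsilon>>0. \<forall>s\<in>{0..1}. \<forall>t\<in>{0..1}. dist s t < \<epsilon> \<longrightarrow> a t \<doteq> a s @ tau (\<gamma> s) (\<gamma> t))"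

text \<open>A relation rather than a function, because the word is determined only up to
  \<doteq>.\<close>

definition hol :: "(real \<Rightarrow> 'a) \<Rightarrow> ((nat \<Rightarrow> real) \<Rightarrow> 'a) set word \<Rightarrow> bool" where
  "hol \<gamma> u \<longleftrightarrow> (\<exists>a. lifts \<gamma> a \<and> a 0 = [] \<and> a 1 \<doteq> u)"

lemma steps_01:
  assumes "\<epsilon> > 0" "P 0" "\<And>s t. s \<in> {0..1} \<Longrightarrow> t \<in> {0..1} \<Longrightarrow> dist s t < \<epsilon> \<Longrightarrow> P s \<Longrightarrow> P t"
  shows "P (1::real)"
proof -
  obtain N :: nat where N: "1 / \<epsilon> < real N" using reals_Archimedean2 by blast
  have N0: "N > 0" using N assms(1) by (intro gr0I) (auto simp: divide_less_0_iff)
  have "i \<le> N \<Longrightarrow> P (real i / real N)" for i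
  proof (induction i)
    case (Suc i)
    have "dist (real i / real N) (real (Suc i) / real N) = 1 / real N"
      by (simp add: dist_real_def add_divide_distrib)
    also have "\<dots> < \<epsilon>" using N N0 assms(1) by (simp add: field_simps)
    finally have d: "dist (real i / real N) (real (Suc i) / real N) < \<epsilon>" .
    have "real i / real N \<in> {0..1}" "real (Suc i) / real N \<in> {0..1}"
      using Suc.prems N0 by (simp_all add: divide_le_eq)
    then show ?case using assms(3)[OF _ _ d] Suc.IH Suc.prems by simp
  qed (simp add: assms)
  from this[of N] show ?thesis using N0 by simp
qed

text \<open>Over short intervals both lifts change by the same words, and finitely many short steps
  lead from 0 to 1.\<close>

lemma lifts_unique:
  assumes "lifts \<gamma> a" "lifts \<gamma> b"
  shows "winv (a 0) @ a 1 \<doteq> winv (b 0) @ b 1"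
proof -
  obtain \<epsilon> where \<epsilon>: "\<epsilon> > 0" "\<And>s t. s \<in> {0..1} \<Longrightarrow> t \<in> {0..1} \<Longrightarrow> dist s t < \<epsilon> \<Longrightarrow> a t \<doteq> a s @ tau (\<gamma> s) (\<gamma> t)"
    using assms(1) unfolding lifts_def by blast
  obtain \<epsilon>' where \<epsilon>': "\<epsilon>' > 0" "\<And>s t. s \<in> {0..1} \<Longrightarrow> t \<in> {0..1} \<Longrightarrow> dist s t < \<epsilon>' \<Longrightarrow> b t \<doteq> b s @ tau (\<gamma> s) (\<gamma> t)"
    using assms(2) unfolding lifts_def by blast
  show ?thesis
  proof (rule steps_01[of "min \<epsilon> \<epsilon>'"])
    show "winv (a 0) @ a 0 \<doteq> winv (b 0) @ b 0"
      using eqw_linv eqw_sym eqw_trans by blast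
    fix s t :: real assume st: "s \<in> {0..1}" "t \<in> {0..1}" "dist s t < min \<epsilon> \<epsilon>'"
      and e: "winv (a 0) @ a s \<doteq> winv (b 0) @ b s"
    have "winv (a 0) @ a t \<doteq> winv (a 0) @ a s @ tau (\<gamma> s) (\<gamma> t)"
      using st \<epsilon>(2) by (intro eqw_append) auto
    also have "\<dots> \<doteq> (winv (b 0) @ b s) @ tau (\<gamma> s) (\<gamma> t)"
      using eqw_append[OF e eqw_refl] by simp
    also have "\<dots> \<doteq> winv (b 0) @ b t"
      using eqw_append[OF eqw_refl eqw_sym[OF \<epsilon>'(2)[OF st(1,2)]], of "winv (b 0)"] st by simp
    finally show "winv (a 0) @ a t \<doteq> winv (b 0) @ b t" .
  qed (use \<epsilon> \<epsilon>' in auto)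
qed

lemma lifts_hol: assumes "lifts \<gamma> a" "path \<gamma>" "path_image \<gamma> \<subseteq> S" shows "hol \<gamma> (winv (a 0) @ a 1)"
proof -
  obtain b \<epsilon> where b: "0 < \<epsilon>" "b 0 = []"
    "\<forall>x\<in>{0..1}. \<forall>y\<in>{0..1}. dist x y < \<epsilon> \<longrightarrow> b y \<doteq> b x @ tau (\<gamma> x) (\<gamma> y)"
    using holonomy_lift[of "{0..1::real}" 0 \<gamma>] assms by (auto simp: path_def path_image_def)
  then have "lifts \<gamma> b" unfolding lifts_def by blast
  then show ?thesis unfolding hol_def using b(2) lifts_unique[OF \<open>lifts \<gamma> b\<close> assms(1)]
    by (intro exI[of _ b]) auto
qed

lemma hol_exists: assumes "path \<gamma>" "path_image \<gamma> \<subseteq> S" shows "\<exists>u. hol \<gamma> u"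
proof -
  obtain b \<epsilon> where b: "0 < \<epsilon>"
    "\<forall>x\<in>{0..1}. \<forall>y\<in>{0..1}. dist x y < \<epsilon> \<longrightarrow> b y \<doteq> b x @ tau (\<gamma> x) (\<gamma> y)"
    using holonomy_lift[of "{0..1::real}" 0 \<gamma>] assms by (auto simp: path_def path_image_def)
  then have "lifts \<gamma> b" unfolding lifts_def by blast
  then show ?thesis using lifts_hol assms by blast
qed

lemma hol_unique: "hol \<gamma> u \<Longrightarrow> hol \<gamma> w \<Longrightarrow> u \<doteq> w"
proof -
  assume "hol \<gamma> u" "hol \<gamma> w"
  then obtain a b where a: "lifts \<gamma> a" "a 0 = []" "a 1 \<doteq> u" and b: "lifts \<gamma> b" "b 0 = []" "b 1 \<doteq> w"
    unfolding hol_def by blast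
  have "a 1 \<doteq> b 1" using lifts_unique[OF a(1) b(1)] a(2) b(2) by simp
  then show "u \<doteq> w" using a(3) b(3) eqw_sym eqw_trans by blast
qed

lemma hol_eqw: "hol \<gamma> u \<Longrightarrow> u \<doteq> w \<Longrightarrow> hol \<gamma> w"
  unfolding hol_def using eqw_trans by blast

lemma lifts_const: assumes "lifts (\<lambda>_. p) a" "p \<in> S" shows "a 1 \<doteq> a 0"
proof -
  have "lifts (\<lambda>_. p) (\<lambda>_. [])"
    unfolding lifts_def using assms(2) by (auto simp: tau_refl intro!: exI[of _ 1])
  from lifts_unique[OF assms(1) this] have "winv (a 0) @ a 1 \<doteq> []" by simp
  then have "a 0 @ winv (a 0) @ a 1 \<doteq> a 0 @ []" by (intro eqw_append) auto
  then show ?thesis using eqw_inv_cancel(2)[of "a 0" "a 1"] eqw_sym eqw_trans by (metis append_Nil2)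
qed

lemma hol_const: assumes "p \<in> S" shows "hol (\<lambda>_. p) []"
  unfolding hol_def lifts_def using assms
  by (intro exI[of _ "\<lambda>_. []"] conjI exI[of _ 1]) (auto simp: tau_refl)

text \<open>The word is lifted over the whole homotopy square. The first and last rows lift the two
  paths, and the sides lie over constant paths, along which the word does not change.\<close>

lemma hol_homotopic:
  assumes h: "homotopic_paths S \<gamma> \<delta>" and u: "hol \<gamma> u"
  shows "hol \<delta> u"
proof -
  obtain f where f0: "continuous_on ({0..1} \<times> {0..1}) f" "f \<in> ({0..1} \<times> {0..1}) \<rightarrow> S"
    "\<forall>x\<in>{0..1}. f (0, x) = \<gamma> x" "\<forall>x\<in>{0..1}. f (1, x) = \<delta> x"
    "\<forall>t\<in>{0..1::real}. pathstart (f \<circ> Pair t) = pathstart \<gamma> \<and> pathfinish (f \<circ> Pair t) = pathfinish \<gamma>"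
    using h unfolding homotopic_paths by blast
  then have f: "continuous_on ({0..1} \<times> {0..1}) f" "f ` ({0..1} \<times> {0..1}) \<subseteq> S"
    "\<And>t. t \<in> {0..1} \<Longrightarrow> f (0, t) = \<gamma> t" "\<And>t. t \<in> {0..1} \<Longrightarrow> f (1, t) = \<delta> t"
    "\<And>s. s \<in> {0..1} \<Longrightarrow> f (s, 0) = pathstart \<gamma>" "\<And>s. s \<in> {0..1} \<Longrightarrow> f (s, 1) = pathfinish \<gamma>"
    by (auto simp: pathstart_def pathfinish_def)
  define Q where "Q = ({0..1} \<times> {0..1} :: (real \<times> real) set)"
  have "compact Q" "convex Q" "(0, 0) \<in> Q" by (auto simp: Q_def compact_Times convex_Times)
  then obtain a \<epsilon> where a: "0 < \<epsilon>" "a (0, 0) = []"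
    "\<And>x y. x \<in> Q \<Longrightarrow> y \<in> Q \<Longrightarrow> dist x y < \<epsilon> \<Longrightarrow> a y \<doteq> a x @ tau (f x) (f y)"
    using holonomy_lift[of Q "(0, 0)" f] f(1,2) unfolding Q_def by blast
  have row: "lifts \<beta> (\<lambda>t. a (c, t))" if "c \<in> {0..1}" "\<And>t. t \<in> {0..1} \<Longrightarrow> f (c, t) = \<beta> t" for c \<beta>
    unfolding lifts_def
  proof (intro exI[of _ \<epsilon>] conjI ballI impI)
    fix s t :: real assume st: "s \<in> {0..1}" "t \<in> {0..1}" "dist s t < \<epsilon>"
    have "dist (c, s) (c, t) < \<epsilon>" using st by (simp add: dist_Pair_Pair)
    then show "a (c, t) \<doteq> a (c, s) @ tau (\<beta> s) (\<beta> t)"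
      using a(3)[of "(c, s)" "(c, t)"] st that by (simp add: Q_def)
  qed (rule a(1))
  have col: "a (1, c) \<doteq> a (0, c)" if "c \<in> {0..1}" "\<And>s. s \<in> {0..1} \<Longrightarrow> f (s, c) = p" for c p
  proof (rule lifts_const[of p "\<lambda>s. a (s, c)"])
    show "lifts (\<lambda>_. p) (\<lambda>s. a (s, c))"
      unfolding lifts_def
    proof (intro exI[of _ \<epsilon>] conjI ballI impI)
      fix s t :: real assume st: "s \<in> {0..1}" "t \<in> {0..1}" "dist s t < \<epsilon>"
      have "dist (s, c) (t, c) < \<epsilon>" using st by (simp add: dist_Pair_Pair)
      then show "a (t, c) \<doteq> a (s, c) @ tau p p"
        using a(3)[of "(s, c)" "(t, c)"] st that by (simp add: Q_def)
    qed (rule a(1))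
    have "f (0, c) \<in> S" using f(2) that(1) by auto
    then show "p \<in> S" using that(2)[of 0] by simp
  qed
  have \<delta>: "path \<delta>" "path_image \<delta> \<subseteq> S" "path \<gamma>" "path_image \<gamma> \<subseteq> S"
    using homotopic_paths_imp_path[OF h] homotopic_paths_imp_subset[OF h] by auto
  have "hol \<gamma> (a (0, 1))" using lifts_hol[OF row[of 0 \<gamma>]] f \<delta> a(2) by simp
  then have "u \<doteq> a (0, 1)" using u hol_unique by blast
  also have "a (0, 1) \<doteq> a (1, 1)" using col[of 1 "pathfinish \<gamma>"] f(6) eqw_sym by auto
  also have "\<dots> \<doteq> winv (a (1, 0)) @ a (1, 1)"
  proof -
    have "a (1, 0) \<doteq> []" using col[of 0 "pathstart \<gamma>"] f(5) a(2) by auto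
    then have "winv (a (1, 0)) @ a (1, 1) \<doteq> winv [] @ a (1, 1)" by (intro eqw_append eqw_winv) auto
    then show ?thesis using eqw_sym by simp
  qed
  finally have "u \<doteq> winv (a (1, 0)) @ a (1, 1)" .
  moreover have "hol \<delta> (winv (a (1, 0)) @ a (1, 1))" using lifts_hol[OF row[of 1 \<delta>]] f \<delta> by simp
  ultimately show ?thesis using hol_eqw eqw_sym by blast
qed

text \<open>The two halves of a lift of the joined path are lifts of the two pieces.\<close>

lemma hol_join:
  assumes p: "path \<gamma>" "path_image \<gamma> \<subseteq> S" "path \<delta>" "path_image \<delta> \<subseteq> S" "pathfinish \<gamma> = pathstart \<delta>"
    and u: "hol \<gamma> u" and w: "hol \<delta> w"
  shows "hol (\<gamma> +++ \<delta>) (u @ w)"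
proof -
  have j: "path (\<gamma> +++ \<delta>)" "path_image (\<gamma> +++ \<delta>) \<subseteq> S"
    using p by (auto simp: path_image_join)
  obtain a \<epsilon> where a: "0 < \<epsilon>" "a 0 = []"
    "\<And>x y. x \<in> {0..1} \<Longrightarrow> y \<in> {0..1} \<Longrightarrow> dist x y < \<epsilon> \<Longrightarrow> a y \<doteq> a x @ tau ((\<gamma> +++ \<delta>) x) ((\<gamma> +++ \<delta>) y)"
    using holonomy_lift[of "{0..1::real}" 0 "\<gamma> +++ \<delta>"] j by (auto simp: path_def path_image_def)
  have "lifts (\<gamma> +++ \<delta>) a" unfolding lifts_def using a by blast
  from lifts_hol[OF this j] have A: "hol (\<gamma> +++ \<delta>) (a 1)" using a(2) by simp
  have g: "(\<gamma> +++ \<delta>) (t / 2) = \<gamma> t" if "t \<in> {0..1}" for t using that by (simp add: joinpaths_def)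
  have d: "(\<gamma> +++ \<delta>) (1/2 + t / 2) = \<delta> t" if "t \<in> {0..1}" for t
    using that p(5) by (auto simp: joinpaths_def pathfinish_def pathstart_def)
  have "lifts \<gamma> (\<lambda>t. a (t / 2))"
    unfolding lifts_def
  proof (intro exI[of _ \<epsilon>] conjI ballI impI)
    fix s t :: real assume st: "s \<in> {0..1}" "t \<in> {0..1}" "dist s t < \<epsilon>"
    have "dist (s/2) (t/2) \<le> dist s t" by (simp add: dist_real_def)
    then show "a (t / 2) \<doteq> a (s / 2) @ tau (\<gamma> s) (\<gamma> t)"
      using a(3)[of "s/2" "t/2"] st g[OF st(1)] g[OF st(2)] by simp
  qed (rule a(1))
  from lifts_hol[OF this p(1,2)] have U: "u \<doteq> a (1/2)" using hol_unique[OF u] a(2) by simp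
  have "lifts \<delta> (\<lambda>t. a (1/2 + t / 2))"
    unfolding lifts_def
  proof (intro exI[of _ \<epsilon>] conjI ballI impI)
    fix s t :: real assume st: "s \<in> {0..1}" "t \<in> {0..1}" "dist s t < \<epsilon>"
    have "dist (1/2 + s/2) (1/2 + t/2) \<le> dist s t" by (simp add: dist_real_def)
    then show "a (1/2 + t / 2) \<doteq> a (1/2 + s / 2) @ tau (\<delta> s) (\<delta> t)"
      using a(3)[of "1/2 + s/2" "1/2 + t/2"] st d[OF st(1)] d[OF st(2)] by simp
  qed (rule a(1))
  from lifts_hol[OF this p(3,4)] have "hol \<delta> (winv (a (1/2)) @ a 1)" by simp
  then have W: "w \<doteq> winv (a (1/2)) @ a 1" using hol_unique[OF w] by blast
  have "u @ w \<doteq> a (1/2) @ winv (a (1/2)) @ a 1" using U W by (rule eqw_append)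
  also have "\<dots> \<doteq> a 1" by (rule eqw_inv_cancel)
  finally show ?thesis using A hol_eqw eqw_sym by blast
qed

definition epath :: "((nat \<Rightarrow> real) \<Rightarrow> 'a) \<Rightarrow> real \<Rightarrow> 'a" where
  "epath e t = e (\<lambda>i. if i = 0 then t else 0)"

lemma unit_cube1: "t \<in> {0..1} \<Longrightarrow> (\<lambda>i. if i = 0 then t else 0) \<in> cube 1"
  by (auto simp: cube_def)

lemma crd_epath:
  assumes e: "e \<in> K 1" and t: "t \<in> {0..1}"
  shows "crd (epath e t) H = (if H = hyp e then frac (if snd (lab e) then t else 1 - t) else 0)"
proof -
  have "axis_edge 0 e = e"
  proof (rule extensionalityI[of _ "cube 1"])
    fix x :: "nat \<Rightarrow> real" assume x: "x \<in> cube 1"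
    then have "(\<lambda>j. if j = 0 then x 0 else 0) = x" by (auto simp: cube_def fun_eq_iff)
    then show "axis_edge 0 e x = e x" using x by (simp add: axis_edge_def)
  qed (use K_ext[OF e] in \<open>auto simp: axis_edge_def\<close>)
  then have "axl e 0 = lab e" by (simp add: axl_def)
  then show ?thesis
    using crd_eq[OF e unit_cube1[OF t], of H] by (auto simp: epath_def co_def lab_def)
qed

lemma epath_path: assumes "e \<in> K 1" shows "path (epath e)" "path_image (epath e) \<subseteq> S"
proof -
  have "continuous_on {0..1} (e \<circ> (\<lambda>t i. if i = (0::nat) then t else 0))"
  proof (rule continuous_on_compose)
    show "continuous_on {0..1} (\<lambda>t i. if i = (0::nat) then t else (0::real))"
    proof (rule continuous_on_coordinatewise_then_product)
      show "continuous_on {0..1} (\<lambda>t. if i = (0::nat) then t else (0::real))" for i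
        by (cases "i = 0") auto
    qed
    show "continuous_on ((\<lambda>t i. if i = (0::nat) then t else 0) ` {0..1}) e"
      by (rule continuous_on_subset[OF K_cont[OF assms]]) (use unit_cube1 in auto)
  qed
  then show "path (epath e)" by (simp add: path_def epath_def o_def)
  show "path_image (epath e) \<subseteq> S" using K_in_S[OF assms unit_cube1] by (auto simp: path_image_def epath_def)
qed

lemma hol_epath: assumes e: "e \<in> K 1" shows "hol (epath e) [lab e]"
proof -
  define b where "b = snd (lab e)"
  define g where "g t = (if b then t else 1 - t)" for t :: real
  \<comment> \<open>The asymmetry at the midpoint matches \<open>cross\<close>, which puts the value
    1/2 on the upper side: an edge running against the orientation has coordinate
    \<open>1 - t\<close>, which at the midpoint has not yet dropped below 1/2.\<close>
  define up where "up t = (if b then 1/2 \<le> t else 1/2 < t)" for t :: real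
  define a where "a t = (if up t then [lab e] else [])" for t
  have lab: "lab e = (hyp e, b)" by (simp add: lab_def b_def)
  have "a t \<doteq> a s @ tau (epath e s) (epath e t)"
    if st: "s \<in> {0..1}" "t \<in> {0..1}" "dist s t < 1/4" for s t
  proof -
    have S: "epath e s \<in> S" "epath e t \<in> S"
      using epath_path(2)[OF e] st by (auto simp: path_image_def)
    define c where "c = cross (frac (g s)) (frac (g t))"
    have c: "cross (crd (epath e s) H) (crd (epath e t) H) = (if H = hyp e then c else 0)" for H
      using crd_epath[OF e st(1), of H] crd_epath[OF e st(2), of H] by (auto simp: c_def g_def b_def)
    have cv: "c = (if up s = up t then 0 else if up t = b then 1 else - 1)"
    proof -
      have "frac (g s) = (if g s < 1 then g s else 0)" "frac (g t) = (if g t < 1 then g t else 0)"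
        using st by (auto simp: g_def frac_01)
      then show ?thesis using st
        by (cases b) (auto simp: c_def cross_def g_def up_def dist_real_def abs_if split: if_splits)
    qed
    show ?thesis
    proof (rule commuting_words_eqw)
      fix x y assume *: "x \<in> set (a t) \<union> set (a s @ tau (epath e s) (epath e t))"
        "y \<in> set (a t) \<union> set (a s @ tau (epath e s) (epath e t))"
      have "fst z = hyp e" if "z \<in> set (a t) \<union> set (a s @ tau (epath e s) (epath e t))" for z
        using that tau_set[OF S, of z] c[of "fst z"] by (auto simp: a_def lab split: if_splits)
      then show "fst x = fst y \<or> xing (fst x) (fst y)" using * by metis
    next
      show "esum (a t) H = esum (a s @ tau (epath e s) (epath e t)) H" for H
        using tau_esum[OF S, of H] c[of H] cv by (auto simp: a_def lab split: if_splits)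
    qed
  qed
  then have "lifts (epath e) a" unfolding lifts_def by (intro exI[of _ "1/4"]) auto
  from lifts_hol[OF this epath_path[OF e]] show ?thesis by (auto simp: a_def up_def split: if_splits)
qed

end

section \<open>Homotopies of paths in arbitrary spaces\<close>

text \<open>The groupoid laws of the library go through \<open>linepath\<close> and are restricted to
  normed spaces; here they are images of homotopies in the unit interval.\<close>

lemma homotopic_paths_convex_image:
  fixes f g :: "real \<Rightarrow> 'b::real_normed_vector"
  assumes "convex C" "continuous_on C F" "F ` C \<subseteq> U" "path f" "path g" "path_image f \<subseteq> C" "path_image g \<subseteq> C"
    "pathstart f = pathstart g" "pathfinish f = pathfinish g"
  shows "homotopic_paths U (F \<circ> f) (F \<circ> g)"
proof (rule homotopic_paths_continuous_image[OF _ assms(2)])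
  show "homotopic_paths C f g"
  proof (rule homotopic_paths_linear)
    fix t :: real assume "t \<in> {0..1}"
    then have "f t \<in> C" "g t \<in> C" using assms by (auto simp: path_image_def)
    then show "closed_segment (f t) (g t) \<subseteq> C" using assms(1) closed_segment_subset by blast
  qed (use assms in auto)
qed (use assms in auto)

lemma path_linepath_compose:
  fixes p :: "real \<Rightarrow> 'a::topological_space"
  shows "p \<circ> linepath 0 1 = p" "p \<circ> linepath 1 1 = (\<lambda>_. pathfinish p)" "p \<circ> linepath 0 0 = (\<lambda>_. pathstart p)"
    "p \<circ> linepath 1 0 = reversepath p"
  by (auto simp: linepath_def fun_eq_iff pathfinish_def pathstart_def reversepath_def)

lemma homotopic_paths_pull:
  fixes f g :: "real \<Rightarrow> real"
  assumes "path p" "path_image p \<subseteq> U" "path f" "path g" "path_image f \<subseteq> {0..1}" "path_image g \<subseteq> {0..1}"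
    "pathstart f = pathstart g" "pathfinish f = pathfinish g"
  shows "homotopic_paths U (p \<circ> f) (p \<circ> g)"
  by (rule homotopic_paths_convex_image[of "{0..1}"]) (use assms in \<open>auto simp: path_def path_image_def\<close>)

lemma path_image_linepath_01: "u \<in> {0..1} \<Longrightarrow> v \<in> {0..1} \<Longrightarrow> path_image (linepath u v) \<subseteq> {0..1::real}"
  by (simp add: closed_segment_subset)

lemma homotopic_paths_const_right:
  assumes "path p" "path_image p \<subseteq> U"
  shows "homotopic_paths U (p +++ (\<lambda>_. pathfinish p)) p"
  using homotopic_paths_pull[OF assms, of "linepath 0 1 +++ linepath 1 1" "linepath 0 1"]
  by (simp add: path_compose_join path_linepath_compose path_image_linepath_01 subset_path_image_join
      del: path_image_linepath)

lemma homotopic_paths_const_left: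
  assumes "path p" "path_image p \<subseteq> U"
  shows "homotopic_paths U ((\<lambda>_. pathstart p) +++ p) p"
  using homotopic_paths_pull[OF assms, of "linepath 0 0 +++ linepath 0 1" "linepath 0 1"]
  by (simp add: path_compose_join path_linepath_compose path_image_linepath_01 subset_path_image_join
      del: path_image_linepath)

lemma homotopic_paths_right_inverse:
  assumes "path p" "path_image p \<subseteq> U"
  shows "homotopic_paths U (p +++ reversepath p) (\<lambda>_. pathstart p)"
  using homotopic_paths_pull[OF assms, of "linepath 0 1 +++ linepath 1 0" "linepath 0 0"]
  by (simp add: path_compose_join path_linepath_compose path_image_linepath_01 subset_path_image_join
      del: path_image_linepath)

lemma homotopic_paths_left_inverse:
  assumes "path p" "path_image p \<subseteq> U"
  shows "homotopic_paths U (reversepath p +++ p) (\<lambda>_. pathfinish p)"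
  using homotopic_paths_right_inverse[of "reversepath p" U] assms by simp

lemma homotopic_paths_subpaths:
  assumes "path p" "path_image p \<subseteq> U" "u \<in> {0..1}" "v \<in> {0..1}" "w \<in> {0..1}"
  shows "homotopic_paths U (p \<circ> linepath u w) ((p \<circ> linepath u v) +++ (p \<circ> linepath v w))"
  using homotopic_paths_pull[OF assms(1,2), of "linepath u w" "linepath u v +++ linepath v w"] assms(3-)
  by (simp add: path_compose_join path_image_linepath_01 subset_path_image_join
      del: path_image_linepath)

lemma pathstart_const [simp]: "pathstart (\<lambda>_. x) = x" and pathfinish_const [simp]: "pathfinish (\<lambda>_. x) = x"
  by (auto simp: pathstart_def pathfinish_def)

lemma path_const [simp]: "path (\<lambda>_. x)"
  by (simp add: path_def)

lemma path_image_const [simp]: "path_image (\<lambda>_. x) = {x}"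
  by (auto simp: path_image_def)

section \<open>Straight lines in cubes\<close>

definition lin :: "real \<Rightarrow> (nat \<Rightarrow> real) \<Rightarrow> (nat \<Rightarrow> real) \<Rightarrow> nat \<Rightarrow> real" where
  "lin s x y = (\<lambda>i. (1 - s) * x i + s * y i)"

lemma lin_simps [simp]: "lin 0 x y = x" "lin 1 x y = y" "lin s x x = x"
  by (auto simp: lin_def algebra_simps)

lemma lin_swap: "lin (1 - s) x y = lin s y x"
  by (auto simp: lin_def)

lemma lin_cube: assumes "x \<in> cube n" "y \<in> cube n" "s \<in> {0..1}" shows "lin s x y \<in> cube n"
proof (rule cubeI)
  fix i
  have "0 \<le> (1 - s) * x i + s * y i" using assms cubeD(1)[OF assms(1), of i] cubeD(1)[OF assms(2), of i] by auto
  moreover have "(1 - s) * x i + s * y i \<le> 1"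
    by (intro convex_bound_le) (use assms cubeD(2) in auto)
  ultimately show "0 \<le> lin s x y i \<and> lin s x y i \<le> 1" by (simp add: lin_def)
  show "lin s x y i = 0" if "i \<ge> n" using that cubeD(3)[OF assms(1)] cubeD(3)[OF assms(2)] by (simp add: lin_def)
qed

lemma continuous_lin:
  assumes "continuous_on A f" "continuous_on A g" "continuous_on A s"
  shows "continuous_on A (\<lambda>x. lin (s x) (f x) (g x))"
  unfolding lin_def
proof (rule continuous_on_coordinatewise_then_product)
  fix i
  have "continuous_on A (\<lambda>x. f x i)" "continuous_on A (\<lambda>x. g x i)"
    using assms by (auto intro: continuous_on_product_then_coordinatewise)
  then show "continuous_on A (\<lambda>x. (1 - s x) * f x i + s x * g x i)"
    using assms(3) by (intro continuous_intros)
qed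

lemma path_lin: "path (\<lambda>t. lin t x y)"
  unfolding path_def by (intro continuous_lin continuous_intros)

context cubes
begin

lemma cube_path:
  assumes "\<phi> \<in> K n" "path f" "path_image f \<subseteq> cube n"
  shows "path (\<phi> \<circ> f)" "path_image (\<phi> \<circ> f) \<subseteq> S"
proof -
  show "path (\<phi> \<circ> f)"
    using assms K_cont[OF assms(1)] by (intro path_continuous_image) (auto intro: continuous_on_subset)
  show "path_image (\<phi> \<circ> f) \<subseteq> S" using assms K_in_S by (auto simp: path_image_def)
qed

lemma cube_homotopic:
  assumes \<phi>: "\<phi> \<in> K n" and f: "path f" "path_image f \<subseteq> cube n" and g: "path g" "path_image g \<subseteq> cube n"
    and ends: "pathstart f = pathstart g" "pathfinish f = pathfinish g"
  shows "homotopic_paths S (\<phi> \<circ> f) (\<phi> \<circ> g)"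
  unfolding homotopic_paths
proof (intro exI conjI ballI)
  let ?h = "\<lambda>p. \<phi> (lin (fst p) (f (snd p)) (g (snd p)))"
  have mem: "lin s (f t) (g t) \<in> cube n" if "s \<in> {0..1}" "t \<in> {0..1}" for s t
    using that f g by (intro lin_cube) (auto simp: path_image_def)
  have c: "continuous_on ({0..1} \<times> {0..1}) (\<lambda>p. lin (fst p) (f (snd p)) (g (snd p)))"
  proof (rule continuous_lin)
    show "continuous_on ({0..1} \<times> {0..1}) (\<lambda>p. f (snd p))"
      by (rule continuous_on_compose2[OF f(1)[unfolded path_def] continuous_on_snd[OF continuous_on_id]]) auto
    show "continuous_on ({0..1} \<times> {0..1}) (\<lambda>p. g (snd p))"
      by (rule continuous_on_compose2[OF g(1)[unfolded path_def] continuous_on_snd[OF continuous_on_id]]) auto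
  qed (intro continuous_intros)
  show "continuous_on ({0..1} \<times> {0..1}) ?h"
    by (rule continuous_on_compose2[OF K_cont[OF \<phi>] c]) (use mem in auto)
  show "?h \<in> {0..1} \<times> {0..1} \<rightarrow> S" using mem K_in_S[OF \<phi>] by auto
  fix t :: real assume "t \<in> {0..1}"
  show "?h (0, t) = (\<phi> \<circ> f) t" "?h (1, t) = (\<phi> \<circ> g) t" by auto
  show "pathstart (?h \<circ> Pair t) = pathstart (\<phi> \<circ> f)" "pathfinish (?h \<circ> Pair t) = pathfinish (\<phi> \<circ> f)"
    using ends by (auto simp: pathstart_def pathfinish_def)
qed

end

context special_complex
begin

section \<open>Contractible neighbourhoods\<close>

lemma eps_ex: assumes "x \<in> S" shows "\<exists>\<epsilon>. 0 < \<epsilon> \<and> \<epsilon> \<le> 1/8 \<and> (\<forall>H\<in>supp x. \<epsilon> \<le> crd x H \<and> crd x H \<le> 1 - \<epsilon>)"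
proof -
  have "\<exists>\<epsilon>. 0 < \<epsilon> \<and> \<epsilon> \<le> 1/8 \<and> (\<forall>H\<in>A. \<epsilon> \<le> crd x H \<and> crd x H \<le> 1 - \<epsilon>)" if "finite A" "A \<subseteq> supp x" for A
    using that
  proof (induction A rule: finite_induct)
    case (insert H A)
    then obtain \<epsilon> where \<epsilon>: "0 < \<epsilon>" "\<epsilon> \<le> 1/8" "\<forall>H\<in>A. \<epsilon> \<le> crd x H \<and> crd x H \<le> 1 - \<epsilon>" by auto
    have "0 < crd x H" "crd x H < 1"
      using crd_range[OF assms, of H] insert.prems by (auto simp: supp_def less_le)
    then show ?case using \<epsilon> by (intro exI[of _ "min \<epsilon> (min (crd x H) (1 - crd x H))"]) (auto simp: min_def)
  qed (auto intro: exI[of _ "1/8"])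
  then show ?thesis using supp_finite[OF assms] by blast
qed

definition eps :: "'a \<Rightarrow> real" where
  "eps x = (SOME \<epsilon>. 0 < \<epsilon> \<and> \<epsilon> \<le> 1/8 \<and> (\<forall>H\<in>supp x. \<epsilon> \<le> crd x H \<and> crd x H \<le> 1 - \<epsilon>))"

lemma eps: assumes "x \<in> S" shows "0 < eps x" "eps x \<le> 1/8" "H \<in> supp x \<Longrightarrow> eps x \<le> crd x H \<and> crd x H \<le> 1 - eps x"
  using someI_ex[OF eps_ex[OF assms]] unfolding eps_def by blast+

text \<open>\<open>dat x n \<phi> a a0\<close>: the point \<open>\<phi> a\<close> lies near \<open>x = \<phi> a0\<close> inside a common cube. The radius
  \<open>eps x\<close> is so small that \<open>\<phi> a\<close> stays in cells having the cell of \<open>x\<close> as a face.\<close>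

definition dat :: "'a \<Rightarrow> nat \<Rightarrow> ((nat \<Rightarrow> real) \<Rightarrow> 'a) \<Rightarrow> (nat \<Rightarrow> real) \<Rightarrow> (nat \<Rightarrow> real) \<Rightarrow> bool" where
  "dat x n \<phi> a a0 \<longleftrightarrow> \<phi> \<in> K n \<and> a \<in> cube n \<and> a0 \<in> cube n \<and> \<phi> a0 = x \<and> (\<forall>i<n. \<bar>a i - a0 i\<bar> < eps x)"

lemma dat_S: "dat x n \<phi> a a0 \<Longrightarrow> x \<in> S"
  unfolding dat_def using K_in_S by blast

lemma crd_label:
  assumes "\<phi> \<in> K n" "a \<in> cube n" "i < n"
  shows "crd (\<phi> a) (fst (axl \<phi> i)) = frac (if snd (axl \<phi> i) then a i else 1 - a i)"
  using crd_eq[OF assms(1,2)] co_label[OF assms(1,3)] by simp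

text \<open>If \<open>a0 i\<close> lay strictly between 0 and 1, its hyperplane would belong to
  \<open>supp x\<close>, and \<open>a0 i\<close> would be at least \<open>eps x\<close> away from 0
  and 1, hence from \<open>a i\<close>.\<close>

lemma dat_frozen: assumes d: "dat x n \<phi> a a0" and i: "i < n" "a i \<in> {0, 1}" shows "a0 i = a i"
proof -
  have K: "\<phi> \<in> K n" "a0 \<in> cube n" "\<phi> a0 = x" "\<bar>a i - a0 i\<bar> < eps x" using d i by (auto simp: dat_def)
  note e = eps[OF dat_S[OF d]]
  have c: "crd x (fst (axl \<phi> i)) = frac (if snd (axl \<phi> i) then a0 i else 1 - a0 i)"
    using crd_label[OF K(1,2) i(1)] K(3) by simp
  have "\<not> (0 < a0 i \<and> a0 i < 1)"
  proof
    assume r: "0 < a0 i \<and> a0 i < 1"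
    then have c': "crd x (fst (axl \<phi> i)) = (if snd (axl \<phi> i) then a0 i else 1 - a0 i)"
      using c by (simp add: frac_01)
    then have "fst (axl \<phi> i) \<in> supp x" using r by (auto simp: supp_def)
    then show False using e(3)[of "fst (axl \<phi> i)"] c' K(4) i(2) by (auto split: if_splits)
  qed
  then have "a0 i \<in> {0, 1}" using cubeD(1,2)[OF K(2), of i] by auto
  then show ?thesis using K(4) e(2) i(2) by auto
qed

text \<open>Both cubes have the face whose interior holds the point. Coordinates frozen at
  \<open>a\<close> are frozen at \<open>a0\<close> by \<open>dat_frozen\<close>, so the segment from
  \<open>a\<close> to \<open>a0\<close> runs inside this face and is seen from either cube.\<close>

lemma dat_transfer:
  assumes d: "dat x n \<phi> a a0" and \<psi>: "\<psi> \<in> K m" "z \<in> cube m" "\<phi> a = \<psi> z"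
  shows "\<exists>z0. dat x m \<psi> z z0 \<and> (\<forall>s\<in>{0..1}. \<psi> (lin s z z0) = \<phi> (lin s a a0))"
proof -
  have K: "\<phi> \<in> K n" "a \<in> cube n" "a0 \<in> cube n" "\<phi> a0 = x" "\<And>i. i < n \<Longrightarrow> \<bar>a i - a0 i\<bar> < eps x"
    using d by (auto simp: dat_def)
  obtain J \<kappa> J' \<kappa>' A k y where f:
    "J = {i. i < n \<and> 0 < a i \<and> a i < 1}" "bij_betw \<kappa> J {..<k}" "\<forall>i<n. i \<notin> J \<longrightarrow> a i \<in> {0, 1}"
    "J' = {i. i < m \<and> 0 < z i \<and> z i < 1}" "bij_betw \<kappa>' J' {..<k}" "\<forall>i<m. i \<notin> J' \<longrightarrow> z i \<in> {0, 1}"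
    "y \<in> open_cube k" "aff n J \<kappa> {} a y = a" "aff m J' \<kappa>' A z y = z"
    "\<forall>u\<in>cube k. \<phi> (aff n J \<kappa> {} a u) = \<psi> (aff m J' \<kappa>' A z u)"
    by (rule common_face[OF K(1) \<psi>(1) K(2) \<psi>(2,3)])
  define y0 where "y0 j = (if j < k then a0 (inv_into J \<kappa> j) else 0)" for j
  have inv: "inv_into J \<kappa> (\<kappa> i) = i" if "i \<in> J" for i
    using f(2) that by (simp add: bij_betw_inv_into_left)
  have invJ: "inv_into J \<kappa> j \<in> J" "\<kappa> (inv_into J \<kappa> j) = j" if "j < k" for j
    using that f(2) by (metis bij_betw_def inv_into_into lessThan_iff, metis bij_betw_inv_into_right f(2) lessThan_iff that)
  have \<kappa>: "\<kappa> i < k" if "i \<in> J" for i using f(2) that bij_betwE by blast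
  have yk: "y \<in> cube k" using f(7) open_cube_subset by blast
  have y0: "y0 \<in> cube k" using cubeD[OF K(3)] by (auto intro!: cubeI simp: y0_def)
  have a0: "aff n J \<kappa> {} a y0 = a0"
  proof
    fix i
    show "aff n J \<kappa> {} a y0 i = a0 i"
      using f(3) dat_frozen[OF d, of i] cubeD(3)[OF K(3), of i] inv \<kappa> by (auto simp: aff_def y0_def)
  qed
  define z0 where "z0 = aff m J' \<kappa>' A z y0"
  have z0: "z0 \<in> cube m" unfolding z0_def using f(6) by (intro aff_cube[OF y0]) fastforce
  have "\<psi> z0 = x" using f(10) y0 a0 K(4) by (metis z0_def)
  moreover have "\<bar>z i - z0 i\<bar> < eps x" if i: "i < m" for i
  proof (cases "i \<in> J'")
    case False
    then have "z0 i = z i" using i by (simp add: z0_def aff_def)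
    then show ?thesis using eps(1)[OF dat_S[OF d]] by simp
  next
    case True
    define j where "j = \<kappa>' i"
    have j: "j < k" using True f(5) bij_betwE j_def by blast
    define l where "l = inv_into J \<kappa> j"
    have l: "l \<in> J" "\<kappa> l = j" "l < n" using invJ[OF j] f(1) by (auto simp: l_def)
    have "y j = a l" using fun_cong[OF f(8), of l] l by (simp add: aff_def)
    moreover have "y0 j = a0 l" using j by (simp add: y0_def l_def)
    moreover have "z i = (if i \<in> A then 1 - y j else y j)" using fun_cong[OF f(9), of i] True i by (auto simp: aff_def j_def)
    moreover have "z0 i = (if i \<in> A then 1 - y0 j else y0 j)" using True i by (simp add: z0_def aff_def j_def)
    ultimately show ?thesis using K(5)[OF l(3)] by (auto simp: abs_minus_commute)
  qed
  ultimately have "dat x m \<psi> z z0" using \<psi> z0 by (simp add: dat_def)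
  moreover have "\<psi> (lin s z z0) = \<phi> (lin s a a0)" if s: "s \<in> {0..1}" for s
  proof -
    have "lin s y y0 \<in> cube k" using yk y0 s by (rule lin_cube)
    then have "\<phi> (aff n J \<kappa> {} a (lin s y y0)) = \<psi> (aff m J' \<kappa>' A z (lin s y y0))" using f(10) by blast
    then show ?thesis unfolding lin_def aff_convex f(8,9) a0 z0_def by simp
  qed
  ultimately show ?thesis by blast
qed

text \<open>The point \<open>x\<close> determines its coordinates in the cube modulo 1, and nearness
  to \<open>z\<close> decides between 0 and 1.\<close>

lemma dat_unique: assumes "dat x m \<psi> z z0" "dat x m \<psi> z z1" shows "z0 = z1"
proof
  fix i
  have K: "\<psi> \<in> K m" "z0 \<in> cube m" "z1 \<in> cube m" "\<psi> z0 = x" "\<psi> z1 = x" using assms by (auto simp: dat_def)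
  show "z0 i = z1 i"
  proof (cases "i < m")
    case True
    have "frac (if snd (axl \<psi> i) then z0 i else 1 - z0 i) = frac (if snd (axl \<psi> i) then z1 i else 1 - z1 i)"
      using crd_label[OF K(1,2) True] crd_label[OF K(1,3) True] K(4,5) by simp
    moreover have "\<bar>z i - z0 i\<bar> < 1/8" "\<bar>z i - z1 i\<bar> < 1/8"
      using assms True eps(2)[OF dat_S[OF assms(1)]] by (auto simp: dat_def intro: less_le_trans)
    ultimately show ?thesis using cubeD(1,2)[OF K(2), of i] cubeD(1,2)[OF K(3), of i]
      by (auto simp: frac_01 split: if_splits)
  next
    case False
    then show ?thesis using cubeD(3)[OF K(2)] cubeD(3)[OF K(3)] by simp
  qed
qed

definition star :: "'a \<Rightarrow> 'a set" where
  "star x = {y. \<exists>n \<phi> a a0. dat x n \<phi> a a0 \<and> \<phi> a = y}"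

text \<open>The straight contraction towards \<open>x\<close>; \<open>dat_transfer\<close> and
  \<open>dat_unique\<close> make it independent of the chosen cube.\<close>

definition ctr :: "'a \<Rightarrow> 'a \<Rightarrow> real \<Rightarrow> 'a" where
  "ctr x y s = (SOME p. \<exists>n \<phi> a a0. dat x n \<phi> a a0 \<and> \<phi> a = y \<and> p = \<phi> (lin s a a0))"

lemma ctr_eq: assumes d: "dat x n \<phi> a a0" and s: "s \<in> {0..1}" shows "ctr x (\<phi> a) s = \<phi> (lin s a a0)"
  unfolding ctr_def
proof (rule some_equality)
  fix p assume "\<exists>m \<psi> z z0. dat x m \<psi> z z0 \<and> \<psi> z = \<phi> a \<and> p = \<psi> (lin s z z0)"
  then obtain m \<psi> z z1 where z: "dat x m \<psi> z z1" "\<psi> z = \<phi> a" "p = \<psi> (lin s z z1)" by blast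
  then have "\<psi> \<in> K m" "z \<in> cube m" by (auto simp: dat_def)
  then obtain z0 where "dat x m \<psi> z z0" "\<psi> (lin s z z0) = \<phi> (lin s a a0)"
    using dat_transfer[OF d] z(2) s by metis
  then show "p = \<phi> (lin s a a0)" using dat_unique z by metis
qed (use d in blast)

lemma star_S: "star x \<subseteq> S"
  unfolding star_def dat_def using K_in_S by blast

lemma star_self: assumes "x \<in> S" shows "x \<in> star x"
proof -
  obtain n \<phi> a where a: "\<phi> \<in> K n" "a \<in> open_cube n" "\<phi> a = x" using S_rep[OF assms] .
  then have "dat x n \<phi> a a" using open_cube_subset eps(1)[OF assms] by (auto simp: dat_def)
  then show ?thesis unfolding star_def using a by blast
qed

lemma star_rep:
  assumes "\<phi> \<in> K n" "a \<in> cube n" "\<phi> a \<in> star x"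
  shows "\<exists>a0. dat x n \<phi> a a0"
  using assms dat_transfer unfolding star_def by (smt (verit) mem_Collect_eq)

text \<open>The weak topology tests sets of points, not sets of pairs of a point and a time. Joint
  continuity of \<open>ctr\<close> is therefore prepared by a statement on a whole compact set
  \<open>T\<close> of times, obtained in each cube from the tube lemma. Empty \<open>T\<close> gives
  the openness of the star.\<close>

lemma star_open_gen:
  assumes W: "openin (top_of_set S) W" and T: "compact T" "T \<subseteq> {0..1}"
  shows "openin (top_of_set S) {y \<in> star x. \<forall>s\<in>T. ctr x y s \<in> W}"
proof (rule weak_open)
  show "{y \<in> star x. \<forall>s\<in>T. ctr x y s \<in> W} \<subseteq> S" using star_S by blast
  fix n \<phi> assume \<phi>: "\<phi> \<in> K n"
  define P where "P = {a0 \<in> cube n. \<phi> a0 = x}"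
  define B where "B a0 = (\<Inter>i\<in>{..<n}. {a::nat \<Rightarrow> real. \<bar>a i - a0 i\<bar> < eps x})" for a0 :: "nat \<Rightarrow> real"
  define R where "R a0 = {a \<in> cube n. \<forall>s\<in>T. \<phi> (lin s a a0) \<in> W}" for a0
  have dat: "dat x n \<phi> a a0 \<longleftrightarrow> a0 \<in> P \<and> a \<in> cube n \<and> a \<in> B a0" for a a0
    using \<phi> by (auto simp: dat_def P_def B_def)
  have eq: "{a \<in> cube n. \<phi> a \<in> {y \<in> star x. \<forall>s\<in>T. ctr x y s \<in> W}} = (\<Union>a0\<in>P. (cube n \<inter> B a0) \<inter> R a0)"
  proof (rule Set.set_eqI, rule iffI)
    fix a assume a: "a \<in> {a \<in> cube n. \<phi> a \<in> {y \<in> star x. \<forall>s\<in>T. ctr x y s \<in> W}}"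
    then obtain a0 where a0: "dat x n \<phi> a a0" using star_rep[OF \<phi>, of a x] by blast
    have "a \<in> R a0" using a ctr_eq[OF a0] T(2) by (auto simp: R_def subset_iff)
    then show "a \<in> (\<Union>a0\<in>P. (cube n \<inter> B a0) \<inter> R a0)" using a0 dat by blast
  next
    fix a assume "a \<in> (\<Union>a0\<in>P. (cube n \<inter> B a0) \<inter> R a0)"
    then obtain a0 where a0: "dat x n \<phi> a a0" "a \<in> R a0" "a \<in> cube n" using dat by blast
    then have "\<phi> a \<in> star x" unfolding star_def by blast
    moreover have "ctr x (\<phi> a) s \<in> W" if "s \<in> T" for s
      using ctr_eq[OF a0(1), of s] a0(2) that T(2) by (auto simp: R_def)
    ultimately show "a \<in> {a \<in> cube n. \<phi> a \<in> {y \<in> star x. \<forall>s\<in>T. ctr x y s \<in> W}}" using a0(3) by blast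
  qed
  have "openin (top_of_set (cube n)) ((cube n \<inter> B a0) \<inter> R a0)" if a0: "a0 \<in> P" for a0
  proof (rule openin_Int)
    have "open {a::nat \<Rightarrow> real. \<bar>a i - a0 i\<bar> < eps x}" for i
    proof (rule open_Collect_less)
      have "continuous_on UNIV (\<lambda>x::nat \<Rightarrow> real. x i)" by (rule continuous_on_product_coordinates)
      then show "continuous_on UNIV (\<lambda>a::nat \<Rightarrow> real. \<bar>a i - a0 i\<bar>)" by (intro continuous_intros)
    qed simp
    then have "open (B a0)" unfolding B_def by (intro open_INT) auto
    then show "openin (top_of_set (cube n)) (cube n \<inter> B a0)" by (auto simp: openin_open)
    have a0c: "a0 \<in> cube n" using a0 P_def by blast
    define g where "g p = \<phi> (lin (snd p) (fst p) a0)" for p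
    have lm: "lin (snd p) (fst p) a0 \<in> cube n" if "p \<in> cube n \<times> T" for p
      using that a0c T by (intro lin_cube) auto
    have "continuous_on (cube n \<times> T) g"
      unfolding g_def
    proof (rule continuous_on_compose2[OF K_cont[OF \<phi>]])
      show "continuous_on (cube n \<times> T) (\<lambda>p. lin (snd p) (fst p) a0)"
        by (intro continuous_lin continuous_intros)
    qed (use lm in auto)
    moreover have "g ` (cube n \<times> T) \<subseteq> S" using lm K_in_S[OF \<phi>] by (auto simp: g_def)
    ultimately have "openin (top_of_set (cube n \<times> T)) ((cube n \<times> T) \<inter> g -` W)"
      using W by (intro continuous_openin_preimage[of _ _ S]) auto
    then obtain O' where O': "open O'" "(cube n \<times> T) \<inter> g -` W = (cube n \<times> T) \<inter> O'" by (auto simp: openin_open)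
    show "openin (top_of_set (cube n)) (R a0)"
      unfolding openin_subopen[of _ "R a0"]
    proof
      fix a assume a: "a \<in> R a0"
      then have ac: "a \<in> cube n" by (simp add: R_def)
      have "{a} \<times> T \<subseteq> O'" using a O'(2) by (auto simp: R_def g_def)
      then obtain X0 where X0: "a \<in> X0" "open X0" "X0 \<times> T \<subseteq> O'" using Elementary_Topology.tube_lemma[OF T(1) O'(1)] by blast
      have "cube n \<inter> X0 \<subseteq> R a0"
      proof
        fix b assume b: "b \<in> cube n \<inter> X0"
        have "g (b, s) \<in> W" if "s \<in> T" for s using b that X0(3) O'(2) by blast
        then show "b \<in> R a0" using b by (simp add: R_def g_def)
      qed
      then show "\<exists>U. openin (top_of_set (cube n)) U \<and> a \<in> U \<and> U \<subseteq> R a0"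
        using X0 ac by (intro exI[of _ "cube n \<inter> X0"]) (auto simp: openin_open)
    qed
  qed
  then show "openin (top_of_set (cube n)) {a \<in> cube n. \<phi> a \<in> {y \<in> star x. \<forall>s\<in>T. ctr x y s \<in> W}}"
    unfolding eq by blast
qed

lemma star_open: "openin (top_of_set S) (star x)"
  using star_open_gen[of S "{}" x] by simp

lemma ctr_line: assumes "y \<in> star x"
  obtains n \<phi> a a0 where "\<phi> \<in> K n" "a \<in> cube n" "a0 \<in> cube n" "\<phi> a = y" "\<phi> a0 = x"
    "\<And>s. s \<in> {0..1} \<Longrightarrow> ctr x y s = \<phi> (lin s a a0)"
proof -
  obtain n \<phi> a a0 where d: "dat x n \<phi> a a0" "\<phi> a = y" using assms star_def by auto
  then show ?thesis using ctr_eq[OF d(1)] by (intro that[of \<phi> n a a0]) (auto simp: dat_def)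
qed

lemma ctr_continuous: "continuous_on (star x \<times> {0..1}) (\<lambda>p. ctr x (fst p) (snd p))"
  unfolding continuous_on_topological
proof (intro ballI allI impI)
  fix p B assume p: "p \<in> star x \<times> {0..1::real}" and B: "open B" "ctr x (fst p) (snd p) \<in> B"
  define y s0 where "y = fst p" and "s0 = snd p"
  have y: "y \<in> star x" and s0: "s0 \<in> {0..1}" using p by (auto simp: y_def s0_def)
  obtain n \<phi> a a0 where l: "\<phi> \<in> K n" "a \<in> cube n" "a0 \<in> cube n" "\<phi> a = y" "\<phi> a0 = x"
    "\<And>s. s \<in> {0..1} \<Longrightarrow> ctr x y s = \<phi> (lin s a a0)" using ctr_line[OF y] by metis
  have cS: "ctr x w s \<in> S" if w: "w \<in> star x" "s \<in> {0..1}" for w s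
    using ctr_line[OF w(1)] lin_cube K_in_S w(2) by metis
  have "continuous_on {0..1} (\<lambda>s. \<phi> (lin s a a0))"
  proof (rule continuous_on_compose2[OF K_cont[OF l(1)]])
    show "continuous_on {0..1} (\<lambda>s. lin s a a0)" by (intro continuous_lin continuous_intros)
  qed (use lin_cube l in auto)
  then have "openin (top_of_set {0..1}) ({0..1} \<inter> (\<lambda>s. \<phi> (lin s a a0)) -` B)"
    using B(1) by (rule continuous_openin_preimage_gen)
  moreover have "s0 \<in> {0..1} \<inter> (\<lambda>s. \<phi> (lin s a a0)) -` B"
    using s0 B(2) l(6)[OF s0] by (simp add: y_def s0_def)
  ultimately obtain \<delta> where \<delta>: "\<delta> > 0" "\<And>s. s \<in> {0..1} \<Longrightarrow> dist s s0 < \<delta> \<Longrightarrow> \<phi> (lin s a a0) \<in> B"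
    unfolding openin_euclidean_subtopology_iff by blast
  \<comment> \<open>A closed interval of times around \<open>s0\<close>, compact as
    \<open>star_open_gen\<close> requires.\<close>
  define T where "T = {0..1} \<inter> cball s0 (\<delta> / 2)"
  have T: "compact T" "T \<subseteq> {0..1}" by (auto simp: T_def compact_Int)
  define N where "N = {w \<in> star x. \<forall>s\<in>T. ctr x w s \<in> S \<inter> B}"
  have "openin (top_of_set S) N"
    unfolding N_def using T B(1) by (intro star_open_gen) auto
  then obtain N' where N': "open N'" "N = S \<inter> N'" by (auto simp: openin_open)
  have "y \<in> N" unfolding N_def
  proof (intro CollectI conjI ballI y)
    fix s assume "s \<in> T"
    then have s: "s \<in> {0..1}" "dist s s0 < \<delta>" using \<delta>(1) by (auto simp: T_def dist_commute)
    then show "ctr x y s \<in> S \<inter> B" using \<delta>(2)[OF s] l(6)[OF s(1)] cS[OF y s(1)] by simp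
  qed
  show "\<exists>A. open A \<and> p \<in> A \<and> (\<forall>q\<in>star x \<times> {0..1}. q \<in> A \<longrightarrow> ctr x (fst q) (snd q) \<in> B)"
  proof (intro exI[of _ "N' \<times> ball s0 (\<delta> / 2)"] conjI ballI impI)
    show "open (N' \<times> ball s0 (\<delta> / 2))" using N' by (intro open_Times) auto
    show "p \<in> N' \<times> ball s0 (\<delta> / 2)" using \<open>y \<in> N\<close> N' \<delta> by (cases p) (auto simp: y_def s0_def)
    fix q assume q: "q \<in> star x \<times> {0..1}" "q \<in> N' \<times> ball s0 (\<delta> / 2)"
    then have "fst q \<in> star x" "fst q \<in> N'" "snd q \<in> T" by (auto simp: T_def)
    then have "fst q \<in> N" "snd q \<in> T" using N'(2) star_S by blast+
    then show "ctr x (fst q) (snd q) \<in> B" by (auto simp: N_def)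
  qed
qed

text \<open>Contracting the path sweeps out a square. One side is the path itself, the opposite side
  is constant at \<open>x\<close>, and the path is pushed across to the other three sides.\<close>

lemma star_path:
  assumes \<delta>: "path \<delta>" "path_image \<delta> \<subseteq> star x"
  shows "homotopic_paths S \<delta> (ctr x (\<delta> 0) +++ (\<lambda>s. ctr x (\<delta> 1) (1 - s)))"
proof -
  define Q where "Q = ({0..1} \<times> {0..1} :: (real \<times> real) set)"
  define F where "F p = ctr x (\<delta> (fst p)) (snd p)" for p
  have mem: "\<delta> t \<in> star x" if "t \<in> {0..1}" for t using that \<delta>(2) by (auto simp: path_image_def)
  have F: "continuous_on Q F"
  proof -
    have "continuous_on Q (\<lambda>p. \<delta> (fst p))"
      by (rule continuous_on_compose2[OF \<delta>(1)[unfolded path_def] continuous_on_fst[OF continuous_on_id]]) (auto simp: Q_def)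
    then have 1: "continuous_on Q (\<lambda>p. (\<delta> (fst p), snd p))"
      by (intro continuous_on_Pair continuous_on_snd continuous_on_id)
    have 2: "(\<lambda>p. (\<delta> (fst p), snd p)) ` Q \<subseteq> star x \<times> {0..1}" using mem by (auto simp: Q_def)
    have "F = (\<lambda>p. ctr x (fst p) (snd p)) \<circ> (\<lambda>p. (\<delta> (fst p), snd p))" by (simp add: F_def fun_eq_iff)
    then show ?thesis
      using continuous_on_compose[OF 1 continuous_on_subset[OF ctr_continuous 2]] by simp
  qed
  have FS: "F ` Q \<subseteq> S"
  proof
    fix w assume "w \<in> F ` Q"
    then obtain t s where ts: "w = ctr x (\<delta> t) s" "t \<in> {0..1}" "s \<in> {0..1}" by (auto simp: F_def Q_def)
    then show "w \<in> S" using ctr_line[OF mem[OF ts(2)]] lin_cube K_in_S by metis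
  qed
  define f where "f = linepath (0 :: real, 0 :: real) (1, 0)"
  define g where "g = linepath (0 :: real, 0 :: real) (0, 1) +++ linepath (0, 1) (1, 1) +++ linepath (1, 1) (1, 0)"
  have cQ: "convex Q" by (simp add: Q_def convex_Times)
  have h1: "homotopic_paths S (F \<circ> f) (F \<circ> g)"
  proof (rule homotopic_paths_convex_image[OF cQ F FS])
    have seg: "closed_segment a b \<subseteq> Q" if "a \<in> Q" "b \<in> Q" for a b
      using that cQ closed_segment_subset by blast
    show "path_image f \<subseteq> Q" using seg by (simp add: f_def Q_def)
    show "path_image g \<subseteq> Q" unfolding g_def using seg
      by (intro subset_path_image_join) (simp_all add: Q_def)
  qed (auto simp: f_def g_def)
  have "F \<circ> f = (\<lambda>t. ctr x (\<delta> t) 0)" by (auto simp: F_def f_def linepath_def)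
  moreover have c0: "ctr x (\<delta> t) 0 = \<delta> t" if "t \<in> {0..1}" for t
    using ctr_line[OF mem[OF that]] by (metis atLeastAtMost_iff lin_simps(1) order_refl zero_le_one)
  moreover have c1: "ctr x (\<delta> t) 1 = x" if "t \<in> {0..1}" for t
    using ctr_line[OF mem[OF that]] by (metis atLeastAtMost_iff lin_simps(2) order_refl zero_le_one)
  ultimately have h0: "homotopic_paths S \<delta> (F \<circ> f)"
    using \<delta>(1) order_trans[OF \<delta>(2) star_S] by (intro homotopic_paths_eq) auto
  have g: "F \<circ> g = ctr x (\<delta> 0) +++ (F \<circ> linepath (0, 1) (1, 1)) +++ (\<lambda>s. ctr x (\<delta> 1) (1 - s))"
    by (simp add: g_def path_compose_join) (simp add: F_def linepath_def o_def)
  define r where "r = (\<lambda>s. ctr x (\<delta> 1) (1 - s))"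
  have pg: "path (F \<circ> g)" "path_image (F \<circ> g) \<subseteq> S"
    using homotopic_paths_imp_path[OF h1] homotopic_paths_imp_subset[OF h1] by auto
  have e: "pathfinish (ctr x (\<delta> 0)) = x" "pathstart r = x"
    using c1[of 0] c1[of 1] by (auto simp: pathfinish_def pathstart_def r_def)
  have fl: "F (linepath (0, 1) (1, 1) t) = x" if "t \<in> {0..1}" for t
    using c1[OF that] by (simp add: F_def linepath_def)
  have cont: "path (ctr x (\<delta> 0))" "path_image (ctr x (\<delta> 0)) \<subseteq> S" "path r" "path_image r \<subseteq> S"
  proof -
    have F0: "ctr x (\<delta> 0) = F \<circ> linepath (0, 0) (0, 1)" and F1: "r = F \<circ> linepath (1, 1) (1, 0)"
      by (auto simp: F_def linepath_def r_def)
    have seg: "closed_segment a b \<subseteq> Q" if "a \<in> Q" "b \<in> Q" for a b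
      using that cQ closed_segment_subset by blast
    have *: "path (F \<circ> linepath a b)" "path_image (F \<circ> linepath a b) \<subseteq> S" if "a \<in> Q" "b \<in> Q" for a b
    proof -
      show "path (F \<circ> linepath a b)"
        using seg[OF that] F by (intro path_continuous_image) (auto intro: continuous_on_subset)
      show "path_image (F \<circ> linepath a b) \<subseteq> S"
        using seg[OF that] FS by (auto simp: path_image_compose)
    qed
    show "path (ctr x (\<delta> 0))" "path_image (ctr x (\<delta> 0)) \<subseteq> S" "path r" "path_image r \<subseteq> S"
      unfolding F0 F1 by (rule *; simp add: Q_def)+
  qed
  have x: "x \<in> S" using cont(3,4) e(2) pathstart_in_path_image by blast
  have hc: "homotopic_paths S (F \<circ> linepath (0, 1) (1, 1)) (\<lambda>_. x)"
    using x fl by (intro homotopic_paths_sym[OF homotopic_paths_eq]) auto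
  have "homotopic_paths S ((F \<circ> linepath (0, 1) (1, 1)) +++ r) ((\<lambda>_. x) +++ r)"
    using cont hc e by (intro homotopic_paths_join) (auto simp: pathfinish_compose F_def c1)
  also have "homotopic_paths S ((\<lambda>_. x) +++ r) r"
    using homotopic_paths_const_left[OF cont(3,4)] e by simp
  finally have "homotopic_paths S (F \<circ> g) (ctr x (\<delta> 0) +++ r)"
    unfolding g r_def[symmetric] using cont e
    by (intro homotopic_paths_join) (auto simp: pathstart_join pathstart_compose F_def c1)
  then show ?thesis using h0 h1 homotopic_paths_trans unfolding r_def by blast
qed

section \<open>Edge paths\<close>

fun chain :: "'a \<Rightarrow> ((nat \<Rightarrow> real) \<Rightarrow> 'a) list \<Rightarrow> 'a \<Rightarrow> bool" where
  "chain u [] w \<longleftrightarrow> u = w \<and> u \<in> S"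
| "chain u (e # es) w \<longleftrightarrow> e \<in> K 1 \<and> epath e 0 = u \<and> chain (epath e 1) es w"

fun gpath :: "'a \<Rightarrow> ((nat \<Rightarrow> real) \<Rightarrow> 'a) list \<Rightarrow> real \<Rightarrow> 'a" where
  "gpath u [] = (\<lambda>_. u)"
| "gpath u (e # es) = epath e +++ gpath (epath e 1) es"

lemma epath_ends [simp]: "pathstart (epath e) = epath e 0" "pathfinish (epath e) = epath e 1"
  by (auto simp: pathstart_def pathfinish_def)

lemma epath_S: "e \<in> K 1 \<Longrightarrow> t \<in> {0..1} \<Longrightarrow> epath e t \<in> S"
  using epath_path(2)[of e] by (auto simp: path_image_def)

lemma gpath_path:
  assumes "chain u es w"
  shows "path (gpath u es)" "path_image (gpath u es) \<subseteq> S" "pathstart (gpath u es) = u" "pathfinish (gpath u es) = w"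
proof -
  have "path (gpath u es) \<and> path_image (gpath u es) \<subseteq> S \<and> pathstart (gpath u es) = u \<and> pathfinish (gpath u es) = w"
    using assms
  proof (induction es arbitrary: u)
    case (Cons e es)
    then have "e \<in> K 1" "epath e 0 = u" and "path (gpath (epath e 1) es)" "path_image (gpath (epath e 1) es) \<subseteq> S"
      "pathstart (gpath (epath e 1) es) = epath e 1" "pathfinish (gpath (epath e 1) es) = w" by simp_all
    then show ?case using epath_path[of e] by (simp add: path_join_imp subset_path_image_join)
  qed simp
  then show "path (gpath u es)" "path_image (gpath u es) \<subseteq> S" "pathstart (gpath u es) = u" "pathfinish (gpath u es) = w"
    by auto
qed

lemma chain_append: "chain u (es @ fs) w \<longleftrightarrow> (\<exists>v. chain u es v \<and> chain v fs w)"
proof (induction es arbitrary: u)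
  case Nil
  have "chain u fs w \<Longrightarrow> u \<in> S"
    using epath_S[of _ 0] by (cases fs) auto
  then show ?case by auto
qed auto

lemma gpath_append:
  assumes "chain u es v" "chain v fs w"
  shows "homotopic_paths S (gpath u (es @ fs)) (gpath u es +++ gpath v fs)"
  using assms(1)
proof (induction es arbitrary: u)
  case Nil
  then show ?case
    using homotopic_paths_const_left[OF gpath_path(1,2)[OF assms(2)]] gpath_path(3)[OF assms(2)] homotopic_paths_sym by auto
next
  case (Cons e es)
  have e: "e \<in> K 1" and c: "chain (epath e 1) es v" using Cons.prems by auto
  note g = gpath_path[OF c] and f = gpath_path[OF assms(2)]
  have "homotopic_paths S (gpath u ((e # es) @ fs)) (epath e +++ (gpath (epath e 1) es +++ gpath v fs))"
  proof -
    have "chain (epath e 1) (es @ fs) w" using c assms(2) chain_append by blast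
    then show ?thesis using Cons.IH[OF c] epath_path[OF e] gpath_path(3) by (simp add: homotopic_paths_join)
  qed
  also have "homotopic_paths S (epath e +++ (gpath (epath e 1) es +++ gpath v fs)) (gpath u (e # es) +++ gpath v fs)"
    using homotopic_paths_assoc[OF epath_path[OF e] g(1,2) f(1,2)] g f by simp
  finally show ?case .
qed

lemma hol_gpath: "chain u es w \<Longrightarrow> hol (gpath u es) (map lab es)"
proof (induction es arbitrary: u)
  case (Cons e es)
  then have e: "e \<in> K 1" and c: "chain (epath e 1) es w" by auto
  show ?case
    using hol_join[OF epath_path[OF e] gpath_path(1,2)[OF c] _ hol_epath[OF e] Cons.IH[OF c]] gpath_path(3)[OF c]
    by simp
qed (auto intro: hol_const)

definition eqv :: "'a \<Rightarrow> ((nat \<Rightarrow> real) \<Rightarrow> 'a) list \<Rightarrow> ((nat \<Rightarrow> real) \<Rightarrow> 'a) list \<Rightarrow> 'a \<Rightarrow> bool" where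
  "eqv u es fs w \<longleftrightarrow> chain u es w \<and> chain u fs w \<and> homotopic_paths S (gpath u es) (gpath u fs)"

lemma eqv_refl: "chain u es w \<Longrightarrow> eqv u es es w"
  by (simp add: eqv_def gpath_path)

lemma eqv_trans: "eqv u es fs w \<Longrightarrow> eqv u fs gs w \<Longrightarrow> eqv u es gs w"
  unfolding eqv_def using homotopic_paths_trans by blast

lemma eqv_append:
  assumes "eqv u es es' v" "eqv v fs fs' w"
  shows "eqv u (es @ fs) (es' @ fs') w"
proof -
  have c: "chain u es v" "chain u es' v" "chain v fs w" "chain v fs' w"
    and h: "homotopic_paths S (gpath u es) (gpath u es')" "homotopic_paths S (gpath v fs) (gpath v fs')"
    using assms by (auto simp: eqv_def)
  have "homotopic_paths S (gpath u (es @ fs)) (gpath u es +++ gpath v fs)" using c by (intro gpath_append)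
  also have "homotopic_paths S (gpath u es +++ gpath v fs) (gpath u es' +++ gpath v fs')"
    using h c gpath_path by (intro homotopic_paths_join) auto
  also have "homotopic_paths S (gpath u es' +++ gpath v fs') (gpath u (es' @ fs'))"
    using c by (intro homotopic_paths_sym[OF gpath_append])
  finally show ?thesis using c chain_append by (auto simp: eqv_def)
qed

lemma eqv_pair:
  assumes "g \<in> K 1" "f \<in> K 1" "g' \<in> K 1" "f' \<in> K 1" "epath g 1 = epath f 0" "epath f' 1 = epath g' 0"
    "epath g 0 = epath f' 0" "epath f 1 = epath g' 1"
    "homotopic_paths S (epath g +++ epath f) (epath f' +++ epath g')"
  shows "eqv (epath g 0) [g, f] [f', g'] (epath f 1)"
proof -
  have S: "epath e t \<in> S" if "e \<in> K 1" "t \<in> {0..1}" for e t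
    using epath_path(2)[OF that(1)] that(2) by (auto simp: path_image_def)
  have c: "chain (epath g 0) [g] (epath f 0)" "chain (epath f 0) [f] (epath f 1)"
    "chain (epath g 0) [f'] (epath g' 0)" "chain (epath g' 0) [g'] (epath f 1)"
    using assms S by auto
  have one: "homotopic_paths S (gpath u [e]) (epath e)" if "e \<in> K 1" for u e
    using homotopic_paths_const_right[OF epath_path[OF that]] by simp
  have "homotopic_paths S (gpath (epath g 0) [g, f]) (gpath (epath g 0) [g] +++ gpath (epath f 0) [f])"
    using gpath_append[OF c(1,2)] by simp
  also have "homotopic_paths S \<dots> (epath g +++ epath f)"
    by (rule homotopic_paths_join[OF one[OF assms(1)] one[OF assms(2)]])
      (simp only: gpath_path(4)[OF c(1)] gpath_path(3)[OF c(2)])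
  also have "homotopic_paths S \<dots> (epath f' +++ epath g')" by (rule assms)
  also have "homotopic_paths S \<dots> (gpath (epath g 0) [f'] +++ gpath (epath g' 0) [g'])"
    by (rule homotopic_paths_join[OF homotopic_paths_sym[OF one[OF assms(4)]] homotopic_paths_sym[OF one[OF assms(3)]]])
      (simp add: assms)
  also have "homotopic_paths S \<dots> (gpath (epath g 0) [f', g'])"
    using homotopic_paths_sym[OF gpath_append[OF c(3,4)]] by simp
  finally show ?thesis using c assms unfolding eqv_def by auto
qed

lemma epath_lin:
  assumes "\<phi> \<in> K n" "i < n" "t \<in> {0..1}"
  shows "epath (edge n \<phi> i b) t = \<phi> (aff n {i} (\<lambda>_. 0) {} b (\<lambda>j. if j = 0 then t else 0))"
  unfolding epath_def edge_def using unit_cube1[OF assms(3)] by simp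

lemma epath_rev: "t \<in> {0..1} \<Longrightarrow> epath (rev_edge e) t = epath e (1 - t)"
  unfolding epath_def using rev_edge_apply[OF unit_cube1[of t], of e] by (simp cong: if_cong)

text \<open>Hyperplanes that cross do not osculate, so consecutive edges dual to them span a square.\<close>

lemma swap_edges:
  assumes g: "g \<in> K 1" and f: "f \<in> K 1" and gf: "epath g 1 = epath f 0"
    and x: "xing (fst (lab g)) (fst (lab f))"
  shows "\<exists>f' g'. eqv (epath g 0) [g, f] [f', g'] (epath f 1) \<and> lab f' = lab f \<and> lab g' = lab g"
proof -
  have rg: "rev_edge g \<in> K 1" "rev_edge g \<in> hyp g" using rev_edge_K[OF g] hyp_self hyp_rev[OF g] by auto
  have "initial e = epath e 0" for e :: "(nat \<Rightarrow> real) \<Rightarrow> 'a" by (simp add: initial_def epath_def cong: if_cong)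
  then have "initial (rev_edge g) = initial f" using epath_rev[of 0 g] gf by simp
  moreover have "hyp g \<noteq> hyp f" using x comm_irrefl by (auto simp: lab_def)
  ultimately have "forms_corner K (rev_edge g) f"
    using x rg(2) hyp_self[OF f] hyp_hyperplanes[OF g] hyp_hyperplanes[OF f]
    by (intro no_inter_osculation[of "hyp g" "hyp f"]) (auto simp: xing_def lab_def)
  then obtain \<sigma> where \<sigma>: "\<sigma> \<in> K 2" "rev_edge g = axis_edge 0 \<sigma>" "f = axis_edge 1 \<sigma>"
    unfolding forms_corner_def by blast
  define pt where "pt a b = (\<lambda>i. if i = 0 then a else if i = Suc 0 then b else (0::real))" for a b :: real
  have pt: "pt a b \<in> cube 2" if "a \<in> {0..1}" "b \<in> {0..1}" for a b
    using that by (auto simp: pt_def cube_def)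
  have aff: "aff 2 {0} (\<lambda>_. 0) {} b (\<lambda>j. if j = 0 then t else 0) = pt t (b 1)"
    "aff 2 {1} (\<lambda>_. 0) {} b (\<lambda>j. if j = 0 then t else 0) = pt (b 0) t" for b :: "nat \<Rightarrow> real" and t :: real
    by (auto simp: aff_def pt_def fun_eq_iff less_2_cases_iff)
  \<comment> \<open>The sides of the square opposite to \<open>f\<close> and to the reverse of
    \<open>g\<close>; they make up the other way around it.\<close>
  define f' where "f' = edge 2 \<sigma> 1 (\<lambda>_. 1)"
  define g1 where "g1 = edge 2 \<sigma> 0 (\<lambda>_. 1)"
  define g' where "g' = rev_edge g1"
  have K: "f' \<in> K 1" "g1 \<in> K 1" unfolding f'_def g1_def by (intro edge_K[OF \<sigma>(1)]; simp)+
  then have K': "g' \<in> K 1" unfolding g'_def by (intro rev_edge_K)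
  have ax: "axis_edge 0 \<sigma> = edge 2 \<sigma> 0 (\<lambda>_. 0)" "axis_edge 1 \<sigma> = edge 2 \<sigma> 1 (\<lambda>_. 0)"
    by (rule axis_edge_eq; simp)+
  have ef: "epath f t = \<sigma> (pt 0 t)" "epath f' t = \<sigma> (pt 1 t)" if "t \<in> {0..1}" for t
    using epath_lin[OF \<sigma>(1), of 1 t] that unfolding \<sigma>(3) ax f'_def by (auto simp: aff[unfolded One_nat_def])
  have rr: "rev_edge (rev_edge g) = g" by (rule rev_rev_edge[OF g])
  have eg: "epath g t = \<sigma> (pt (1 - t) 0)" "epath g' t = \<sigma> (pt (1 - t) 1)" if t: "t \<in> {0..1}" for t
  proof -
    have t': "1 - t \<in> {0..1}" using t by auto
    have "epath g t = epath (rev_edge g) (1 - t)" using epath_rev[of t "rev_edge g"] t rr by simp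
    then show "epath g t = \<sigma> (pt (1 - t) 0)"
      using epath_lin[OF \<sigma>(1), of 0 "1 - t"] t' unfolding \<sigma>(2) ax by (simp add: aff)
    show "epath g' t = \<sigma> (pt (1 - t) 1)"
      using epath_lin[OF \<sigma>(1), of 0 "1 - t"] t' epath_rev[OF t, of g1] unfolding g'_def by (simp add: aff g1_def)
  qed
  have "lab f' = lab f" unfolding f'_def \<sigma>(3) ax by (intro lab_parallel edge_parallel[OF \<sigma>(1)]) auto
  moreover have "lab g1 = lab (rev_edge g)" unfolding g1_def \<sigma>(2) ax by (intro lab_parallel edge_parallel[OF \<sigma>(1)]) auto
  then have "lab g' = lab g" using lab_rev[OF K(2)] lab_rev[OF g] by (simp add: g'_def)
  moreover have "eqv (epath g 0) [g, f] [f', g'] (epath f 1)"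
  proof (rule eqv_pair[OF g f K' K(1) gf])
    show "epath f' 1 = epath g' 0" "epath g 0 = epath f' 0" "epath f 1 = epath g' 1"
      using ef eg by auto
    define a where "a = (\<lambda>t. lin t (pt 1 0) (pt 0 0)) +++ (\<lambda>t. lin t (pt 0 0) (pt 0 1))"
    define b where "b = (\<lambda>t. lin t (pt 1 0) (pt 1 1)) +++ (\<lambda>t. lin t (pt 1 1) (pt 0 1))"
    have l: "lin t (pt 1 0) (pt 0 0) = pt (1 - t) 0" "lin t (pt 0 0) (pt 0 1) = pt 0 t"
      "lin t (pt 1 0) (pt 1 1) = pt 1 t" "lin t (pt 1 1) (pt 0 1) = pt (1 - t) 1" for t
      by (auto simp: lin_def pt_def fun_eq_iff)
    have img: "path_image (\<lambda>t. lin t p q) \<subseteq> cube 2" if "p \<in> cube 2" "q \<in> cube 2" for p q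
      using lin_cube[OF that] by (auto simp: path_image_def)
    have ab: "path a" "path b" "path_image a \<subseteq> cube 2" "path_image b \<subseteq> cube 2"
      unfolding a_def b_def
      by (intro path_join_imp path_lin subset_path_image_join img pt; simp add: pathstart_def pathfinish_def)+
    have h: "homotopic_paths S (\<sigma> \<circ> a) (\<sigma> \<circ> b)"
      by (rule cube_homotopic[OF \<sigma>(1) ab(1,3,2,4)]) (auto simp: a_def b_def pathstart_def pathfinish_def joinpaths_def)
    have "(\<sigma> \<circ> a) t = (epath g +++ epath f) t" "(\<sigma> \<circ> b) t = (epath f' +++ epath g') t" if "t \<in> {0..1}" for t
      using that ef eg by (auto simp: a_def b_def joinpaths_def l)
    then have "homotopic_paths S (\<sigma> \<circ> a) (epath g +++ epath f)" "homotopic_paths S (\<sigma> \<circ> b) (epath f' +++ epath g')"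
      by (intro homotopic_paths_eq cube_path[OF \<sigma>(1)] ab; simp)+
    then show "homotopic_paths S (epath g +++ epath f) (epath f' +++ epath g')"
      using h homotopic_paths_sym homotopic_paths_trans by blast
  qed
  ultimately show ?thesis by blast
qed

text \<open>Repeated exchange through squares carries \<open>f\<close> past the edges before
  it.\<close>

lemma slide_edge:
  assumes "chain v (es @ [f]) w" "\<And>e. e \<in> set es \<Longrightarrow> xing (fst (lab e)) (fst (lab f))"
  shows "\<exists>f' es'. eqv v (es @ [f]) (f' # es') w \<and> lab f' = lab f \<and> map lab es' = map lab es"
  using assms
proof (induction es arbitrary: v)
  case Nil
  then show ?case using eqv_refl by (intro exI[of _ f] exI[of _ "[]"]) auto
next
  case (Cons g es)
  have g: "g \<in> K 1" "epath g 0 = v" "chain (epath g 1) (es @ [f]) w" using Cons.prems by auto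
  obtain f1 es1 where f1: "eqv (epath g 1) (es @ [f]) (f1 # es1) w" "lab f1 = lab f" "map lab es1 = map lab es"
    using Cons.IH[OF g(3)] Cons.prems(2) by auto
  have c1: "f1 \<in> K 1" "epath f1 0 = epath g 1" "chain (epath f1 1) es1 w" using f1(1) by (auto simp: eqv_def)
  obtain f' g' where f': "eqv (epath g 0) [g, f1] [f', g'] (epath f1 1)" "lab f' = lab f1" "lab g' = lab g"
    using swap_edges[OF g(1) c1(1)] c1(2) Cons.prems(2)[of g] f1(2) by auto
  have gv: "chain v [g] (epath g 1)" using g epath_path(2)[OF g(1)] by (auto simp: path_image_def)
  have "eqv v ([g] @ (es @ [f])) ([g] @ (f1 # es1)) w" by (rule eqv_append[OF eqv_refl[OF gv] f1(1)])
  moreover have "eqv v ([g, f1] @ es1) ([f', g'] @ es1) w"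
    using eqv_append[OF f'(1) eqv_refl[OF c1(3)]] g(2) by simp
  ultimately have "eqv v ((g # es) @ [f]) (f' # g' # es1) w"
    using eqv_trans[of v "g # es @ [f]" "g # f1 # es1" w "f' # g' # es1"] by simp
  then show ?case using f' f1 by (intro exI[of _ f'] exI[of _ "g' # es1"]) auto
qed

text \<open>The reverse of \<open>e\<close> starts where \<open>f\<close> does and is parallel to
  it. If they differed, absence of self-osculation would make them a corner of a square, against
  embeddedness. So \<open>f\<close> is the reverse of \<open>e\<close>.\<close>

lemma cancel_edges:
  assumes e: "e \<in> K 1" and f: "f \<in> K 1" and ef: "epath e 1 = epath f 0" and l: "lab e = linv (lab f)"
  shows "eqv (epath e 0) [e, f] [] (epath f 1)"
proof -
  have re: "rev_edge e \<in> K 1" by (rule rev_edge_K[OF e])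
  have "lab (rev_edge e) = lab f" using lab_rev[OF e] l by simp
  then have par: "parallel K (rev_edge e) f" using lab_eq_parallel re f by blast
  have "f = rev_edge e"
  proof (rule ccontr)
    assume "f \<noteq> rev_edge e"
    moreover have "initial e = epath e 0" for e :: "(nat \<Rightarrow> real) \<Rightarrow> 'a" by (simp add: initial_def epath_def cong: if_cong)
    then have "initial (rev_edge e) = initial f" using epath_rev[of 0 e] ef by simp
    ultimately have "forms_corner K (rev_edge e) f" using no_self_osculation[OF re f par] by blast
    moreover have "hyp (rev_edge e) = hyp f" using par by (rule hyp_parallel)
    ultimately show False
      using embedded[of "rev_edge e" "hyp f" f] hyp_self[OF re] hyp_self[OF f] hyp_hyperplanes[OF f] by auto
  qed
  then have r: "epath f t = reversepath (epath e) t" if "t \<in> {0..1}" for t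
    using epath_rev[OF that, of e] by (simp add: reversepath_def)
  have S: "epath e t \<in> S" if "t \<in> {0..1}" for t
    using epath_path(2)[OF e] that by (auto simp: path_image_def)
  have c: "chain (epath e 0) [e, f] (epath e 0)" using e f ef r[of 1] S[of 0] by (auto simp: reversepath_def)
  have c2: "chain (epath e 1) [f] (epath e 0)" using c by auto
  have "homotopic_paths S (gpath (epath e 1) [f]) (epath f)"
    using homotopic_paths_const_right[OF epath_path[OF f]] by simp
  also have "homotopic_paths S (epath f) (reversepath (epath e))"
    using epath_path[OF f] r by (intro homotopic_paths_eq) auto
  finally have "homotopic_paths S (gpath (epath e 0) [e, f]) (epath e +++ reversepath (epath e))"
    using epath_path[OF e] gpath_path(3)[OF c2] by (auto intro!: homotopic_paths_join)
  also have "homotopic_paths S \<dots> (\<lambda>_. epath e 0)"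
    using homotopic_paths_right_inverse[OF epath_path[OF e]] by simp
  finally show ?thesis using c r[of 1] S[of 0] by (auto simp: eqv_def reversepath_def)
qed

text \<open>\<open>eqw_Nil_pattern\<close> finds an inverse pair separated by commuting letters
  only; \<open>slide_edge\<close> makes the two edges adjacent and \<open>cancel_edges\<close>
  removes them. The path is not assumed closed: that it closes up follows from its word.\<close>

lemma edge_loop_null:
  assumes "chain u es w" "map lab es \<doteq> []"
  shows "u = w \<and> homotopic_paths S (gpath u es) (\<lambda>_. u)"
  using assms
proof (induction "length es" arbitrary: es rule: less_induct)
  case less
  show ?case
  proof (cases "es = []")
    case False
    then have "map lab es \<noteq> []" by simp
    then obtain u1 q u2 u3 where pat: "map lab es = u1 @ linv q # u2 @ q # u3" "lkw q u2"
      using eqw_Nil_pattern[OF less.prems(2)] by blast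
    obtain es1 r1 where 1: "es = es1 @ r1" "map lab es1 = u1" "map lab r1 = linv q # u2 @ q # u3"
      using pat(1) by (auto simp: map_eq_append_conv)
    obtain e r2 where 2: "r1 = e # r2" "lab e = linv q" "map lab r2 = u2 @ q # u3"
      using 1(3) by (auto simp: map_eq_Cons_conv)
    obtain es2 r3 where 3: "r2 = es2 @ r3" "map lab es2 = u2" "map lab r3 = q # u3"
      using 2(3) by (auto simp: map_eq_append_conv)
    obtain f es3 where 4: "r3 = f # es3" "lab f = q" "map lab es3 = u3"
      using 3(3) by (auto simp: map_eq_Cons_conv)
    have es: "es = es1 @ [e] @ (es2 @ [f]) @ es3" using 1 2 3 4 by simp
    obtain v1 v2 v3 where c: "chain u es1 v1" "chain v1 [e] v2" "chain v2 (es2 @ [f]) v3" "chain v3 es3 w"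
      using less.prems(1) unfolding es chain_append by blast
    have "xing (fst (lab g)) (fst (lab f))" if "g \<in> set es2" for g
      using pat(2) that unfolding 3(2)[symmetric] 4(2) lkw_def by auto
    then obtain f' es2' where f': "eqv v2 (es2 @ [f]) (f' # es2') v3" "lab f' = lab f" "map lab es2' = map lab es2"
      using slide_edge[OF c(3)] by blast
    have cf: "f' \<in> K 1" "epath f' 0 = v2" "chain (epath f' 1) es2' v3" using f'(1) by (auto simp: eqv_def)
    have ce: "e \<in> K 1" "epath e 0 = v1" "epath e 1 = v2" using c(2) by auto
    have can: "eqv v1 [e, f'] [] (epath f' 1)"
      using cancel_edges[OF ce(1) cf(1)] ce cf 2(2) f'(2) 4(2) by simp
    have "eqv v1 ([e] @ (es2 @ [f])) ([e] @ (f' # es2')) v3" by (rule eqv_append[OF eqv_refl[OF c(2)] f'(1)])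
    moreover have "eqv v1 ([e, f'] @ es2') ([] @ es2') v3" by (rule eqv_append[OF can eqv_refl[OF cf(3)]])
    ultimately have "eqv v1 ([e] @ es2 @ [f]) es2' v3"
      using eqv_trans[of v1 "e # es2 @ [f]" "e # f' # es2'" v3 es2'] by simp
    then have "eqv v1 (([e] @ es2 @ [f]) @ es3) (es2' @ es3) w" by (rule eqv_append[OF _ eqv_refl[OF c(4)]])
    then have "eqv u (es1 @ (([e] @ es2 @ [f]) @ es3)) (es1 @ (es2' @ es3)) w" by (rule eqv_append[OF eqv_refl[OF c(1)]])
    then have E: "eqv u es (es1 @ es2' @ es3) w" using es by simp
    have "length es2' = length es2" using f'(3) by (metis length_map)
    then have len: "length (es1 @ es2' @ es3) < length es" using es by simp
    have "u1 @ (linv q # u2 @ [q]) @ u3 \<doteq> u1 @ u2 @ u3" by (intro eqw_cong eqw_lkw_cancel pat)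
    then have "map lab (es1 @ es2' @ es3) \<doteq> map lab es"
      using eqw_sym pat(1) 1 3 4 f'(3) by simp
    then have "map lab (es1 @ es2' @ es3) \<doteq> []" using less.prems(2) eqw_trans by blast
    moreover have cE: "chain u (es1 @ es2' @ es3) w" "homotopic_paths S (gpath u es) (gpath u (es1 @ es2' @ es3))"
      using E unfolding eqv_def by blast+
    ultimately have "u = w \<and> homotopic_paths S (gpath u (es1 @ es2' @ es3)) (\<lambda>_. u)"
      by (intro less.hyps[OF len])
    then show ?thesis using cE(2) homotopic_paths_trans by blast
  qed (use less.prems in auto)
qed

section \<open>Every path is homotopic to an edge path\<close>

text \<open>One coordinate is changed at a time, and the detour is homotopic to the straight segment
  within the cube.\<close>

lemma cube_edge_path:
  assumes "\<phi> \<in> K n" "v \<in> cube n" "v' \<in> cube n" "\<forall>i<n. v i \<in> {0, 1}" "\<forall>i<n. v' i \<in> {0, 1}"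
  shows "\<exists>es. chain (\<phi> v) es (\<phi> v') \<and> homotopic_paths S (gpath (\<phi> v) es) (\<phi> \<circ> (\<lambda>t. lin t v v'))"
  using assms
proof (induction "card {i. i < n \<and> v i \<noteq> v' i}" arbitrary: v)
  case 0
  have "finite {i. i < n \<and> v i \<noteq> v' i}" by simp
  then have "{i. i < n \<and> v i \<noteq> v' i} = {}" using 0 by simp
  then have "v i = v' i" if "i < n" for i using that by blast
  then have "v = v'" using cubeD(3)[OF 0(3)] cubeD(3)[OF 0(4)] by (metis ext linorder_not_less)
  then show ?case using K_in_S[OF 0(2,3)] by (intro exI[of _ "[]"]) (auto simp: o_def)
next
  case (Suc d)
  have "{i. i < n \<and> v i \<noteq> v' i} \<noteq> {}" using Suc(2) by (metis card.empty nat.distinct(1))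
  then obtain i where i: "i < n" "v i \<noteq> v' i" by blast
  define w where "w = v(i := v' i)"
  have w: "w \<in> cube n" "\<forall>j<n. w j \<in> {0, 1}"
    using Suc.prems i cubeD[OF Suc.prems(2)] cubeD(1,2)[OF Suc.prems(3), of i] by (auto simp: w_def cube_def)
  have "{j. j < n \<and> v j \<noteq> v' j} = insert i {j. j < n \<and> w j \<noteq> v' j}" "i \<notin> {j. j < n \<and> w j \<noteq> v' j}"
    using i by (auto simp: w_def)
  then have "d = card {j. j < n \<and> w j \<noteq> v' j}" using Suc(2) by simp
  then obtain es where es: "chain (\<phi> w) es (\<phi> v')" "homotopic_paths S (gpath (\<phi> w) es) (\<phi> \<circ> (\<lambda>t. lin t w v'))"
    using Suc(1)[of w] Suc.prems w by blast
  define e0 where "e0 = edge n \<phi> i v"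
  have e0: "e0 \<in> K 1" unfolding e0_def using Suc.prems i by (intro edge_K) auto
  have ep: "epath e0 t = \<phi> (v(i := t))" if "t \<in> {0..1}" for t
  proof -
    have "aff n {i} (\<lambda>_. 0) {} v (\<lambda>j. if j = 0 then t else 0) = v(i := t)"
      using i cubeD(3)[OF Suc.prems(2)] by (auto simp: aff_def fun_eq_iff)
    then show ?thesis using epath_lin[OF Suc.prems(1) i(1) that] by (simp add: e0_def)
  qed
  define e where "e = (if v i = 0 then e0 else rev_edge e0)"
  have e: "e \<in> K 1" using e0 rev_edge_K by (simp add: e_def)
  have vi: "v i \<in> {0, 1}" "v' i = 1 - v i" using Suc.prems i by force+
  have el: "epath e t = \<phi> (lin t v w)" if t: "t \<in> {0..1}" for t
  proof (cases "v i = 0")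
    case True
    have "lin t v w = v(i := t)" using True vi by (auto simp: lin_def w_def fun_eq_iff algebra_simps)
    then show ?thesis using ep[OF t] True by (simp add: e_def)
  next
    case False
    then have "v i = 1" using vi by simp
    then have "lin t v w = v(i := 1 - t)" using vi by (auto simp: lin_def w_def fun_eq_iff algebra_simps)
    then show ?thesis using ep[of "1 - t"] epath_rev[OF t, of e0] t False by (simp add: e_def)
  qed
  have ends: "epath e 0 = \<phi> v" "epath e 1 = \<phi> w" using el[of 0] el[of 1] by auto
  have img: "path_image (\<lambda>t. lin t p q) \<subseteq> cube n" if "p \<in> cube n" "q \<in> cube n" for p q
    using lin_cube[OF that] by (auto simp: path_image_def)
  have "homotopic_paths S (epath e) (\<phi> \<circ> (\<lambda>t. lin t v w))"
    using el epath_path[OF e] by (intro homotopic_paths_eq) auto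
  then have "homotopic_paths S (gpath (\<phi> v) (e # es)) ((\<phi> \<circ> (\<lambda>t. lin t v w)) +++ (\<phi> \<circ> (\<lambda>t. lin t w v')))"
    using es ends gpath_path(3)[OF es(1)] by (auto intro!: homotopic_paths_join)
  also have "\<dots> = \<phi> \<circ> ((\<lambda>t. lin t v w) +++ (\<lambda>t. lin t w v'))" by (simp add: path_compose_join)
  also have "homotopic_paths S \<dots> (\<phi> \<circ> (\<lambda>t. lin t v v'))"
    using Suc.prems w
    by (intro cube_homotopic[OF Suc.prems(1)] path_join_imp path_lin subset_path_image_join img)
       (simp_all add: pathstart_def pathfinish_def joinpaths_def)
  finally show ?case using es ends e by (intro exI[of _ "e # es"]) auto
qed

definition rep :: "'a \<Rightarrow> nat \<times> ((nat \<Rightarrow> real) \<Rightarrow> 'a) \<times> (nat \<Rightarrow> real)" where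
  "rep y = (SOME (n, \<phi>, x). \<phi> \<in> K n \<and> x \<in> open_cube n \<and> \<phi> x = y)"

text \<open>The leg of \<open>y\<close> runs from \<open>y\<close> to a vertex of the open cube containing it.\<close>

definition leg :: "'a \<Rightarrow> real \<Rightarrow> 'a" where
  "leg y = (case rep y of (n, \<phi>, x) \<Rightarrow> \<phi> \<circ> (\<lambda>t. lin t x (\<lambda>_. 0)))"

definition foot :: "'a \<Rightarrow> 'a" where
  "foot y = leg y 1"

text \<open>The leg runs in the cube whose interior contains the point. That cube is a face of any
  cube containing the point, so the leg is straight there too and ends at a vertex.\<close>

lemma leg_in_cube:
  assumes \<phi>: "\<phi> \<in> K n" and a: "a \<in> cube n"
  obtains v where "v \<in> cube n" "\<forall>i<n. v i \<in> {0, 1}" "\<forall>t\<in>{0..1}. leg (\<phi> a) t = \<phi> (lin t a v)"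
proof -
  obtain m0 \<psi>0 x0 where r0: "\<psi>0 \<in> K m0" "x0 \<in> open_cube m0" "\<psi>0 x0 = \<phi> a"
    using S_rep[OF K_in_S[OF \<phi> a]] .
  then have "\<exists>r. case r of (n, \<psi>, x) \<Rightarrow> \<psi> \<in> K n \<and> x \<in> open_cube n \<and> \<psi> x = \<phi> a"
    by (intro exI[of _ "(m0, \<psi>0, x0)"]) simp
  from someI_ex[OF this] have sel: "case rep (\<phi> a) of (n, \<psi>, x) \<Rightarrow> \<psi> \<in> K n \<and> x \<in> open_cube n \<and> \<psi> x = \<phi> a"
    unfolding rep_def .
  obtain m \<psi> x where r1: "rep (\<phi> a) = (m, \<psi>, x)" by (cases "rep (\<phi> a)")
  then have r: "rep (\<phi> a) = (m, \<psi>, x)" "\<psi> \<in> K m" "x \<in> open_cube m" "\<psi> x = \<phi> a" using sel by simp_all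
  have xc: "x \<in> cube m" using r(3) open_cube_subset by blast
  obtain J \<kappa> J' \<kappa>' A k y where f:
    "J = {i. i < m \<and> 0 < x i \<and> x i < 1}" "bij_betw \<kappa> J {..<k}" "\<forall>i<m. i \<notin> J \<longrightarrow> x i \<in> {0, 1}"
    "J' = {i. i < n \<and> 0 < a i \<and> a i < 1}" "bij_betw \<kappa>' J' {..<k}" "\<forall>i<n. i \<notin> J' \<longrightarrow> a i \<in> {0, 1}"
    "y \<in> open_cube k" "aff m J \<kappa> {} x y = x" "aff n J' \<kappa>' A a y = a"
    "\<forall>u\<in>cube k. \<psi> (aff m J \<kappa> {} x u) = \<phi> (aff n J' \<kappa>' A a u)"
    by (rule common_face[OF r(2) \<phi> xc a r(4)])
  define v where "v = aff n J' \<kappa>' A a (\<lambda>_. 0)"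
  have z: "aff m J \<kappa> {} x (\<lambda>_. 0) = (\<lambda>_. 0)"
    using r(3) f(1) by (auto simp: aff_def open_cube_def fun_eq_iff)
  have yk: "y \<in> cube k" using f(7) open_cube_subset by blast
  have "leg (\<phi> a) t = \<phi> (lin t a v)" if t: "t \<in> {0..1}" for t
  proof -
    have "lin t y (\<lambda>_. 0) \<in> cube k" using yk t by (intro lin_cube) auto
    then have "\<psi> (aff m J \<kappa> {} x (lin t y (\<lambda>_. 0))) = \<phi> (aff n J' \<kappa>' A a (lin t y (\<lambda>_. 0)))" using f(10) by blast
    then have "\<psi> (lin t x (\<lambda>_. 0)) = \<phi> (lin t a v)" unfolding lin_def aff_convex f(8,9) z v_def .
    then show ?thesis by (simp add: leg_def r(1))
  qed
  moreover have "v \<in> cube n" unfolding v_def using f(6) by (intro aff_cube[of _ k]) fastforce+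
  moreover have "\<forall>i<n. v i \<in> {0, 1}" using f(6) by (auto simp: v_def aff_def)
  ultimately show ?thesis using that by blast
qed

lemma leg_path:
  assumes "y \<in> S"
  shows "path (leg y)" "path_image (leg y) \<subseteq> S" "pathstart (leg y) = y" "pathfinish (leg y) = foot y"
proof -
  obtain n \<phi> a where a: "\<phi> \<in> K n" "a \<in> open_cube n" "\<phi> a = y" using S_rep[OF assms] .
  then have ac: "a \<in> cube n" using open_cube_subset by blast
  obtain v where v: "v \<in> cube n" "\<forall>t\<in>{0..1}. leg (\<phi> a) t = \<phi> (lin t a v)"
    using leg_in_cube[OF a(1) ac] by metis
  have img: "path_image (\<lambda>t. lin t a v) \<subseteq> cube n" using lin_cube[OF ac v(1)] by (auto simp: path_image_def)
  have "homotopic_paths S (\<phi> \<circ> (\<lambda>t. lin t a v)) (leg y)"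
    using cube_path[OF a(1) path_lin img] v(2) a(3) by (intro homotopic_paths_eq) auto
  then show "path (leg y)" "path_image (leg y) \<subseteq> S"
    using homotopic_paths_imp_path homotopic_paths_imp_subset by blast+
  show "pathstart (leg y) = y" using bspec[OF v(2), of 0] a(3) by (simp add: pathstart_def)
  show "pathfinish (leg y) = foot y" by (simp add: pathfinish_def foot_def)
qed

text \<open>Endpoints need not be vertices, so legs connect them to vertices. A leg depends only on
  its point, and therefore the two legs at a common point cancel when paths are joined.\<close>

definition good :: "(real \<Rightarrow> 'a) \<Rightarrow> bool" where
  "good \<gamma> \<longleftrightarrow> pathstart \<gamma> \<in> S \<and> pathfinish \<gamma> \<in> S \<and> (\<exists>es. chain (foot (pathstart \<gamma>)) es (foot (pathfinish \<gamma>)) \<and>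
     homotopic_paths S \<gamma> (leg (pathstart \<gamma>) +++ (gpath (foot (pathstart \<gamma>)) es +++ reversepath (leg (pathfinish \<gamma>)))))"

lemma good_homotopic: assumes "homotopic_paths S \<gamma> \<delta>" "good \<delta>" shows "good \<gamma>"
  using assms homotopic_paths_imp_pathstart[OF assms(1)] homotopic_paths_imp_pathfinish[OF assms(1)]
    homotopic_paths_trans unfolding good_def by metis

text \<open>Both legs and the edge path between their feet can be taken in the given cube, where
  paths with the same ends are homotopic.\<close>

lemma good_line:
  assumes \<phi>: "\<phi> \<in> K n" and a: "a \<in> cube n" "a' \<in> cube n"
  shows "good (\<phi> \<circ> (\<lambda>t. lin t a a'))"
proof -
  obtain v where v: "v \<in> cube n" "\<forall>i<n. v i \<in> {0, 1}" "\<forall>t\<in>{0..1}. leg (\<phi> a) t = \<phi> (lin t a v)"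
    using leg_in_cube[OF \<phi> a(1)] .
  obtain v' where v': "v' \<in> cube n" "\<forall>i<n. v' i \<in> {0, 1}" "\<forall>t\<in>{0..1}. leg (\<phi> a') t = \<phi> (lin t a' v')"
    using leg_in_cube[OF \<phi> a(2)] .
  obtain es where es: "chain (\<phi> v) es (\<phi> v')" "homotopic_paths S (gpath (\<phi> v) es) (\<phi> \<circ> (\<lambda>t. lin t v v'))"
    using cube_edge_path[OF \<phi> v(1) v'(1) v(2) v'(2)] by blast
  have foot: "foot (\<phi> a) = \<phi> v" "foot (\<phi> a') = \<phi> v'" using bspec[OF v(3), of 1] bspec[OF v'(3), of 1] by (auto simp: foot_def)
  have S: "\<phi> a \<in> S" "\<phi> a' \<in> S" using K_in_S[OF \<phi>] a by auto
  have img: "path_image (\<lambda>t. lin t p q) \<subseteq> cube n" if "p \<in> cube n" "q \<in> cube n" for p q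
    using lin_cube[OF that] by (auto simp: path_image_def)
  have "homotopic_paths S (\<phi> \<circ> (\<lambda>t. lin t a a')) (\<phi> \<circ> ((\<lambda>t. lin t a v) +++ ((\<lambda>t. lin t v v') +++ (\<lambda>t. lin t v' a'))))"
    using a v v'
    by (intro cube_homotopic[OF \<phi>] path_join_imp path_lin subset_path_image_join img)
       (simp_all add: pathstart_def pathfinish_def joinpaths_def)
  also have "\<dots> = (\<phi> \<circ> (\<lambda>t. lin t a v)) +++ ((\<phi> \<circ> (\<lambda>t. lin t v v')) +++ (\<phi> \<circ> (\<lambda>t. lin t v' a')))"
    by (simp add: path_compose_join)
  also have "homotopic_paths S \<dots> (leg (\<phi> a) +++ (gpath (\<phi> v) es +++ reversepath (leg (\<phi> a'))))"
  proof (intro homotopic_paths_join)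
    show "homotopic_paths S (\<phi> \<circ> (\<lambda>t. lin t a v)) (leg (\<phi> a))"
      using cube_path[OF \<phi> path_lin img] a v by (intro homotopic_paths_eq) auto
    show "homotopic_paths S (\<phi> \<circ> (\<lambda>t. lin t v v')) (gpath (\<phi> v) es)" by (rule homotopic_paths_sym[OF es(2)])
    have "leg (\<phi> a') (1 - t) = \<phi> (lin t v' a')" if "t \<in> {0..1}" for t
      using bspec[OF v'(3), of "1 - t"] that lin_swap[of t a' v'] by simp
    then show "homotopic_paths S (\<phi> \<circ> (\<lambda>t. lin t v' a')) (reversepath (leg (\<phi> a')))"
      using cube_path[OF \<phi> path_lin img] a v' by (intro homotopic_paths_eq) (auto simp: reversepath_def)
  qed (auto simp: pathstart_def pathfinish_def joinpaths_def)
  finally have h: "homotopic_paths S (\<phi> \<circ> (\<lambda>t. lin t a a')) (leg (\<phi> a) +++ (gpath (\<phi> v) es +++ reversepath (leg (\<phi> a'))))" .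
  have "pathstart (\<phi> \<circ> (\<lambda>t. lin t a a')) = \<phi> a" "pathfinish (\<phi> \<circ> (\<lambda>t. lin t a a')) = \<phi> a'"
    by (auto simp: pathstart_def pathfinish_def)
  then show ?thesis unfolding good_def using es(1) S foot h by metis
qed

lemma good_join:
  assumes "good \<gamma>" "good \<delta>" "pathfinish \<gamma> = pathstart \<delta>"
  shows "good (\<gamma> +++ \<delta>)"
proof -
  define x y z where "x = pathstart \<gamma>" and "y = pathfinish \<gamma>" and "z = pathfinish \<delta>"
  obtain es where es: "chain (foot x) es (foot y)"
    "homotopic_paths S \<gamma> (leg x +++ (gpath (foot x) es +++ reversepath (leg y)))"
    using assms(1) unfolding good_def x_def y_def by blast
  obtain fs where fs: "chain (foot y) fs (foot z)"
    "homotopic_paths S \<delta> (leg y +++ (gpath (foot y) fs +++ reversepath (leg z)))"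
    using assms(2,3) unfolding good_def y_def z_def by auto
  have S: "x \<in> S" "y \<in> S" "z \<in> S" using assms by (auto simp: good_def x_def y_def z_def)
  note lx = leg_path[OF S(1)] and ly = leg_path[OF S(2)] and lz = leg_path[OF S(3)]
  note ge = gpath_path[OF es(1)] and gf = gpath_path[OF fs(1)]
  note simps = lx ly lz ge gf path_image_join subset_path_image_join
  define A B C D E where "A = leg x" and "B = gpath (foot x) es" and "C = leg y" and "D = gpath (foot y) fs"
    and "E = reversepath (leg z)"
  have p: "path A" "path B" "path C" "path D" "path E" "path_image A \<subseteq> S" "path_image B \<subseteq> S" "path_image C \<subseteq> S"
    "path_image D \<subseteq> S" "path_image E \<subseteq> S" "pathstart A = x" "pathfinish A = foot x" "pathstart B = foot x" "pathfinish B = foot y"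
    "pathstart C = y" "pathfinish C = foot y" "pathstart D = foot y" "pathfinish D = foot z" "pathstart E = foot z" "pathfinish E = z"
    using simps by (auto simp: A_def B_def C_def D_def E_def)
  note ps = p subset_path_image_join path_join_imp
  have "homotopic_paths S (\<gamma> +++ \<delta>) ((A +++ (B +++ reversepath C)) +++ (C +++ (D +++ E)))"
    using es(2) fs(2) assms(3) unfolding A_def B_def C_def D_def E_def by (intro homotopic_paths_join)
  also have "homotopic_paths S \<dots> (A +++ ((B +++ reversepath C) +++ (C +++ (D +++ E))))"
    by (rule homotopic_paths_sym, rule homotopic_paths_assoc) (simp_all add: ps)
  also have "homotopic_paths S \<dots> (A +++ (B +++ (D +++ E)))"
  proof (rule homotopic_paths_join)
    have "homotopic_paths S ((B +++ reversepath C) +++ (C +++ (D +++ E))) (B +++ (reversepath C +++ (C +++ (D +++ E))))"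
      by (rule homotopic_paths_sym, rule homotopic_paths_assoc) (simp_all add: ps)
    also have "homotopic_paths S \<dots> (B +++ (D +++ E))"
    proof (rule homotopic_paths_join)
      have "homotopic_paths S (reversepath C +++ (C +++ (D +++ E))) ((reversepath C +++ C) +++ (D +++ E))"
        by (rule homotopic_paths_assoc) (simp_all add: ps)
      also have "homotopic_paths S \<dots> ((\<lambda>_. foot y) +++ (D +++ E))"
        using homotopic_paths_left_inverse[OF p(3,8)] p by (intro homotopic_paths_join) (simp_all add: ps)
      also have "homotopic_paths S \<dots> (D +++ E)"
        using homotopic_paths_const_left[of "D +++ E" S] by (simp add: ps)
      finally show "homotopic_paths S (reversepath C +++ (C +++ (D +++ E))) (D +++ E)" .
    qed (simp_all add: ps)
    finally show "homotopic_paths S ((B +++ reversepath C) +++ (C +++ (D +++ E))) (B +++ (D +++ E))" .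
  qed (simp_all add: ps)
  also have "homotopic_paths S \<dots> (A +++ ((B +++ D) +++ E))"
    by (rule homotopic_paths_join[OF _ homotopic_paths_assoc]) (simp_all add: ps)
  also have "homotopic_paths S \<dots> (A +++ (gpath (foot x) (es @ fs) +++ E))"
  proof (rule homotopic_paths_join)
    show "homotopic_paths S ((B +++ D) +++ E) (gpath (foot x) (es @ fs) +++ E)"
    proof (rule homotopic_paths_join)
      show "homotopic_paths S (B +++ D) (gpath (foot x) (es @ fs))"
        using homotopic_paths_sym[OF gpath_append[OF es(1) fs(1)]] by (simp add: B_def D_def)
    qed (simp_all add: ps)
  qed (simp_all add: ps)
  finally have "homotopic_paths S (\<gamma> +++ \<delta>) (leg x +++ (gpath (foot x) (es @ fs) +++ reversepath (leg z)))"
    by (simp add: A_def E_def)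
  moreover have "chain (foot x) (es @ fs) (foot z)" using es fs chain_append by blast
  ultimately show ?thesis unfolding good_def using S by (auto simp: x_def z_def)
qed

text \<open>\<open>star_path\<close> reduces the claim to the two straight lines joining the ends to
  the centre of the star.\<close>

lemma good_star: assumes "path \<delta>" "path_image \<delta> \<subseteq> star x" shows "good \<delta>"
proof (rule good_homotopic[OF star_path[OF assms]])
  have mem: "\<delta> 0 \<in> star x" "\<delta> 1 \<in> star x" using assms(2) by (auto simp: path_image_def)
  have line: "good (ctr x y)" "good (\<lambda>s. ctr x y (1 - s))" if y: "y \<in> star x" for y
  proof -
    obtain n \<phi> a a0 where l: "\<phi> \<in> K n" "a \<in> cube n" "a0 \<in> cube n"
      "\<And>s. s \<in> {0..1} \<Longrightarrow> ctr x y s = \<phi> (lin s a a0)" using ctr_line[OF y] by metis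
    have img: "path_image (\<lambda>t. lin t p q) \<subseteq> cube n" if "p \<in> cube n" "q \<in> cube n" for p q
      using lin_cube[OF that] by (auto simp: path_image_def)
    have "homotopic_paths S (\<phi> \<circ> (\<lambda>t. lin t a a0)) (ctr x y)"
      using cube_path[OF l(1) path_lin img] l by (intro homotopic_paths_eq) auto
    then show "good (ctr x y)" using good_line[OF l(1-3)] homotopic_paths_sym good_homotopic by blast
    have "homotopic_paths S (\<phi> \<circ> (\<lambda>t. lin t a0 a)) (\<lambda>s. ctr x y (1 - s))"
    proof (rule homotopic_paths_eq)
      fix t :: real assume "t \<in> {0..1}"
      then show "(\<phi> \<circ> (\<lambda>t. lin t a0 a)) t = ctr x y (1 - t)" using l(4)[of "1 - t"] lin_swap[of t a a0] by simp
    qed (use cube_path[OF l(1) path_lin img] l in auto)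
    then show "good (\<lambda>s. ctr x y (1 - s))"
      using good_line[OF l(1,3,2)] homotopic_paths_sym good_homotopic by blast
  qed
  have "ctr x (\<delta> 0) 1 = x" "ctr x (\<delta> 1) 1 = x"
    using ctr_line[OF mem(1)] ctr_line[OF mem(2)] by (metis atLeastAtMost_iff lin_simps(2) order_refl zero_le_one)+
  then show "good (ctr x (\<delta> 0) +++ (\<lambda>s. ctr x (\<delta> 1) (1 - s)))"
    using line mem by (intro good_join) (auto simp: pathstart_def pathfinish_def)
qed

text \<open>A Lebesgue number cuts the path into pieces inside stars; these are good and can be
  joined one after another.\<close>

lemma good_path: assumes \<gamma>: "path \<gamma>" "path_image \<gamma> \<subseteq> S" shows "good \<gamma>"
proof -
  define C where "C = {G. open G \<and> (\<exists>x. \<gamma> ` ({0..1} \<inter> G) \<subseteq> star x)}"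
  have "{0..1} \<subseteq> \<Union>C"
  proof
    fix t :: real assume t: "t \<in> {0..1}"
    then have tS: "\<gamma> t \<in> S" using \<gamma>(2) by (auto simp: path_image_def)
    have "openin (top_of_set {0..1}) ({0..1} \<inter> \<gamma> -` star (\<gamma> t))"
      using \<gamma> star_open unfolding path_def path_image_def by (intro continuous_openin_preimage[of _ _ S]) auto
    then obtain G where G: "open G" "{0..1} \<inter> \<gamma> -` star (\<gamma> t) = {0..1} \<inter> G" by (auto simp: openin_open)
    have "\<gamma> ` ({0..1} \<inter> G) \<subseteq> star (\<gamma> t)" using G(2) by blast
    then have "G \<in> C" using G(1) by (auto simp: C_def)
    moreover have "t \<in> G" using G(2) t star_self[OF tS] by blast
    ultimately show "t \<in> \<Union>C" by blast
  qed
  then obtain \<epsilon> where \<epsilon>: "0 < \<epsilon>" "\<And>t. t \<in> {0..1} \<Longrightarrow> \<exists>G\<in>C. ball t \<epsilon> \<subseteq> G"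
  proof (rule Heine_Borel_lemma[OF compact_Icc])
    show "open G" if "G \<in> C" for G using that by (simp add: C_def)
  qed (assumption | blast)+
  have sub: "path (\<gamma> \<circ> linepath u v)" "path_image (\<gamma> \<circ> linepath u v) = \<gamma> ` closed_segment u v"
    if "u \<in> {0..1}" "v \<in> {0..1}" for u v
  proof -
    have s: "closed_segment u v \<subseteq> {0..1}" using that by (intro closed_segment_subset) auto
    show "path (\<gamma> \<circ> linepath u v)"
      using \<gamma>(1) s unfolding path_def[of \<gamma>] by (intro path_continuous_image) (auto intro: continuous_on_subset)
    show "path_image (\<gamma> \<circ> linepath u v) = \<gamma> ` closed_segment u v" by (simp add: path_image_compose)
  qed
  have short: "good (\<gamma> \<circ> linepath u v)" if uv: "u \<in> {0..1}" "v \<in> {0..1}" "dist u v < \<epsilon>" for u v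
  proof -
    obtain G x where G: "ball u \<epsilon> \<subseteq> G" "\<gamma> ` ({0..1} \<inter> G) \<subseteq> star x" using \<epsilon>(2)[OF uv(1)] by (auto simp: C_def)
    have "closed_segment u v \<subseteq> ball u \<epsilon>" using uv(3) \<epsilon>(1) by (intro closed_segment_subset) auto
    moreover have "closed_segment u v \<subseteq> {0..1}" using uv by (intro closed_segment_subset) auto
    ultimately have "\<gamma> ` closed_segment u v \<subseteq> star x" using G by blast
    then show ?thesis using sub[OF uv(1,2)] by (intro good_star[of _ x]) auto
  qed
  have "good (\<gamma> \<circ> linepath 0 1)"
  proof (rule steps_01[OF \<epsilon>(1), of "\<lambda>t. good (\<gamma> \<circ> linepath 0 t)"])
    show "good (\<gamma> \<circ> linepath 0 0)" using short[of 0 0] \<epsilon>(1) by simp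
    fix s t :: real assume st: "s \<in> {0..1}" "t \<in> {0..1}" "dist s t < \<epsilon>" "good (\<gamma> \<circ> linepath 0 s)"
    have "good ((\<gamma> \<circ> linepath 0 s) +++ (\<gamma> \<circ> linepath s t))"
      using st short by (intro good_join) (auto simp: pathstart_compose pathfinish_compose)
    moreover have "homotopic_paths S (\<gamma> \<circ> linepath 0 t) ((\<gamma> \<circ> linepath 0 s) +++ (\<gamma> \<circ> linepath s t))"
      using homotopic_paths_subpaths[OF \<gamma>, of 0 s t] st by simp
    ultimately show "good (\<gamma> \<circ> linepath 0 t)" using good_homotopic by blast
  qed
  then show ?thesis by (simp add: path_linepath_compose)
qed

text \<open>The two legs contribute words \<open>a\<close> and \<open>b\<close> with trivial
  product, so the edge loop between them also has trivial word. It is then null-homotopic, and the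
  legs cancel.\<close>

theorem hol_injective:
  assumes \<gamma>: "path \<gamma>" "path_image \<gamma> \<subseteq> S" "pathstart \<gamma> = p" "pathfinish \<gamma> = p"
    and h: "hol \<gamma> w" "w \<doteq> []"
  shows "homotopic_paths S \<gamma> (\<lambda>_. p)"
proof -
  obtain es where p: "p \<in> S" and es: "chain (foot p) es (foot p)"
    "homotopic_paths S \<gamma> (leg p +++ (gpath (foot p) es +++ reversepath (leg p)))"
    using good_path[OF \<gamma>(1,2)] unfolding good_def \<gamma>(3,4) by blast
  note l = leg_path[OF p] and g = gpath_path[OF es(1)]
  note ps = l g subset_path_image_join path_join_imp
  obtain a where a: "hol (leg p) a" using hol_exists l by blast
  obtain b where b: "hol (reversepath (leg p)) b" using hol_exists[of "reversepath (leg p)"] l by auto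
  have inv: "homotopic_paths S (leg p +++ reversepath (leg p)) (\<lambda>_. p)"
    using homotopic_paths_right_inverse[OF l(1,2)] l by simp
  have "hol (leg p +++ reversepath (leg p)) (a @ b)" using l a b by (intro hol_join) auto
  then have "hol (\<lambda>_. p) (a @ b)" using inv hol_homotopic by blast
  then have ab: "a @ b \<doteq> []" using hol_const[OF p] hol_unique by blast
  have hb: "hol (gpath (foot p) es +++ reversepath (leg p)) (map lab es @ b)"
    using b hol_gpath[OF es(1)] by (intro hol_join) (simp_all add: ps)
  have "hol (leg p +++ (gpath (foot p) es +++ reversepath (leg p))) (a @ (map lab es @ b))"
    by (rule hol_join[OF _ _ _ _ _ a hb]) (simp_all add: ps)
  moreover have "hol (leg p +++ (gpath (foot p) es +++ reversepath (leg p))) w" using hol_homotopic[OF es(2) h(1)] .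
  ultimately have "a @ map lab es @ b \<doteq> w" by (rule hol_unique)
  also have "w \<doteq> a @ b" using h(2) ab eqw_sym eqw_trans by blast
  finally have "map lab es @ b \<doteq> [] @ b" using eqw_cancel_left by simp
  then have "map lab es \<doteq> []" by (rule eqw_cancel_right)
  then have n: "homotopic_paths S (gpath (foot p) es) (\<lambda>_. foot p)" using edge_loop_null[OF es(1)] by blast
  have "homotopic_paths S (leg p +++ (gpath (foot p) es +++ reversepath (leg p))) (leg p +++ reversepath (leg p))"
  proof (rule homotopic_paths_join)
    have "homotopic_paths S (gpath (foot p) es +++ reversepath (leg p)) ((\<lambda>_. foot p) +++ reversepath (leg p))"
      using n by (intro homotopic_paths_join) (simp_all add: ps)
    also have "homotopic_paths S \<dots> (reversepath (leg p))"
      using homotopic_paths_const_left[of "reversepath (leg p)" S] by (simp add: ps)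
    finally show "homotopic_paths S (gpath (foot p) es +++ reversepath (leg p)) (reversepath (leg p))" .
  qed (simp_all add: ps)
  then show ?thesis using es(2) inv homotopic_paths_trans by blast
qed

end

section \<open>The fundamental group\<close>

lemma loop_class_eq_iff:
  assumes "\<gamma> \<in> loops S p"
  shows "loop_class S \<gamma> = loop_class S \<delta> \<longleftrightarrow> homotopic_paths S \<gamma> \<delta>"
proof
  assume "loop_class S \<gamma> = loop_class S \<delta>"
  moreover have "\<gamma> \<in> loop_class S \<gamma>" using assms by (auto simp: loops_def loop_class_def)
  ultimately show "homotopic_paths S \<gamma> \<delta>" by (auto simp: loop_class_def intro: homotopic_paths_sym)
next
  assume "homotopic_paths S \<gamma> \<delta>"
  then show "loop_class S \<gamma> = loop_class S \<delta>"
    unfolding loop_class_def using homotopic_paths_sym homotopic_paths_trans by blast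
qed

lemma loops_join: "\<gamma> \<in> loops S p \<Longrightarrow> \<delta> \<in> loops S p \<Longrightarrow> \<gamma> +++ \<delta> \<in> loops S p"
  by (simp add: loops_def path_join_imp subset_path_image_join)

lemma loops_reverse: "\<gamma> \<in> loops S p \<Longrightarrow> reversepath \<gamma> \<in> loops S p"
  by (simp add: loops_def)

lemma loops_const: "p \<in> S \<Longrightarrow> (\<lambda>_. p) \<in> loops S p"
  by (simp add: loops_def)

text \<open>The union in the definition of the product runs over representatives, all of which give
  the same class.\<close>

lemma fundamental_group_mult:
  assumes "\<gamma> \<in> loops S p" "\<delta> \<in> loops S p"
  shows "loop_class S \<gamma> \<otimes>\<^bsub>fundamental_group S p\<^esub> loop_class S \<delta> = loop_class S (\<gamma> +++ \<delta>)"
proof -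
  have "loop_class S (\<gamma>' +++ \<delta>') = loop_class S (\<gamma> +++ \<delta>)" if "\<gamma>' \<in> loop_class S \<gamma>" "\<delta>' \<in> loop_class S \<delta>" for \<gamma>' \<delta>'
  proof -
    have h: "homotopic_paths S \<gamma> \<gamma>'" "homotopic_paths S \<delta> \<delta>'" using that by (auto simp: loop_class_def)
    have "homotopic_paths S (\<gamma> +++ \<delta>) (\<gamma>' +++ \<delta>')"
      using assms by (intro homotopic_paths_join h) (auto simp: loops_def)
    then show ?thesis using loop_class_eq_iff[OF loops_join[OF assms], of "\<gamma>' +++ \<delta>'"] by simp
  qed
  then have "(\<Union>\<gamma>'\<in>loop_class S \<gamma>. \<Union>\<delta>'\<in>loop_class S \<delta>. loop_class S (\<gamma>' +++ \<delta>')) =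
      (\<Union>\<gamma>'\<in>loop_class S \<gamma>. \<Union>\<delta>'\<in>loop_class S \<delta>. loop_class S (\<gamma> +++ \<delta>))"
    by (intro SUP_cong refl) simp
  moreover have "\<gamma> \<in> loop_class S \<gamma>" "\<delta> \<in> loop_class S \<delta>" using assms by (auto simp: loops_def loop_class_def)
  then have "loop_class S \<gamma> \<noteq> {}" "loop_class S \<delta> \<noteq> {}" by blast+
  ultimately show ?thesis by (simp add: fundamental_group_def)
qed

lemma fundamental_group_simps:
  "carrier (fundamental_group S p) = loop_class S ` loops S p"
  "\<one>\<^bsub>fundamental_group S p\<^esub> = loop_class S (\<lambda>_. p)"
  by (auto simp: fundamental_group_def)

lemma fundamental_group_group:
  assumes "p \<in> S"
  shows "group (fundamental_group S p)"
proof (rule groupI)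
  let ?G = "fundamental_group S p"
  note c = loops_const[OF assms]
  show "\<one>\<^bsub>?G\<^esub> \<in> carrier ?G" using c by (auto simp: fundamental_group_simps)
  fix a assume "a \<in> carrier ?G"
  then obtain \<alpha> where a: "\<alpha> \<in> loops S p" "a = loop_class S \<alpha>" by (auto simp: fundamental_group_simps)
  have pa: "path \<alpha>" "path_image \<alpha> \<subseteq> S" "pathstart \<alpha> = p" "pathfinish \<alpha> = p" using a by (auto simp: loops_def)
  show "\<one>\<^bsub>?G\<^esub> \<otimes>\<^bsub>?G\<^esub> a = a"
    unfolding fundamental_group_simps a(2) fundamental_group_mult[OF c a(1)]
      loop_class_eq_iff[OF loops_join[OF c a(1)]]
    using homotopic_paths_const_left[OF pa(1,2)] pa by simp
  have "loop_class S (reversepath \<alpha>) \<otimes>\<^bsub>?G\<^esub> a = \<one>\<^bsub>?G\<^esub>"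
    unfolding fundamental_group_simps a(2) fundamental_group_mult[OF loops_reverse[OF a(1)] a(1)]
      loop_class_eq_iff[OF loops_join[OF loops_reverse[OF a(1)] a(1)]]
    using homotopic_paths_left_inverse[OF pa(1,2)] pa by simp
  then show "\<exists>y\<in>carrier ?G. y \<otimes>\<^bsub>?G\<^esub> a = \<one>\<^bsub>?G\<^esub>"
    using loops_reverse[OF a(1)] by (auto simp: fundamental_group_simps(1))
  fix b assume "b \<in> carrier ?G"
  then obtain \<beta> where b: "\<beta> \<in> loops S p" "b = loop_class S \<beta>" by (auto simp: fundamental_group_simps)
  show "a \<otimes>\<^bsub>?G\<^esub> b \<in> carrier ?G"
    using fundamental_group_mult[OF a(1) b(1)] loops_join[OF a(1) b(1)] a b by (simp add: fundamental_group_simps(1))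
  fix d assume "d \<in> carrier ?G"
  then obtain \<delta> where d: "\<delta> \<in> loops S p" "d = loop_class S \<delta>" by (auto simp: fundamental_group_simps)
  show "a \<otimes>\<^bsub>?G\<^esub> b \<otimes>\<^bsub>?G\<^esub> d = a \<otimes>\<^bsub>?G\<^esub> (b \<otimes>\<^bsub>?G\<^esub> d)"
    unfolding a(2) b(2) d(2) fundamental_group_mult[OF a(1) b(1)] fundamental_group_mult[OF b(1) d(1)]
      fundamental_group_mult[OF loops_join[OF a(1) b(1)] d(1)] fundamental_group_mult[OF a(1) loops_join[OF b(1) d(1)]]
      loop_class_eq_iff[OF loops_join[OF loops_join[OF a(1) b(1)] d(1)]]
    using a(1) b(1) d(1) unfolding loops_def by (intro homotopic_paths_sym[OF homotopic_paths_assoc]) auto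
qed

theorem corollary3:
  fixes S :: "'a::topological_space set"
    and K :: "nat \<Rightarrow> ((nat \<Rightarrow> real) \<Rightarrow> 'a) set"
    and p :: 'a
    and g :: "(real \<Rightarrow> 'a) set"
  assumes "special_cube_complex S K"
    and "p \<in> S"
    and "g \<in> carrier (fundamental_group S p)"
    and "g \<noteq> \<one>\<^bsub>fundamental_group S p\<^esub>"
  shows "scl (fundamental_group S p) g \<ge> ereal (1 / 24)"
proof -
  interpret special_complex S K
    using assms(1) by unfold_locales (simp_all add: special_cube_complex_def)
  define G where "G = fundamental_group S p"
  interpret G: group G unfolding G_def by (rule fundamental_group_group[OF assms(2)])
  \<comment> \<open>A chosen word for each class. Homotopy invariance makes the representative
    immaterial, and the choice is multiplicative up to \<doteq>.\<close>
  define \<rho> where "\<rho> a = (SOME w. \<exists>\<gamma>\<in>a. hol \<gamma> w)" for a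
  have \<rho>: "hol \<gamma> (\<rho> (loop_class S \<gamma>))" if "\<gamma> \<in> loops S p" for \<gamma>
  proof -
    have \<gamma>: "path \<gamma>" "path_image \<gamma> \<subseteq> S" using that by (auto simp: loops_def)
    then obtain w where "hol \<gamma> w" using hol_exists by blast
    moreover have "\<gamma> \<in> loop_class S \<gamma>" using \<gamma> by (auto simp: loop_class_def)
    ultimately have "\<exists>w. \<exists>\<delta>\<in>loop_class S \<gamma>. hol \<delta> w" by blast
    from someI_ex[OF this] obtain \<delta> where "\<delta> \<in> loop_class S \<gamma>" "hol \<delta> (\<rho> (loop_class S \<gamma>))"
      unfolding \<rho>_def by blast
    then show ?thesis using hol_homotopic homotopic_paths_sym unfolding loop_class_def by blast
  qed
  have loop: "\<exists>\<gamma>\<in>loops S p. a = loop_class S \<gamma>" if "a \<in> carrier G" for a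
    using that by (auto simp: G_def fundamental_group_simps)
  have \<rho>_mult: "\<rho> (a \<otimes>\<^bsub>G\<^esub> b) \<doteq> \<rho> a @ \<rho> b" if ab: "a \<in> carrier G" "b \<in> carrier G" for a b
  proof -
    obtain \<alpha> \<beta> where \<alpha>: "\<alpha> \<in> loops S p" "a = loop_class S \<alpha>" and \<beta>: "\<beta> \<in> loops S p" "b = loop_class S \<beta>"
      using loop ab by meson
    have "hol (\<alpha> +++ \<beta>) (\<rho> a @ \<rho> b)"
      using \<rho>[OF \<alpha>(1)] \<rho>[OF \<beta>(1)] \<alpha> \<beta> by (intro hol_join) (auto simp: loops_def)
    moreover have "hol (\<alpha> +++ \<beta>) (\<rho> (a \<otimes>\<^bsub>G\<^esub> b))"
      using \<rho>[OF loops_join[OF \<alpha>(1) \<beta>(1)]] fundamental_group_mult[OF \<alpha>(1) \<beta>(1)] \<alpha> \<beta> by (simp add: G_def)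
    ultimately show ?thesis using hol_unique by blast
  qed
  have \<rho>_one: "\<rho> \<one>\<^bsub>G\<^esub> \<doteq> []"
    using hol_unique[OF \<rho>[OF loops_const[OF assms(2)]] hol_const[OF assms(2)]]
    by (simp add: G_def fundamental_group_simps)
  have \<rho>_inv: "\<rho> (inv\<^bsub>G\<^esub> a) \<doteq> winv (\<rho> a)" if a: "a \<in> carrier G" for a
  proof -
    have "\<rho> (inv\<^bsub>G\<^esub> a) @ \<rho> a \<doteq> \<rho> (inv\<^bsub>G\<^esub> a \<otimes>\<^bsub>G\<^esub> a)" using \<rho>_mult[of "inv\<^bsub>G\<^esub> a" a] a eqw_sym by simp
    also have "\<dots> \<doteq> []" using \<rho>_one a by simp
    also have "[] \<doteq> winv (\<rho> a) @ \<rho> a" by (rule eqw_sym, rule eqw_linv)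
    finally show ?thesis by (rule eqw_cancel_right)
  qed
  have \<rho>_pow: "\<rho> (a [^]\<^bsub>G\<^esub> n) \<doteq> wpow (\<rho> a) n" if a: "a \<in> carrier G" for a and n :: nat
  proof (induction n)
    case (Suc n)
    have "\<rho> (a [^]\<^bsub>G\<^esub> Suc n) \<doteq> \<rho> (a [^]\<^bsub>G\<^esub> n) @ \<rho> a" using \<rho>_mult a by simp
    also have "\<dots> \<doteq> wpow (\<rho> a) n @ \<rho> a" using Suc by (rule eqw_append) simp
    also have "\<dots> = wpow (\<rho> a) (Suc n)" using replicate_add[of n 1 "\<rho> a"] by simp
    finally show ?case .
  qed (use \<rho>_one in simp)
  have gG: "g \<in> carrier G" using assms(3) by (simp add: G_def)
  have "\<not> \<rho> g \<doteq> []"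
  proof
    assume n: "\<rho> g \<doteq> []"
    obtain \<gamma> where \<gamma>: "\<gamma> \<in> loops S p" "g = loop_class S \<gamma>" using loop[OF gG] by blast
    then have "homotopic_paths S \<gamma> (\<lambda>_. p)"
      using \<rho>[OF \<gamma>(1)] n by (intro hol_injective[of \<gamma> p "\<rho> g"]) (auto simp: loops_def)
    then show False using assms(4) \<gamma> loop_class_eq_iff[OF \<gamma>(1)] by (simp add: fundamental_group_simps)
  qed
  from raag_quasimorphism[OF this] obtain \<phi> :: "((nat \<Rightarrow> real) \<Rightarrow> 'a) set word \<Rightarrow> int" where
    \<phi>: "\<And>u w. u \<doteq> w \<Longrightarrow> \<phi> u = \<phi> w" "\<And>u w. \<bar>\<phi> (u @ w) - \<phi> u - \<phi> w\<bar> \<le> 6" "\<And>w. \<phi> (winv w) = - \<phi> w"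
    "\<And>n. int n - 1 \<le> \<phi> (wpow (\<rho> g) n)" by blast
  define \<psi> where "\<psi> a = real_of_int (\<phi> (\<rho> a))" for a
  \<comment> \<open>The defect 6 is the parameter \<open>D\<close>, and the 1 lost in the lower
    bound at powers of \<open>g\<close> is \<open>C\<close>.\<close>
  have "ereal (1 / (4 * 6)) \<le> scl G g"
  proof (rule G.scl_ge_quasimorphism[of \<psi> 6 g 1])
    show "\<bar>\<psi> (a \<otimes>\<^bsub>G\<^esub> b) - \<psi> a - \<psi> b\<bar> \<le> 6" if "a \<in> carrier G" "b \<in> carrier G" for a b
    proof -
      have "\<phi> (\<rho> (a \<otimes>\<^bsub>G\<^esub> b)) = \<phi> (\<rho> a @ \<rho> b)" using \<phi>(1) \<rho>_mult[OF that] by blast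
      then have "\<bar>\<phi> (\<rho> (a \<otimes>\<^bsub>G\<^esub> b)) - \<phi> (\<rho> a) - \<phi> (\<rho> b)\<bar> \<le> 6" using \<phi>(2) by simp
      then show ?thesis unfolding \<psi>_def by linarith
    qed
    show "\<psi> (inv\<^bsub>G\<^esub> a) = - \<psi> a" if "a \<in> carrier G" for a
      using \<phi>(1)[OF \<rho>_inv[OF that]] \<phi>(3) by (simp add: \<psi>_def)
    show "real n - 1 \<le> \<psi> (g [^]\<^bsub>G\<^esub> n)" for n
      using \<phi>(1)[OF \<rho>_pow[OF gG, of n]] \<phi>(4)[of n] unfolding \<psi>_def by linarith
  qed (use gG in simp_all)
  then show ?thesis by (simp add: G_def)
qed

end
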